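(* Let $D_\lambda\subset\mathbb{P}^{n-1}$ be the diagonal hypersurface $X_1^d+\cdots+X_n^d=d\lambda X_1^{h_1}\cdots X_n^{h_n}$ over $\mathbb{F}_q$, where $d,n\ge2$, $h_i\ge1$, $\sum_i h_i=d$, $\gcd(d,h_1,\dots,h_n)=1$, and $dh_i\mid q-1$ for all $i$. For any $\lambda\in\mathbb{F}_q^\times$ and $w\in W$ we have $$N_1(D_\lambda;\chi^w)=\begin{cases}\dfrac{(-1)^n}{q^{\delta(m)}}\,j(\varphi_d^w)^{1-\delta(m)}F^w(\lambda)+\dfrac{1-q^{n-1}}{1-q}+\dfrac{(-1)^{n-1}}{q}+C & (\text{if } w=mh \text{ for some } m\in\{0,\dots,d-1\}),\\[2mm] (-1)^n j(\varphi_d^w)F^w(\lambda)+C & (\text{if } w\not\sim0),\end{cases}$$ where $\delta(m)=1$ if $m=0$ and $\delta(m)=0$ otherwise, and $$C=(-1)^{n-1}\sum_{\substack{w'\in W,\ w'\sim w\\ w'_i=0\text{ for some but not all } i}} j(\varphi_d^{w'}).$$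
   Context: **Characters and hypergeometric functions.** Let $\widehat{\mathbb{F}_q^\times}=\mathrm{Hom}(\mathbb{F}_q^\times,\overline{\mathbb{Q}}^\times)$, with trivial character $\varepsilon$; put $\eta(0)=0$ for every $\eta$ (including $\varepsilon$), and $\delta(\eta)=1$ if $\eta=\varepsilon$, $0$ otherwise. Fix a nontrivial additive character $\psi$ of $\mathbb{F}_q$ and put $g(\eta)=-\sum_{x\in \mathbb{F}_q^\times}\eta(x)\psi(x)$, $g^\circ(\eta)=q^{\delta(\eta)}g(\eta)$, $(\alpha)_\nu=g(\alpha\nu)/g(\alpha)$, $(\alpha)_\nu^\circ=g^\circ(\alpha\nu)/g^\circ(\alpha)$, and $$F(\alpha_1,\dots,\alpha_m;\beta_1,\dots,\beta_m;z)_q=\frac{1}{1-q}\sum_{\nu\in\widehat{\mathbb{F}_q^\times}}\frac{(\alpha_1)_\nu\cdots(\alpha_m)_\nu}{(\beta_1)^\circ_\nu\cdots(\beta_m)^\circ_\nu}\,\nu(z).$$ Jacobi sum: $j(\eta_1,\dots,\eta_n)=(-1)^{n-1}\sum_{x_i\in\mathbb{F}_q^\times,\ x_1+\cdots+x_n=1}\eta_1(x_1)\cdots\eta_n(x_n)$. Fix a generator $\varphi$ of $\widehat{\mathbb{F}_q^\times}$; for $m\mid q-1$ put $\varphi_m=\varphi^{(q-1)/m}$. Write $j(\varphi_d^w)=j(\varphi_d^{w_1},\dots,\varphi_d^{w_n})$. **Group action and point counts.** Let $h=(h_1,\dots,h_n)$, $\mu_d\subset\mathbb{F}_q^\times$ the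 $d$th roots of unity, $\widetilde G=\{\xi\in\mu_d^n\mid \xi_1^{h_1}\cdots\xi_n^{h_n}=1\}$, $\Delta\subset\widetilde G$ the diagonal subgroup, $G=\widetilde G/\Delta$, acting on $D_\lambda$ by coordinatewise multiplication. Let $W=\{w\in(\mathbb{Z}/d\mathbb{Z})^n\mid w_1+\cdots+w_n=0\}$. For $w\in W$, $\chi^w(\xi)=\varphi(\xi_1^{w_1}\cdots\xi_n^{w_n})$ defines a character of $G$. Write $w\sim w'$ if $\chi^w=\chi^{w'}$, equivalently $w-w'=mh$ in $(\mathbb{Z}/d\mathbb{Z})^n$ for some $m\in\{0,\dots,d-1\}$. With $\Phi$ the $q$-Frobenius, $$N_1(D_\lambda;\chi^w)=\frac{1}{\#G}\sum_{\xi\in G}\chi^w(\xi)\,\#\{X\in D_\lambda(\overline{\mathbb{F}_q})\mid \xi^{-1}\Phi(X)=X\}.$$ **The function $F^w$.** $F^w(\lambda)$ is the value $F(\cdots;\varepsilon,\varphi_d,\dots,\varphi_d^{d-1};(\prod_{j=1}^n h_j^{h_j})\lambda^d)_q$ whose $d$ upper parameters are $\varphi_{dh_i}^{w_i},\varphi_{dh_i}^{w_i+d},\dots,\varphi_{dh_i}^{w_i+d(h_i-1)}$ for $i=1,\dots,n$, where in the exponents $w_i$ means its representative in $\{0,\dots,d-1\}$. *)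

theory Defs
  imports "HOL-Algebra.Algebraic_Closure_Type" "HOL-Library.Cardinality"
begin

text \<open>
  The finite field with q elements is a type \<open>'a :: {field, finite}\<close>, so q is \<open>CARD('a)\<close>.  Its
  algebraic closure is \<open>'a alg_closure\<close>, with embedding \<^const>\<open>to_ac\<close>; characters take
  values in \<open>rat alg_closure\<close>.  An n-tuple is a function on \<open>{1..n}\<close> that is \<^const>\<open>undefined\<close>
  elsewhere.
\<close>

type_synonym qbar = "rat alg_closure"


subsection \<open>Characters\<close>

text \<open>Multiplicative characters are extended by 0 at 0; this includes the trivial one.\<close>

definition mult_chars :: "('a::{field,finite} \<Rightarrow> qbar) set" where
  "mult_chars =
     {\<eta>. \<eta> 0 = 0 \<and> (\<forall>x. x \<noteq> 0 \<longrightarrow> \<eta> x \<noteq> 0) \<and> (\<forall>x y. \<eta> (x * y) = \<eta> x * \<eta> y)}"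

definition triv_char :: "'a::{field,finite} \<Rightarrow> qbar" where
  "triv_char x = (if x = 0 then 0 else 1)"

definition char_mult :: "('a::{field,finite} \<Rightarrow> qbar) \<Rightarrow> ('a \<Rightarrow> qbar) \<Rightarrow> 'a \<Rightarrow> qbar" where
  "char_mult \<alpha> \<nu> x = \<alpha> x * \<nu> x"

text \<open>The case distinction matters for \<open>k = 0\<close>: the 0th power is the trivial character, which
  vanishes at 0.\<close>

definition char_pow :: "('a::{field,finite} \<Rightarrow> qbar) \<Rightarrow> nat \<Rightarrow> 'a \<Rightarrow> qbar" where
  "char_pow \<eta> k x = (if x = 0 then 0 else \<eta> x ^ k)"

definition char_generator :: "('a::{field,finite} \<Rightarrow> qbar) \<Rightarrow> bool" where
  "char_generator \<phi> \<longleftrightarrow> \<phi> \<in> mult_chars \<and> (\<forall>\<eta>\<in>mult_chars. \<exists>k. \<eta> = char_pow \<phi> k)"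

definition nontrivial_add_char :: "('a::{field,finite} \<Rightarrow> qbar) \<Rightarrow> bool" where
  "nontrivial_add_char \<psi> \<longleftrightarrow>
     (\<forall>x. \<psi> x \<noteq> 0) \<and> (\<forall>x y. \<psi> (x + y) = \<psi> x * \<psi> y) \<and> (\<exists>x. \<psi> x \<noteq> 1)"

text \<open>\<open>char_root \<phi> m\<close> is the character of order m obtained from the generator; it is meant for
  m dividing q - 1.\<close>

definition char_root :: "('a::{field,finite} \<Rightarrow> qbar) \<Rightarrow> nat \<Rightarrow> 'a \<Rightarrow> qbar" where
  "char_root \<phi> m = char_pow \<phi> ((CARD('a) - 1) div m)"


subsection \<open>Gauss sums, Jacobi sums and hypergeometric functions\<close>

definition gauss_sum :: "('a::{field,finite} \<Rightarrow> qbar) \<Rightarrow> ('a \<Rightarrow> qbar) \<Rightarrow> qbar" where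
  "gauss_sum \<psi> \<eta> = - (\<Sum>x\<in>UNIV - {0}. \<eta> x * \<psi> x)"

definition gauss_sum0 :: "('a::{field,finite} \<Rightarrow> qbar) \<Rightarrow> ('a \<Rightarrow> qbar) \<Rightarrow> qbar" where
  "gauss_sum0 \<psi> \<eta> = of_nat CARD('a) ^ (if \<eta> = triv_char then 1 else 0) * gauss_sum \<psi> \<eta>"

definition poch :: "('a::{field,finite} \<Rightarrow> qbar) \<Rightarrow> ('a \<Rightarrow> qbar) \<Rightarrow> ('a \<Rightarrow> qbar) \<Rightarrow> qbar" where
  "poch \<psi> \<alpha> \<nu> = gauss_sum \<psi> (char_mult \<alpha> \<nu>) / gauss_sum \<psi> \<alpha>"

definition poch0 :: "('a::{field,finite} \<Rightarrow> qbar) \<Rightarrow> ('a \<Rightarrow> qbar) \<Rightarrow> ('a \<Rightarrow> qbar) \<Rightarrow> qbar" where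
  "poch0 \<psi> \<alpha> \<nu> = gauss_sum0 \<psi> (char_mult \<alpha> \<nu>) / gauss_sum0 \<psi> \<alpha>"

definition hyperF ::
  "('a::{field,finite} \<Rightarrow> qbar) \<Rightarrow> ('a \<Rightarrow> qbar) list \<Rightarrow> ('a \<Rightarrow> qbar) list \<Rightarrow> 'a \<Rightarrow> qbar" where
  "hyperF \<psi> \<alpha>s \<beta>s z =
     1 / (1 - of_nat CARD('a)) *
     (\<Sum>\<nu>\<in>mult_chars. (\<Prod>\<alpha>\<leftarrow>\<alpha>s. poch \<psi> \<alpha> \<nu>) / (\<Prod>\<beta>\<leftarrow>\<beta>s. poch0 \<psi> \<beta> \<nu>) * \<nu> z)"

definition jacobi_sum :: "nat \<Rightarrow> (nat \<Rightarrow> 'a::{field,finite} \<Rightarrow> qbar) \<Rightarrow> qbar" where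
  "jacobi_sum n \<eta> =
     (-1) ^ (n - 1) *
     (\<Sum>x \<in> {x \<in> {1..n} \<rightarrow>\<^sub>E UNIV - {0}. (\<Sum>i=1..n. x i) = 1}. \<Prod>i=1..n. \<eta> i (x i))"

definition jacobi_w ::
  "('a::{field,finite} \<Rightarrow> qbar) \<Rightarrow> nat \<Rightarrow> nat \<Rightarrow> (nat \<Rightarrow> nat) \<Rightarrow> qbar" where
  "jacobi_w \<phi> d n w = jacobi_sum n (\<lambda>i. char_pow (char_root \<phi> d) (w i))"

definition Fw ::
  "('a::{field,finite} \<Rightarrow> qbar) \<Rightarrow> ('a \<Rightarrow> qbar) \<Rightarrow> nat \<Rightarrow> nat \<Rightarrow> (nat \<Rightarrow> nat) \<Rightarrow> (nat \<Rightarrow> nat) \<Rightarrow> 'a \<Rightarrow> qbar"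
  where
  "Fw \<psi> \<phi> d n h w lam =
     hyperF \<psi>
       (concat (map (\<lambda>i. map (\<lambda>k. char_pow (char_root \<phi> (d * h i)) (w i + d * k)) [0..<h i])
                    [1..<n+1]))
       (map (char_pow (char_root \<phi> d)) [0..<d])
       (of_nat (\<Prod>j=1..n. h j ^ h j) * lam ^ d)"


subsection \<open>Projective points and the diagonal hypersurface\<close>

text \<open>A point of projective (n-1)-space is the set of all its homogeneous coordinate vectors.\<close>

definition proj_space :: "nat \<Rightarrow> (nat \<Rightarrow> 'k::field) set set" where
  "proj_space n =
     {{(\<lambda>i\<in>{1..n}. c * x i) | c. c \<noteq> 0} | x. x \<in> {1..n} \<rightarrow>\<^sub>E UNIV \<and> (\<exists>i\<in>{1..n}. x i \<noteq> 0)}"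

definition diag_hyp ::
  "nat \<Rightarrow> nat \<Rightarrow> (nat \<Rightarrow> nat) \<Rightarrow> 'a::{field,finite} \<Rightarrow> (nat \<Rightarrow> 'a alg_closure) set set" where
  "diag_hyp d n h lam =
     {P \<in> proj_space n.
        \<forall>x\<in>P. (\<Sum>i=1..n. x i ^ d) = of_nat d * to_ac lam * (\<Prod>i=1..n. x i ^ h i)}"

definition frob ::
  "nat \<Rightarrow> (nat \<Rightarrow> 'a::{field,finite} alg_closure) set \<Rightarrow> (nat \<Rightarrow> 'a alg_closure) set" where
  "frob n P = (\<lambda>x. \<lambda>i\<in>{1..n}. x i ^ CARD('a)) ` P"


subsection \<open>The group and its characters\<close>

definition mu :: "nat \<Rightarrow> 'a::{field,finite} set" where
  "mu d = {x. x ^ d = 1}"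

definition Gtilde :: "nat \<Rightarrow> nat \<Rightarrow> (nat \<Rightarrow> nat) \<Rightarrow> (nat \<Rightarrow> 'a::{field,finite}) monoid" where
  "Gtilde d n h =
     \<lparr>carrier = {\<xi> \<in> {1..n} \<rightarrow>\<^sub>E mu d. (\<Prod>i=1..n. \<xi> i ^ h i) = 1},
      monoid.mult = (\<lambda>\<xi> \<zeta>. \<lambda>i\<in>{1..n}. \<xi> i * \<zeta> i),
      one = (\<lambda>i\<in>{1..n}. 1)\<rparr>"

definition Delta :: "nat \<Rightarrow> nat \<Rightarrow> (nat \<Rightarrow> 'a::{field,finite}) set" where
  "Delta d n = {(\<lambda>i\<in>{1..n}. c) | c. c \<in> mu d}"

definition Ggrp :: "nat \<Rightarrow> nat \<Rightarrow> (nat \<Rightarrow> nat) \<Rightarrow> (nat \<Rightarrow> 'a::{field,finite}) set monoid" where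
  "Ggrp d n h = Gtilde d n h Mod Delta d n"

text \<open>Elements of the quotient group are cosets A; they act by multiplying a representative of the
  coset with a representative of the point, and letting both vary gives the whole resulting point
  (see \<open>act_coset\<close> below).\<close>

definition act ::
  "nat \<Rightarrow> (nat \<Rightarrow> 'a::{field,finite}) set \<Rightarrow> (nat \<Rightarrow> 'a alg_closure) set \<Rightarrow> (nat \<Rightarrow> 'a alg_closure) set"
  where
  "act n A P = {(\<lambda>i\<in>{1..n}. to_ac (\<xi> i) * x i) | \<xi> x. \<xi> \<in> A \<and> x \<in> P}"

text \<open>Tuples over the integers modulo d are given by representatives in \<open>{0..<d}\<close>.\<close>

definition Wset :: "nat \<Rightarrow> nat \<Rightarrow> (nat \<Rightarrow> nat) set" where
  "Wset d n = {w \<in> {1..n} \<rightarrow>\<^sub>E {0..<d}. (\<Sum>i=1..n. w i) mod d = 0}"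

definition zero_vec :: "nat \<Rightarrow> nat \<Rightarrow> nat" where
  "zero_vec n = (\<lambda>i\<in>{1..n}. 0)"

definition mult_vec :: "nat \<Rightarrow> nat \<Rightarrow> nat \<Rightarrow> (nat \<Rightarrow> nat) \<Rightarrow> nat \<Rightarrow> nat" where
  "mult_vec d n m h = (\<lambda>i\<in>{1..n}. (m * h i) mod d)"

text \<open>The value on a coset is the common value on its elements (see \<open>chi_coset\<close> below).\<close>

definition chi ::
  "('a::{field,finite} \<Rightarrow> qbar) \<Rightarrow> nat \<Rightarrow> (nat \<Rightarrow> nat) \<Rightarrow> (nat \<Rightarrow> 'a) set \<Rightarrow> qbar" where
  "chi \<phi> n w A = the_elem ((\<lambda>\<xi>. \<phi> (\<Prod>i=1..n. \<xi> i ^ w i)) ` A)"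

definition char_sim ::
  "('a::{field,finite} \<Rightarrow> qbar) \<Rightarrow> nat \<Rightarrow> nat \<Rightarrow> (nat \<Rightarrow> nat) \<Rightarrow> (nat \<Rightarrow> nat) \<Rightarrow> (nat \<Rightarrow> nat) \<Rightarrow> bool"
  where
  "char_sim \<phi> d n h w w' \<longleftrightarrow> (\<forall>A\<in>carrier (Ggrp d n h). chi \<phi> n w A = chi \<phi> n w' A)"

definition N1 ::
  "('a::{field,finite} \<Rightarrow> qbar) \<Rightarrow> nat \<Rightarrow> nat \<Rightarrow> (nat \<Rightarrow> nat) \<Rightarrow> 'a \<Rightarrow> (nat \<Rightarrow> nat) \<Rightarrow> qbar" where
  "N1 \<phi> d n h lam w =
     1 / of_nat (Coset.order (Ggrp d n h :: (nat \<Rightarrow> 'a) set monoid)) *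
     (\<Sum>A\<in>carrier (Ggrp d n h). chi \<phi> n w A *
        of_nat (card {P \<in> diag_hyp d n h lam. act n (inv\<^bsub>Ggrp d n h\<^esub> A) (frob n P) = P}))"

definition Cterm ::
  "('a::{field,finite} \<Rightarrow> qbar) \<Rightarrow> nat \<Rightarrow> nat \<Rightarrow> (nat \<Rightarrow> nat) \<Rightarrow> (nat \<Rightarrow> nat) \<Rightarrow> qbar" where
  "Cterm \<phi> d n h w =
     (-1) ^ (n - 1) *
     (\<Sum>w' \<in> {w' \<in> Wset d n. char_sim \<phi> d n h w' w \<and>
                 (\<exists>i\<in>{1..n}. w' i = 0) \<and> \<not> (\<forall>i\<in>{1..n}. w' i = 0)}.
        jacobi_w \<phi> d n w')"


subsection \<open>The quotient constructions are well defined\<close>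

lemma mu_nonzero: "d \<noteq> 0 \<Longrightarrow> x \<in> mu d \<Longrightarrow> x \<noteq> 0"
  by (auto simp: mu_def power_0_left)

lemma comm_group_Gtilde:
  assumes "d \<noteq> 0"
  shows "comm_group (Gtilde d n h :: (nat \<Rightarrow> 'a::{field,finite}) monoid)"
proof (rule comm_groupI)
  fix x :: "nat \<Rightarrow> 'a" assume x: "x \<in> carrier (Gtilde d n h)"
  have nz: "x i \<noteq> 0" if "i \<in> {1..n}" for i
    using x that assms mu_nonzero[of d "x i"] by (auto simp: Gtilde_def PiE_def Pi_def)
  have p: "(\<Prod>i=1..n. (inverse (x i)) ^ h i) = inverse (\<Prod>i=1..n. x i ^ h i)"
    by (simp add: power_inverse flip: prod_inversef)
  have "(\<lambda>i\<in>{1..n}. inverse (x i)) \<in> carrier (Gtilde d n h)"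
    using x p by (auto simp: Gtilde_def mu_def PiE_def Pi_def power_inverse)
  moreover have "(\<lambda>i\<in>{1..n}. inverse (x i)) \<otimes>\<^bsub>Gtilde d n h\<^esub> x = \<one>\<^bsub>Gtilde d n h\<^esub>"
    using nz by (auto simp: Gtilde_def fun_eq_iff)
  ultimately show "\<exists>y\<in>carrier (Gtilde d n h). y \<otimes>\<^bsub>Gtilde d n h\<^esub> x = \<one>\<^bsub>Gtilde d n h\<^esub>" by blast
qed (auto simp: Gtilde_def mu_def PiE_def Pi_def power_mult_distrib prod.distrib fun_eq_iff
       extensional_def mult_ac)

lemma normal_Delta:
  assumes "d \<noteq> 0" and "(\<Sum>i=1..n. h i) = d"
  shows "Delta d n \<lhd> (Gtilde d n h :: (nat \<Rightarrow> 'a::{field,finite}) monoid)"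
proof -
  interpret comm_group "Gtilde d n h :: (nat \<Rightarrow> 'a) monoid"
    by (rule comm_group_Gtilde) fact
  have sub: "Delta d n \<subseteq> carrier (Gtilde d n h :: (nat \<Rightarrow> 'a) monoid)"
    using assms(2) by (auto simp: Delta_def Gtilde_def mu_def simp flip: power_sum)
  have "subgroup (Delta d n) (Gtilde d n h :: (nat \<Rightarrow> 'a) monoid)"
  proof (rule subgroupI[OF sub])
    have "(\<lambda>i\<in>{1..n}. 1) \<in> (Delta d n :: (nat \<Rightarrow> 'a) set)"
      unfolding Delta_def mu_def by (intro CollectI exI[of _ 1]) auto
    then show "Delta d n \<noteq> ({} :: (nat \<Rightarrow> 'a) set)" by blast
  next
    fix a :: "nat \<Rightarrow> 'a" assume a: "a \<in> Delta d n"
    then obtain c where c: "a = (\<lambda>i\<in>{1..n}. c)" "c \<in> mu d" by (auto simp: Delta_def)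
    have c0: "c \<noteq> 0" using mu_nonzero assms(1) c(2) by blast
    have D: "(\<lambda>i\<in>{1..n}. inverse c) \<in> Delta d n"
      unfolding Delta_def mu_def using c(2)
      by (intro CollectI exI[of _ "inverse c"]) (auto simp: mu_def power_inverse)
    have "(\<lambda>i\<in>{1..n}. inverse c) \<otimes>\<^bsub>Gtilde d n h\<^esub> a = \<one>\<^bsub>Gtilde d n h\<^esub>"
      using c c0 by (auto simp: Gtilde_def fun_eq_iff)
    then have "inv\<^bsub>Gtilde d n h\<^esub> a = (\<lambda>i\<in>{1..n}. inverse c)"
      using D a sub by (meson inv_equality subsetD)
    then show "inv\<^bsub>Gtilde d n h\<^esub> a \<in> Delta d n" using D by simp
  next
    fix a b :: "nat \<Rightarrow> 'a" assume "a \<in> Delta d n" "b \<in> Delta d n"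
    then obtain c e where "a = (\<lambda>i\<in>{1..n}. c)" "b = (\<lambda>i\<in>{1..n}. e)" "c \<in> mu d" "e \<in> mu d"
      by (auto simp: Delta_def)
    then show "a \<otimes>\<^bsub>Gtilde d n h\<^esub> b \<in> Delta d n"
      unfolding Delta_def
      by (intro CollectI exI[of _ "c * e"])
         (auto simp: Gtilde_def mu_def power_mult_distrib fun_eq_iff)
  qed
  then show ?thesis using normal_iff_subgroup by blast
qed

lemma coset_Delta:
  "Delta d n #>\<^bsub>Gtilde d n h\<^esub> \<xi> = {(\<lambda>i\<in>{1..n}. c * \<xi> i) | c. c \<in> mu d}"
proof -
  have "Delta d n #>\<^bsub>Gtilde d n h\<^esub> \<xi>
      = (\<lambda>\<zeta>. \<zeta> \<otimes>\<^bsub>Gtilde d n h\<^esub> \<xi>) ` (\<lambda>c. \<lambda>i\<in>{1..n}. c) ` mu d"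
    unfolding r_coset_def Delta_def by blast
  also have "\<dots> = (\<lambda>c. \<lambda>i\<in>{1..n}. c * \<xi> i) ` mu d"
    unfolding image_image by (intro image_cong refl) (simp add: Gtilde_def cong: restrict_cong)
  finally show ?thesis by blast
qed

lemma chi_coset:
  fixes \<xi> :: "nat \<Rightarrow> 'a::{field,finite}"
  assumes "w \<in> Wset d n"
  shows "chi \<phi> n w (Delta d n #>\<^bsub>Gtilde d n h\<^esub> \<xi>) = \<phi> (\<Prod>i=1..n. \<xi> i ^ w i)"
proof -
  have "(\<Prod>i=1..n. (c * \<xi> i) ^ w i) = (\<Prod>i=1..n. \<xi> i ^ w i)" if "c \<in> mu d" for c :: 'a
  proof -
    obtain k where "(\<Sum>i=1..n. w i) = d * k" using assms by (auto simp: Wset_def)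
    then have "c ^ (\<Sum>i=1..n. w i) = 1" using that by (simp add: mu_def power_mult)
    then show ?thesis by (simp add: power_mult_distrib prod.distrib power_sum)
  qed
  then have "(\<lambda>\<zeta>. \<phi> (\<Prod>i=1..n. \<zeta> i ^ w i)) ` (Delta d n #>\<^bsub>Gtilde d n h\<^esub> \<xi>)
      = (\<lambda>c. \<phi> (\<Prod>i=1..n. \<xi> i ^ w i)) ` (mu d :: 'a set)"
    unfolding coset_Delta Setcompr_eq_image image_image by (simp cong: image_cong_simp)
  also have "\<dots> = {\<phi> (\<Prod>i=1..n. \<xi> i ^ w i)}"
    by (rule image_constant[of 1]) (simp add: mu_def)
  finally have "(\<lambda>\<zeta>. \<phi> (\<Prod>i=1..n. \<zeta> i ^ w i)) ` (Delta d n #>\<^bsub>Gtilde d n h\<^esub> \<xi>)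
      = {\<phi> (\<Prod>i=1..n. \<xi> i ^ w i)}" .
  then show ?thesis by (simp add: chi_def)
qed

lemma act_coset:
  fixes \<xi> :: "nat \<Rightarrow> 'a::{field,finite}"
  assumes "d \<noteq> 0"
  shows "act n (Delta d n #>\<^bsub>Gtilde d n h\<^esub> \<xi>) {(\<lambda>i\<in>{1..n}. c * x i) | c. c \<noteq> 0}
       = {(\<lambda>i\<in>{1..n}. c * (to_ac (\<xi> i) * x i)) | c. c \<noteq> 0}" (is "?L = ?R")
proof -
  have eq: "(\<lambda>i\<in>{1..n}. to_ac ((\<lambda>i\<in>{1..n}. c * \<xi> i) i) * (\<lambda>i\<in>{1..n}. e * x i) i)
      = (\<lambda>i\<in>{1..n}. (to_ac c * e) * (to_ac (\<xi> i) * x i))" for c e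
    by (simp add: mult_ac cong: restrict_cong)
  have "?L = {(\<lambda>i\<in>{1..n}. (to_ac c * e) * (to_ac (\<xi> i) * x i)) | c e. c \<in> mu d \<and> e \<noteq> 0}"
    unfolding act_def coset_Delta eq[symmetric] by blast
  also have "\<dots> = ?R" (is "?M = _")
  proof
    show "?M \<subseteq> ?R"
    proof
      fix y assume "y \<in> ?M"
      then obtain c e where ce: "c \<in> mu d" "e \<noteq> 0"
        "y = (\<lambda>i\<in>{1..n}. (to_ac c * e) * (to_ac (\<xi> i) * x i))" by blast
      have "to_ac c * e \<noteq> 0" using ce mu_nonzero[OF assms] by simp
      then show "y \<in> ?R" using ce(3) by blast
    qed
    have one: "(1::'a) \<in> mu d" by (simp add: mu_def)
    show "?R \<subseteq> ?M"
    proof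
      fix y assume "y \<in> ?R"
      then obtain c where c: "c \<noteq> 0" "y = (\<lambda>i\<in>{1..n}. c * (to_ac (\<xi> i) * x i))" by blast
      then have "y = (\<lambda>i\<in>{1..n}. (to_ac 1 * c) * (to_ac (\<xi> i) * x i))" by simp
      then show "y \<in> ?M" using one c(1) by blast
    qed
  qed
  finally show ?thesis .
qed

end

theory Submission
  imports Defs
    "HOL-Algebra.Multiplicative_Group" "HOL-Algebra.Sylow"
    "HOL-Computational_Algebra.Formal_Power_Series"
begin

text \<open>
  The average that defines \<open>N\<^sub>1(D\<^sub>\<lambda>; \<chi>\<^sup>w)\<close> is a weighted count of vectors. A fixed point of
  \<open>\<xi>\<inverse>\<Phi>\<close> is a line spanned by a vector x over the algebraic closure with \<open>x\<^sub>i\<^sup>q = \<xi>\<^sub>i x\<^sub>i\<close>,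
  and there are q - 1 such vectors on it. Their d-th powers \<open>y\<^sub>i = x\<^sub>i\<^sup>d\<close> lie in the ground
  field, and where \<open>x\<^sub>i \<noteq> 0\<close> the twist \<open>\<xi>\<^sub>i = y\<^sub>i\<^bsup>(q-1)/d\<^esup>\<close> is determined by \<open>y\<^sub>i\<close>. So
  \<open>\<chi>\<^sup>w(\<xi>)\<close> becomes \<open>\<Prod>\<phi>\<^sub>d\<^bsup>w\<^sub>i\<^esup>(y\<^sub>i)\<close>, and the count becomes a character sum over points y
  with coordinates in the ground field.

  If all coordinates are nonzero, the condition on y is that \<open>t = \<Sum>y\<^sub>i / (d\<lambda>)\<close> satisfies
  \<open>t\<^sup>d = \<Prod>y\<^sub>i\<^bsup>h\<^sub>i\<^esup>\<close>. It is homogeneous of degree d, so y may be normalised to \<open>\<Sum>y\<^sub>i = 1\<close>,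
  and orthogonality of characters gives a sum over \<open>\<nu>\<close> of \<open>\<nu>((d\<lambda>)\<^sup>d)\<close> times the Jacobi sum
  of the characters \<open>\<phi>\<^sub>d\<^bsup>w\<^sub>i\<^esup>\<nu>\<^bsup>h\<^sub>i\<^esup>\<close> (\<open>full_sum_eq_jacobi_sums\<close>). Jacobi sums are quotients
  of Gauss sums (\<open>jacobi_sum_eq_gauss_sums\<close>), except for a correction when all characters
  are trivial, which happens for exactly one \<open>\<nu>\<close> if w is a multiple of h and for none
  otherwise. On the other side, the product formula of Hasse and Davenport collapses the
  parameters of the hypergeometric function, so that its terms are the same quotients of
  Gauss sums (\<open>Fw_eq\<close>).

  If some coordinate vanishes, the equation loses its right-hand side. Orthogonality on
  \<open>\<mu>\<^sub>d\<close> replaces the average over the tuples with \<open>\<Prod>\<xi>\<^sub>i\<^bsup>h\<^sub>i\<^esup> = 1\<close> by averages over all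
  tuples of d-th roots of unity, one for each \<open>w' = w + mh\<close>, that is, for each \<open>w' \<sim> w\<close>.
  Each is a character sum over a hyperplane: it vanishes if no \<open>w'\<^sub>i\<close> is 0, gives a Jacobi
  sum, hence a term of C, if some but not all are 0, and is elementary if \<open>w' = 0\<close>
  (\<open>zero_part_eq\<close>). The value for \<open>w' = 0\<close> cancels the correction above, up to the terms of
  the formula that are rational functions of q.

  The product formula \<open>hasse_davenport_product\<close> itself is proved with L-functions of
  polynomials over the finite field. Attach to a monic polynomial the value \<open>\<alpha>\<^sup>m\<close> of the
  product of its roots times \<open>\<psi>\<close> of the sum of the m-th powers of its roots. As the
  characters of order dividing m count the m-th roots of an element, the L-function of this
  weight is the product over k < m of those of the weights \<open>\<alpha>\<phi>\<^sub>m\<^sup>k\<close> of the product times \<open>\<psi>\<close>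
  of the sum of the roots, and each of these is the linear polynomial \<open>1 - g(\<alpha>\<phi>\<^sub>m\<^sup>k) T\<close>. So
  the product of the m Gauss sums is, up to sign, the coefficient of degree m. But the m-th
  power sum of the roots of a polynomial of degree m is -m times the constant coefficient
  plus a function of the other coefficients; hence this coefficient factors into a Gauss sum
  of \<open>\<alpha>\<^sup>m\<close> and a constant in which \<open>\<alpha>\<close> does not occur. To avoid Euler products, polynomials
  are replaced by their Frobenius-stable multisets of roots, where the logarithmic
  derivative of the L-function is a count of closed walks (\<open>newton_stable_msets\<close>).
\<close>


section \<open>Finite fields and their algebraic closure\<close>

lemma power_mod_order:
  fixes x :: "'b::monoid_mult"
  assumes "x ^ N = 1"
  shows "x ^ (i mod N) = x ^ i"
proof -
  have "x ^ i = (x ^ N) ^ (i div N) * x ^ (i mod N)"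
    unfolding power_mult[symmetric] power_add[symmetric] by simp
  then show ?thesis using assms by simp
qed

lemma finite_field_power_card_minus_1:
  fixes x :: "'a::{field,finite}"
  assumes "x \<noteq> 0"
  shows "x ^ (CARD('a) - 1) = 1"
proof -
  have "bij_betw ((*) x) (UNIV - {0}) (UNIV - {0})"
    by (rule bij_betw_byWitness[of _ "\<lambda>y. y / x"]) (use assms in auto)
  then have "(\<Prod>y\<in>UNIV - {0}. x * y) = \<Prod>(UNIV - {0})"
    by (rule prod.reindex_bij_betw)
  moreover have "\<Prod>(UNIV - {0::'a}) \<noteq> 0" by simp
  ultimately show ?thesis by (simp add: prod.distrib card_Diff_singleton)
qed

lemma card_field_ge_2: "CARD('a::{field,finite}) \<ge> 2"
proof -
  have "card {0, 1::'a} \<le> CARD('a)" by (rule card_mono) auto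
  then show ?thesis by simp
qed

lemma finite_field_generator:
  obtains g :: "'a::{field,finite}"
  where "g \<noteq> 0" "bij_betw (\<lambda>i. g ^ i) {..<CARD('a) - 1} (UNIV - {0})"
proof -
  define R where "R = (ring_of_type_algebra :: 'a ring)"
  interpret R: Ring.field R unfolding R_def by (rule field_from_type_algebra)
  have carr: "carrier (Multiplicative_Group.mult_of R) = UNIV - {0}"
    unfolding Multiplicative_Group.carrier_mult_of by (simp add: R_def ring_of_type_algebra_def)
  have pow: "a [^]\<^bsub>R\<^esub> i = a ^ i" for a :: 'a and i :: nat
    by (induction i) (simp_all add: R_def ring_of_type_algebra_def mult.commute)
  have "finite (carrier R)" by (simp add: R_def ring_of_type_algebra_def)
  from R.finite_field_mult_group_has_gen[OF this]
  obtain g where g: "g \<in> carrier (Multiplicative_Group.mult_of R)" "carrier (Multiplicative_Group.mult_of R) = {g [^]\<^bsub>R\<^esub> i |i::nat. i \<in> UNIV}"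
    by blast
  have g0: "g \<noteq> 0" using g(1) unfolding carr by simp
  let ?N = "CARD('a) - 1"
  have card: "card (UNIV - {0::'a}) = ?N" by (simp add: card_Diff_singleton)
  have N: "?N > 0" using card_field_ge_2[where 'a = 'a] by simp
  have "(\<lambda>i. g ^ i) ` {..<?N} = UNIV - {0}"
  proof -
    have "x \<in> (\<lambda>i. g ^ i) ` {..<?N}" if x: "x \<noteq> 0" for x
    proof -
      have "x \<in> {g [^]\<^bsub>R\<^esub> i |i::nat. i \<in> UNIV}"
        using x unfolding g(2)[symmetric] carr by simp
      then obtain i where i: "x = g ^ i" unfolding pow by blast
      then show ?thesis
        using N power_mod_order[OF finite_field_power_card_minus_1[OF g0], of i]
        by (auto intro!: image_eqI[of _ _ "i mod ?N"])
    qed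
    then show ?thesis using g0 by auto
  qed
  moreover from this have "inj_on (\<lambda>i. g ^ i) {..<?N}"
    by (intro eq_card_imp_inj_on) (simp_all add: card)
  ultimately show ?thesis using that[OF g0] by (simp add: bij_betw_def)
qed

lemma finite_field_power_card:
  fixes x :: "'a::{field,finite}"
  shows "x ^ CARD('a) = x"
proof (cases "x = 0")
  case False
  have "x ^ CARD('a) = x * x ^ (CARD('a) - 1)"
    using card_field_ge_2[where 'a = 'a] by (metis One_nat_def Suc_1 Suc_le_D diff_Suc_1 power_Suc)
  then show ?thesis using finite_field_power_card_minus_1[OF False] by simp
qed (use card_field_ge_2[where 'a = 'a] in \<open>simp add: power_0_left\<close>)

text \<open>The powers of a primitive element that lie in the group of d-th roots of unity are the
  powers of its ((q - 1) / d)-th power.\<close>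

lemma card_mu:
  assumes "d dvd CARD('a::{field,finite}) - 1"
  shows "card (mu d :: 'a set) = d"
proof -
  obtain g :: 'a where g: "g \<noteq> 0" "bij_betw (\<lambda>i. g ^ i) {..<CARD('a) - 1} (UNIV - {0})"
    by (rule finite_field_generator)
  let ?N = "CARD('a) - 1"
  have N: "?N > 0" using card_field_ge_2[where 'a = 'a] by simp
  obtain e where e: "?N = d * e" using assms by blast
  have d0: "d > 0" and e0: "e > 0" using e N by (auto intro: Nat.gr0I)
  have one: "g ^ i = 1 \<longleftrightarrow> ?N dvd i" for i
  proof
    assume "?N dvd i"
    then show "g ^ i = 1" using finite_field_power_card_minus_1[OF g(1)] by (auto simp: power_mult)
  next
    assume "g ^ i = 1"
    then have "g ^ (i mod ?N) = g ^ 0"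
      by (simp only: power_mod_order[OF finite_field_power_card_minus_1[OF g(1)]] power_0)
    moreover have "i mod ?N \<in> {..<?N}" "0 \<in> {..<?N}" using N by auto
    ultimately have "i mod ?N = 0" using g(2) unfolding bij_betw_def inj_on_def by blast
    then show "?N dvd i" by auto
  qed
  have "mu d = (\<lambda>i. g ^ i) ` ((*) e ` {..<d})"
  proof (intro equalityI subsetI)
    fix x :: 'a assume x: "x \<in> mu d"
    then have "x \<noteq> 0" using mu_nonzero[of d x] d0 by simp
    then obtain i where i: "i < ?N" "x = g ^ i" using g(2) by (auto simp: bij_betw_def)
    then have "g ^ (i * d) = 1" using x by (simp add: mu_def power_mult)
    then have "e dvd i" using e d0 one by (simp add: mult.commute[of i])
    then obtain k where k: "i = e * k" by blast
    then have "k < d" using i e e0 by (simp add: mult.commute[of d])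
    then show "x \<in> (\<lambda>i. g ^ i) ` ((*) e ` {..<d})" using i k by auto
  next
    fix x assume "x \<in> (\<lambda>i. g ^ i) ` ((*) e ` {..<d})"
    then obtain k where "x = g ^ (e * k)" by auto
    then have "x ^ d = g ^ (?N * k)" unfolding e by (simp only: power_mult[symmetric] mult_ac)
    then show "x \<in> mu d" using one by (simp add: mu_def del: power_mult)
  qed
  moreover have "inj_on (\<lambda>i. g ^ i) ((*) e ` {..<d})"
  proof (rule inj_on_subset)
    show "inj_on (\<lambda>i. g ^ i) {..<?N}" using g(2) by (simp add: bij_betw_def)
    show "(*) e ` {..<d} \<subseteq> {..<?N}" unfolding e using e0 by (auto simp: mult.commute)
  qed
  moreover have "inj_on ((*) e) {..<d}" using e0 by (auto simp: inj_on_def)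
  ultimately show ?thesis by (simp add: card_image)
qed

lemma of_nat_neq_0_if_dvd:
  assumes "m dvd CARD('a::{field,finite}) - 1"
  shows "of_nat m \<noteq> (0::'a)"
proof
  assume "of_nat m = (0::'a)"
  then have "CHAR('a) dvd m" by (simp add: of_nat_eq_0_iff_char_dvd)
  then have "CHAR('a) dvd CARD('a) - 1" using assms by auto
  moreover have "CHAR('a) dvd CARD('a)"
  proof -
    have "(\<Sum>x\<in>UNIV. x + (1::'a)) = \<Sum>UNIV"
      by (rule sum.reindex_bij_betw) (rule bij_betw_byWitness[of _ "\<lambda>x. x - 1"], auto)
    then show ?thesis by (simp add: sum.distrib of_nat_eq_0_iff_char_dvd)
  qed
  moreover have "CARD('a) - (CARD('a) - 1) = 1" using card_field_ge_2[where 'a = 'a] by simp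
  ultimately have "CHAR('a) dvd 1" by (metis dvd_diff_nat)
  then show False by simp
qed

lemma prime_CHAR_finite_field: "prime CHAR('a::{field,finite})"
  by (rule prime_CHAR_semidom) (simp add: finite_imp_CHAR_pos)

text \<open>By Cauchy's theorem for the additive group, a prime factor \<open>\<ell>\<close> of q kills a nonzero
  element, so it is the characteristic.\<close>

lemma CARD_eq_CHAR_power: "\<exists>k. CARD('a::{field,finite}) = CHAR('a) ^ k"
proof -
  define G where "G = \<lparr>carrier = (UNIV::'a set), monoid.mult = (+), one = (0::'a)\<rparr>"
  have inv: "\<exists>y. x + y = 0" for x :: 'a by (rule exI[of _ "- x"]) simp
  interpret G: comm_group G
    by (rule comm_groupI) (simp_all add: G_def add_ac inv)
  have pow: "x [^]\<^bsub>G\<^esub> (n::nat) = of_nat n * x" for x n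
    by (induction n) (simp_all add: G_def algebra_simps)
  have "l = CHAR('a)" if l: "prime l" "l dvd CARD('a)" for l
  proof -
    obtain m where "CARD('a) = l ^ 1 * m" using l by auto
    then have "Coset.order G = l ^ 1 * m" by (simp add: Coset.order_def G_def)
    then obtain H where H: "subgroup H G" "card H = l"
      using sylow_thm[OF l(1) G.group_axioms, of 1 m] by (auto simp: G_def)
    have "\<exists>x\<in>H. x \<noteq> 0"
    proof (rule ccontr)
      assume "\<not> ?thesis"
      then have "card H \<le> card {0::'a}" by (intro card_mono) auto
      then show False using H(2) prime_ge_2_nat[OF l(1)] by simp
    qed
    then obtain x where x: "x \<in> H" "x \<noteq> 0" by blast
    interpret H: group "G\<lparr>carrier := H\<rparr>" using H(1) by (rule subgroup.subgroup_is_group) (rule G.group_axioms)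
    have "x [^]\<^bsub>G\<lparr>carrier := H\<rparr>\<^esub> Coset.order (G\<lparr>carrier := H\<rparr>) = \<one>\<^bsub>G\<lparr>carrier := H\<rparr>\<^esub>"
      using x(1) by (intro H.pow_order_eq_1) simp
    then have "x [^]\<^bsub>G\<^esub> l = \<one>\<^bsub>G\<^esub>"
      using H(2) by (simp add: Coset.order_def nat_pow_def)
    then have "of_nat l * x = 0" unfolding pow by (simp add: G_def)
    then have "CHAR('a) dvd l" using x(2) by (simp add: of_nat_eq_0_iff_char_dvd)
    then show ?thesis using l(1) prime_CHAR_finite_field[where 'a = 'a] primes_dvd_imp_eq by metis
  qed
  then have "prime_factors CARD('a) \<subseteq> {CHAR('a)}" by auto
  then have "(\<Prod>p\<in>prime_factors CARD('a). p ^ multiplicity p CARD('a))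
     = (\<Prod>p\<in>{CHAR('a)}. p ^ multiplicity p CARD('a))"
  proof (intro prod.mono_neutral_left ballI)
    fix p assume "p \<in> {CHAR('a)} - prime_factors CARD('a)"
    then have "\<not> p dvd CARD('a)"
      using prime_CHAR_finite_field[where 'a = 'a] by (auto simp: prime_factors_dvd)
    then show "p ^ multiplicity p CARD('a) = 1" by (simp add: not_dvd_imp_multiplicity_0)
  qed auto
  then show ?thesis by (auto simp: prime_factorization_nat[symmetric])
qed

lemma frobenius_add:
  fixes x y :: "'a::{field,finite} alg_closure"
  shows "(x + y) ^ CARD('a) = x ^ CARD('a) + y ^ CARD('a)"
proof -
  obtain k where "CARD('a) = CHAR('a) ^ k" using CARD_eq_CHAR_power by blast
  then show ?thesis
    using prime_CHAR_finite_field[where 'a = 'a]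
    by (intro freshmans_dream'[where n = k]) (simp_all add: CHAR_alg_closure)
qed

lemma frobenius_uminus:
  fixes x :: "'a::{field,finite} alg_closure"
  shows "(- x) ^ CARD('a) = - (x ^ CARD('a))"
proof -
  have "x ^ CARD('a) + (- x) ^ CARD('a) = (x + - x) ^ CARD('a)" by (rule frobenius_add[symmetric])
  also have "\<dots> = 0" by simp
  finally show ?thesis by (simp only: add_eq_0_iff2 minus_minus add_eq_0_iff)
qed

lemma frobenius_diff:
  fixes x y :: "'a::{field,finite} alg_closure"
  shows "(x - y) ^ CARD('a) = x ^ CARD('a) - y ^ CARD('a)"
  using frobenius_add[of x "- y"] by (simp add: frobenius_uminus)

lemma inj_frobenius: "inj (\<lambda>x :: 'a::{field,finite} alg_closure. x ^ CARD('a))"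
proof (rule injI)
  fix x y :: "'a alg_closure" assume "x ^ CARD('a) = y ^ CARD('a)"
  then have "(x - y) ^ CARD('a) = 0" by (simp add: frobenius_diff)
  then show "x = y" by simp
qed

lemma finite_frobenius_power_fixed:
  assumes "r \<ge> 1"
  shows "finite {x :: 'a::{field,finite} alg_closure. x ^ CARD('a) ^ r = x}"
proof -
  have "CARD('a) ^ r \<ge> 2 ^ 1"
    using card_field_ge_2[where 'a = 'a] assms
    by (intro order_trans[OF power_increasing[of 1 r "2::nat"] power_mono]) auto
  then have "(monom 1 (CARD('a) ^ r) - monom 1 1 :: 'a alg_closure poly) \<noteq> 0"
    by (auto simp: poly_eq_iff dest!: spec[of _ 1])
  from poly_roots_finite[OF this] show ?thesis by (simp add: poly_monom)
qed

text \<open>The polynomial \<open>X\<^sup>q - X\<close> has at most q roots, and the q elements of the finite field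
  are roots.\<close>

lemma frobenius_fixed_iff:
  fixes x :: "'a::{field,finite} alg_closure"
  shows "x ^ CARD('a) = x \<longleftrightarrow> x \<in> range to_ac"
proof -
  let ?q = "CARD('a)"
  let ?p = "monom 1 ?q - monom 1 1 :: 'a alg_closure poly"
  have q: "?q \<ge> 2" by (rule card_field_ge_2)
  have p0: "?p \<noteq> 0" using q by (auto simp: poly_eq_iff dest!: spec[of _ 1])
  have "degree ?p \<le> ?q" by (rule degree_diff_le) (use q in \<open>auto simp: degree_monom_eq\<close>)
  then have "card {x. poly ?p x = 0} \<le> ?q"
    using card_poly_roots_bound[OF p0] by simp
  moreover have "range to_ac \<subseteq> {x. poly ?p x = 0}"
    by (auto simp: poly_monom finite_field_power_card simp flip: to_ac_power)
  moreover have "card (range (to_ac :: 'a \<Rightarrow> _)) = ?q" by (rule card_image) (rule inj_to_ac)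
  ultimately have "range to_ac = {x. poly ?p x = 0}"
    using poly_roots_finite[OF p0] by (metis card_seteq)
  then show ?thesis by (auto simp: poly_monom)
qed

text \<open>As m divides q - 1, all m-th roots of unity of the algebraic closure lie in the finite field,
  and multiplying one m-th root of a by them gives the others.\<close>

lemma card_nth_roots_alg_closure:
  fixes a :: "'a::{field,finite} alg_closure"
  assumes m: "m dvd CARD('a) - 1" and "a \<noteq> 0"
  obtains b where "b ^ m = a" "bij_betw (\<lambda>z. to_ac z * b) (mu m :: 'a set) {x. x ^ m = a}"
proof -
  have m0: "m > 0" using m card_field_ge_2[where 'a = 'a] by (auto intro!: Nat.gr0I)
  obtain b where b: "b ^ m = a" using nth_root_exists[OF m0] by blast
  have b0: "b \<noteq> 0" using b assms m0 by (auto simp: power_0_left)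
  let ?R = "{x :: 'a alg_closure. x ^ m = 1}"
  have "to_ac ` (mu m :: 'a set) = ?R"
  proof (rule card_subset_eq)
    have nz: "(monom 1 m - 1 :: 'a alg_closure poly) \<noteq> 0"
      using m0 by (auto simp: poly_eq_iff dest!: spec[of _ m])
    have "?R = {x. poly (monom 1 m - 1) x = 0}" by (simp add: poly_monom)
    then show fin: "finite ?R" using poly_roots_finite[OF nz] by simp
    show "to_ac ` (mu m :: 'a set) \<subseteq> ?R" by (auto simp: mu_def simp flip: to_ac_power)
    have "degree (monom 1 m - 1 :: 'a alg_closure poly) \<le> m"
      by (rule degree_diff_le) (auto simp: degree_monom_eq)
    then have "card ?R \<le> m" using card_poly_roots_bound[OF nz] by (simp add: poly_monom)
    moreover have "card (to_ac ` (mu m :: 'a set)) = m"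
      using card_mu[OF m] by (subst card_image) (auto intro: inj_on_subset[OF inj_to_ac])
    moreover have "card (to_ac ` (mu m :: 'a set)) \<le> card ?R"
      using fin by (rule card_mono) (auto simp: mu_def simp flip: to_ac_power)
    ultimately show "card (to_ac ` (mu m :: 'a set)) = card ?R" by simp
  qed
  moreover have "{x. x ^ m = a} = (\<lambda>z. z * b) ` ?R"
  proof (intro equalityI subsetI)
    fix x assume "x \<in> {x. x ^ m = a}"
    then have "x / b \<in> ?R" using b b0 assms by (simp add: power_divide)
    then show "x \<in> (\<lambda>z. z * b) ` ?R" using b0 by (intro image_eqI[of _ _ "x / b"]) auto
  qed (use b in \<open>auto simp: power_mult_distrib\<close>)
  moreover have "(\<lambda>z. to_ac z * b) ` (mu m :: 'a set) = (\<lambda>z. z * b) ` to_ac ` (mu m :: 'a set)"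
    by (simp only: image_image)
  ultimately have "(\<lambda>z. to_ac z * b) ` (mu m :: 'a set) = {x. x ^ m = a}" by (simp only:)
  moreover have "inj_on (\<lambda>z. to_ac z * b) (mu m :: 'a set)" using b0 by (simp add: inj_on_def)
  ultimately show ?thesis using b by (intro that[of b]) (simp_all add: bij_betw_def)
qed


section \<open>Characters and Gauss sums\<close>

lemma mult_char_0: "\<eta> \<in> mult_chars \<Longrightarrow> \<eta> 0 = 0"
  and mult_char_nonzero: "\<eta> \<in> mult_chars \<Longrightarrow> x \<noteq> 0 \<Longrightarrow> \<eta> x \<noteq> 0"
  and mult_char_mult: "\<eta> \<in> mult_chars \<Longrightarrow> \<eta> (x * y) = \<eta> x * \<eta> y"
  by (simp_all add: mult_chars_def)

lemma mult_char_1: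
  assumes "\<eta> \<in> mult_chars"
  shows "\<eta> 1 = 1"
proof -
  have "\<eta> 1 * \<eta> 1 = \<eta> 1 * 1" using mult_char_mult[OF assms, of 1 1] by simp
  moreover have "\<eta> 1 \<noteq> 0" by (rule mult_char_nonzero[OF assms]) simp
  ultimately show ?thesis by (metis mult_left_cancel)
qed

lemma mult_char_power: "\<eta> \<in> mult_chars \<Longrightarrow> \<eta> (x ^ k) = \<eta> x ^ k"
  by (induction k) (simp_all add: mult_char_1 mult_char_mult)

lemma mult_char_prod: "\<eta> \<in> mult_chars \<Longrightarrow> \<eta> (\<Prod>i\<in>I. f i) = (\<Prod>i\<in>I. \<eta> (f i))"
  by (induction I rule: infinite_finite_induct) (simp_all add: mult_char_1 mult_char_mult)

lemma mult_char_order: "\<eta> \<in> mult_chars \<Longrightarrow> x \<noteq> 0 \<Longrightarrow> \<eta> (x :: 'a::{field,finite}) ^ (CARD('a) - 1) = 1"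
  by (simp add: mult_char_1 finite_field_power_card_minus_1[simplified] flip: mult_char_power)

lemma triv_char_in_mult_chars [simp]: "triv_char \<in> mult_chars"
  by (auto simp: mult_chars_def triv_char_def)

lemma char_mult_in_mult_chars [simp]:
  "\<alpha> \<in> mult_chars \<Longrightarrow> \<beta> \<in> mult_chars \<Longrightarrow> char_mult \<alpha> \<beta> \<in> mult_chars"
  by (auto simp: mult_chars_def char_mult_def)

lemma char_pow_in_mult_chars [simp]: "\<eta> \<in> mult_chars \<Longrightarrow> char_pow \<eta> k \<in> mult_chars"
  by (auto simp: mult_chars_def char_pow_def power_mult_distrib)

lemma char_pow_0 [simp]: "char_pow \<eta> 0 = triv_char"
  by (auto simp: char_pow_def triv_char_def)

lemma char_mult_triv [simp]:
  "\<eta> \<in> mult_chars \<Longrightarrow> char_mult \<eta> triv_char = \<eta>" "\<eta> \<in> mult_chars \<Longrightarrow> char_mult triv_char \<eta> = \<eta>"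
  by (auto simp: char_mult_def triv_char_def mult_char_0)

lemma char_mult_char_pow: "char_mult (char_pow \<eta> a) (char_pow \<eta> b) = char_pow \<eta> (a + b)"
  by (auto simp: char_mult_def char_pow_def power_add)

lemma char_pow_char_pow: "char_pow (char_pow \<eta> a) b = char_pow \<eta> (a * b)"
  by (auto simp: char_pow_def power_mult)

lemma char_pow_triv [simp]: "char_pow triv_char k = triv_char"
  by (auto simp: char_pow_def triv_char_def)

lemma char_pow_mod:
  fixes \<eta> :: "'a::{field,finite} \<Rightarrow> qbar"
  assumes "\<eta> \<in> mult_chars"
  shows "char_pow \<eta> (k mod (CARD('a) - 1)) = char_pow \<eta> k"
proof (rule ext)
  fix x :: 'a
  let ?N = "CARD('a) - 1"
  show "char_pow \<eta> (k mod ?N) x = char_pow \<eta> k x"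
  proof (cases "x = 0")
    case False
    then show ?thesis
      using power_mod_order[OF mult_char_order[OF assms False]] by (simp add: char_pow_def)
  qed (simp add: char_pow_def)
qed

lemma sum_mult_char:
  fixes \<eta> :: "'a::{field,finite} \<Rightarrow> qbar"
  assumes "\<eta> \<in> mult_chars"
  shows "(\<Sum>x\<in>UNIV - {0}. \<eta> x) = (if \<eta> = triv_char then of_nat (CARD('a) - 1) else 0)"
proof (cases "\<eta> = triv_char")
  case True
  have "(\<Sum>x\<in>UNIV - {0::'a}. triv_char x) = (\<Sum>x\<in>UNIV - {0::'a}. 1)"
    by (rule sum.cong) (auto simp: triv_char_def)
  then show ?thesis using True by (simp add: card_Diff_singleton)
next
  case False
  then obtain a where a: "\<eta> a \<noteq> triv_char a" by (auto simp: fun_eq_iff)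
  then have a0: "a \<noteq> 0" and a1: "\<eta> a \<noteq> 1"
    using mult_char_0[OF assms] by (auto simp: triv_char_def split: if_splits)
  have "bij_betw ((*) a) (UNIV - {0}) (UNIV - {0})"
    by (rule bij_betw_byWitness[of _ "\<lambda>x. x / a"]) (use a0 in auto)
  then have "(\<Sum>x\<in>UNIV - {0}. \<eta> (a * x)) = (\<Sum>x\<in>UNIV - {0}. \<eta> x)"
    by (rule sum.reindex_bij_betw)
  then have "\<eta> a * (\<Sum>x\<in>UNIV - {0}. \<eta> x) = (\<Sum>x\<in>UNIV - {0}. \<eta> x)"
    by (simp add: mult_char_mult[OF assms] sum_distrib_left)
  then show ?thesis using a1 False by simp
qed

lemma sum_powers_root_of_unity:
  fixes z :: "'b::field"
  assumes "z ^ m = 1"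
  shows "(\<Sum>k<m. z ^ k) = (if z = 1 then of_nat m else 0)"
  using assms by (simp add: geometric_sum)

text \<open>Because \<open>X\<^sup>N - 1\<close> is separable, an algebraically closed field of characteristic 0 has N
  distinct N-th roots of unity.\<close>

lemma card_roots_of_unity:
  assumes "N > 0"
  shows "card {z :: qbar. z ^ N = 1} = N"
proof -
  let ?p = "monom 1 N - 1 :: qbar poly"
  have p0: "?p \<noteq> 0" using assms by (auto simp: poly_eq_iff dest!: spec[of _ N])
  have "degree (1 :: qbar poly) < degree (monom 1 N :: qbar poly)"
    using assms by (simp add: degree_monom_eq)
  then have deg: "degree ?p = N"
    using degree_add_eq_left[of "- 1" "monom 1 N :: qbar poly"] by (simp add: degree_monom_eq)
  have lead: "lead_coeff ?p = 1" unfolding deg using assms by simp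
  obtain A where A: "size A = N" "?p = (\<Prod>x\<in>#A. [:-x, 1:])"
    using alg_closed_imp_factorization[OF p0] deg lead by auto
  have "proots (\<Prod>x\<in>#B. [:-x, 1:]) = B" for B :: "qbar multiset"
  proof (induction B)
    case (add b B)
    have "(\<Prod>x\<in>#B. [:-x, 1:]) \<noteq> 0" by (auto simp: prod_mset_zero_iff)
    then show ?case using add.IH by (simp only: image_mset_add_mset prod_mset.add_mset)
        (subst proots_mult, auto)
  qed simp
  then have roots: "proots ?p = A" using A(2) by simp
  have Z: "{z. poly ?p z = 0} = {z. z ^ N = 1}" by (simp add: poly_monom)
  have "rsquarefree ?p"
    unfolding rsquarefree_roots
    using assms by (auto simp: poly_monom pderiv_diff pderiv_monom power_0_left)
  then have "order z ?p = 1" if "z ^ N = 1" for z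
    using that rsquarefree_root_order[of ?p z] p0 by (simp add: poly_monom)
  then have "count A z = 1" if "z \<in> set_mset A" for z
    using that roots p0 Z by (metis (mono_tags, lifting) count_proots mem_Collect_eq set_count_proots)
  then have "size A = card (set_mset A)" unfolding size_multiset_overloaded_eq by simp
  then show ?thesis using A(1) roots p0 Z by (metis set_count_proots)
qed

locale char_setup =
  fixes \<psi> \<phi> :: "'a::{field,finite} \<Rightarrow> qbar"
  assumes psi: "nontrivial_add_char \<psi>" and phi: "char_generator \<phi>"
begin

lemma phi_char [simp]: "\<phi> \<in> mult_chars" using phi by (simp add: char_generator_def)

lemma psi_add: "\<psi> (x + y) = \<psi> x * \<psi> y" using psi by (simp add: nontrivial_add_char_def)

lemma psi_nonzero: "\<psi> x \<noteq> 0" using psi by (simp add: nontrivial_add_char_def)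

lemma psi_0: "\<psi> 0 = 1"
  using psi_add[of 0 0] psi_nonzero[of 0] by simp

lemma psi_sum: "\<psi> (\<Sum>i\<in>I. f i) = (\<Prod>i\<in>I. \<psi> (f i))"
  by (induction I rule: infinite_finite_induct) (simp_all add: psi_0 psi_add)

lemma sum_psi: "(\<Sum>x\<in>UNIV. \<psi> (c * x)) = (if c = 0 then of_nat CARD('a) else 0)"
proof (cases "c = 0")
  case False
  obtain a where a: "\<psi> a \<noteq> 1" using psi by (auto simp: nontrivial_add_char_def)
  have "bij_betw (\<lambda>x. a / c + x) UNIV UNIV"
    by (rule bij_betw_byWitness[of _ "\<lambda>x. x - a / c"]) auto
  then have "(\<Sum>x\<in>UNIV. \<psi> (c * (a / c + x))) = (\<Sum>x\<in>UNIV. \<psi> (c * x))"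
    by (rule sum.reindex_bij_betw)
  then have "\<psi> a * (\<Sum>x\<in>UNIV. \<psi> (c * x)) = (\<Sum>x\<in>UNIV. \<psi> (c * x))"
    using False by (simp add: distrib_left psi_add sum_distrib_left)
  then show ?thesis using a False by simp
qed (simp add: psi_0)

lemma sum_psi_units: "(\<Sum>x\<in>UNIV - {0}. \<psi> x) = -1"
proof -
  have "(\<Sum>x\<in>UNIV. \<psi> x) = \<psi> 0 + (\<Sum>x\<in>UNIV - {0}. \<psi> x)" by (rule sum.remove) auto
  then show ?thesis using sum_psi[of 1] by (simp add: psi_0 add_eq_0_iff)
qed

text \<open>Let g be a primitive element.  Every root of unity of order dividing q - 1 is the value at g
  of some character, hence a power of \<open>\<phi> g\<close>; as there are q - 1 of them, \<open>\<phi> g\<close> has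
  order q - 1.  So \<open>\<phi>\<close> is injective on the multiplicative group.\<close>

lemma phi_eq_1_iff: "\<phi> x = 1 \<longleftrightarrow> x = 1"
proof
  assume x: "\<phi> x = 1"
  let ?N = "CARD('a) - 1"
  obtain g :: 'a where g: "g \<noteq> 0" "bij_betw (\<lambda>i. g ^ i) {..<?N} (UNIV - {0})"
    by (rule finite_field_generator)
  have N: "?N > 0" using card_field_ge_2[where 'a = 'a] by simp
  have x0: "x \<noteq> 0" using x mult_char_0[OF phi_char] by auto
  have val: "z \<in> range (\<lambda>k. \<phi> g ^ k)" if z: "z ^ ?N = 1" for z
  proof -
    define dlog where "dlog = (\<lambda>y. inv_into {..<?N} (\<lambda>i. g ^ i) y)"
    have dlog: "dlog y < ?N" "g ^ dlog y = y" if "y \<noteq> 0" for y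
    proof -
      have "y \<in> (\<lambda>i. g ^ i) ` {..<?N}" using that g(2) by (simp add: bij_betw_def)
      then show "dlog y < ?N" "g ^ dlog y = y"
        using inv_into_into[of y "\<lambda>i. g ^ i" "{..<?N}"] f_inv_into_f[of y "\<lambda>i. g ^ i" "{..<?N}"]
        by (simp_all add: dlog_def)
    qed
    have zz: "z ^ i = z ^ j" if "g ^ i = g ^ j" for i j
    proof -
      have "g ^ (i mod ?N) = g ^ (j mod ?N)"
        using that by (simp only: power_mod_order[OF finite_field_power_card_minus_1[OF g(1)]])
      moreover have "i mod ?N \<in> {..<?N}" "j mod ?N \<in> {..<?N}" using N by auto
      ultimately have "i mod ?N = j mod ?N" using g(2) unfolding bij_betw_def inj_on_def by blast
      then show ?thesis using power_mod_order[OF z] by metis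
    qed
    \<comment> \<open>the character that takes the value z at the primitive element g\<close>
    define \<eta> where "\<eta> = (\<lambda>y. if y = 0 then 0 else z ^ dlog y)"
    have z0: "z \<noteq> 0" using z N by (auto simp: power_0_left)
    have "\<eta> \<in> mult_chars"
      unfolding mult_chars_def \<eta>_def using z0
      by (auto simp flip: power_add intro!: zz simp: dlog) (simp add: dlog power_add)
    then obtain k where k: "\<eta> = char_pow \<phi> k" using phi by (auto simp: char_generator_def)
    have "z = z ^ 1" by simp
    also have "\<dots> = z ^ dlog g" by (rule zz) (simp add: dlog g(1))
    also have "\<dots> = \<phi> g ^ k" using fun_cong[OF k, of g] g(1) by (simp add: \<eta>_def char_pow_def)
    finally show ?thesis by blast
  qed
  obtain i where i: "i < ?N" "x = g ^ i" using g(2) x0 by (auto simp: bij_betw_def)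
  have "i = 0"
  proof (rule ccontr)
    assume "i \<noteq> 0"
    have "\<phi> g ^ i = 1" using x i(2) by (simp add: mult_char_power)
    have "{z::qbar. z ^ ?N = 1} \<subseteq> {z. z ^ i = 1}"
    proof
      fix z :: qbar assume "z \<in> {z. z ^ ?N = 1}"
      then obtain k where "z = \<phi> g ^ k" using val by blast
      then have "z ^ i = (\<phi> g ^ i) ^ k" by (simp only: power_mult[symmetric] mult.commute)
      then show "z \<in> {z. z ^ i = 1}" using \<open>\<phi> g ^ i = 1\<close> by simp
    qed
    moreover have "finite {z::qbar. z ^ i = 1}"
      using card_roots_of_unity[of i] \<open>i \<noteq> 0\<close> by (intro card_ge_0_finite) simp
    ultimately have "card {z::qbar. z ^ ?N = 1} \<le> card {z::qbar. z ^ i = 1}" by (intro card_mono)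
    then show False using card_roots_of_unity[of i] card_roots_of_unity[OF N] \<open>i \<noteq> 0\<close> i(1) by simp
  qed
  then show "x = 1" using i by simp
qed (simp add: mult_char_1)

lemma char_pow_phi_eq_triv_iff: "char_pow \<phi> k = triv_char \<longleftrightarrow> CARD('a) - 1 dvd k"
proof
  assume k: "char_pow \<phi> k = triv_char"
  obtain g :: 'a where g: "g \<noteq> 0" "bij_betw (\<lambda>i. g ^ i) {..<CARD('a) - 1} (UNIV - {0})"
    by (rule finite_field_generator)
  let ?N = "CARD('a) - 1"
  have N: "?N > 0" using card_field_ge_2[where 'a = 'a] by simp
  have "char_pow \<phi> (k mod ?N) g = 1"
    using k by (simp add: char_pow_mod del: One_nat_def) (simp add: triv_char_def g)
  then have "\<phi> (g ^ (k mod ?N)) = 1" using g(1) by (simp add: char_pow_def mult_char_power)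
  then have "g ^ (k mod ?N) = g ^ 0" by (simp add: phi_eq_1_iff)
  moreover have "k mod ?N \<in> {..<?N}" "0 \<in> {..<?N}" using N by auto
  ultimately have "k mod ?N = 0" using g(2) unfolding bij_betw_def inj_on_def by blast
  then show "?N dvd k" by auto
next
  assume "CARD('a) - 1 dvd k"
  then have "k mod (CARD('a) - 1) = 0" by simp
  then show "char_pow \<phi> k = triv_char" using char_pow_mod[OF phi_char, of k] by simp
qed

lemma bij_betw_mult_chars: "bij_betw (char_pow \<phi>) {..<CARD('a) - 1} mult_chars"
proof -
  let ?N = "CARD('a) - 1"
  have N: "?N > 0" using card_field_ge_2[where 'a = 'a] by simp
  have le: "a = b" if ab: "char_pow \<phi> a = char_pow \<phi> b" "a \<le> b" "b < ?N" for a b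
  proof -
    have "char_pow \<phi> (b - a) x = triv_char x" for x
    proof (cases "x = 0")
      case False
      have "\<phi> x ^ a * \<phi> x ^ (b - a) = \<phi> x ^ b" using ab(2) by (simp flip: power_add)
      also have "\<dots> = \<phi> x ^ a * 1" using fun_cong[OF ab(1), of x] False by (simp add: char_pow_def)
      finally have "\<phi> x ^ a * \<phi> x ^ (b - a) = \<phi> x ^ a * 1" .
      then show ?thesis using False mult_char_nonzero[OF phi_char False]
        by (simp add: char_pow_def triv_char_def)
    qed (simp add: char_pow_def triv_char_def)
    then have "char_pow \<phi> (b - a) = triv_char" by blast
    then have "?N dvd b - a" by (simp only: char_pow_phi_eq_triv_iff)
    then show ?thesis using ab by (metis diff_is_0_eq less_imp_diff_less nat_dvd_not_less not_gr_zero le_antisym)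
  qed
  have "inj_on (char_pow \<phi>) {..<?N}"
    by (rule inj_onI) (metis le lessThan_iff nat_le_linear)
  moreover have "char_pow \<phi> ` {..<?N} = mult_chars"
  proof (intro equalityI subsetI)
    fix \<eta> :: "'a \<Rightarrow> qbar" assume "\<eta> \<in> mult_chars"
    then obtain k where "\<eta> = char_pow \<phi> k" using phi by (auto simp: char_generator_def)
    then show "\<eta> \<in> char_pow \<phi> ` {..<?N}"
      using N by (intro image_eqI[of _ _ "k mod ?N"]) (simp_all add: char_pow_mod del: One_nat_def)
  qed auto
  ultimately show ?thesis by (simp add: bij_betw_def)
qed

lemma finite_mult_chars [simp]: "finite (mult_chars :: ('a \<Rightarrow> qbar) set)"
  using bij_betw_finite[OF bij_betw_mult_chars] by simp

lemma sum_mult_chars_eq: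
  "(\<Sum>\<nu>\<in>mult_chars. f \<nu>) = (\<Sum>k<CARD('a) - 1. f (char_pow \<phi> k))"
  by (rule sum.reindex_bij_betw[OF bij_betw_mult_chars, symmetric])

lemma sum_over_mult_chars:
  fixes x :: 'a
  assumes "x \<noteq> 0"
  shows "(\<Sum>\<nu>\<in>mult_chars. \<nu> x) = (if x = 1 then of_nat (CARD('a) - 1) else 0)"
proof -
  have "(\<Sum>\<nu>\<in>mult_chars. \<nu> x) = (\<Sum>k<CARD('a) - 1. \<phi> x ^ k)"
    unfolding sum_mult_chars_eq using assms by (simp add: char_pow_def)
  also have "\<dots> = (if \<phi> x = 1 then of_nat (CARD('a) - 1) else 0)"
    by (rule sum_powers_root_of_unity) (rule mult_char_order[OF phi_char assms])
  finally show ?thesis by (simp only: phi_eq_1_iff)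
qed

lemma char_root_in_mult_chars [simp]: "char_root \<phi> m \<in> mult_chars"
  by (simp add: char_root_def)

lemma char_root_eq: "x \<noteq> 0 \<Longrightarrow> char_root \<phi> m x = \<phi> (x ^ ((CARD('a) - 1) div m))"
  by (simp add: char_root_def char_pow_def mult_char_power)

lemma sum_char_root_powers:
  assumes "m dvd CARD('a) - 1" "x \<noteq> 0"
  shows "(\<Sum>k<m. char_root \<phi> m x ^ k) = (if x ^ ((CARD('a) - 1) div m) = 1 then of_nat m else 0)"
proof -
  have "char_root \<phi> m x ^ m = \<phi> x ^ (CARD('a) - 1)"
    using assms by (simp add: char_root_def char_pow_def flip: power_mult)
  also have "\<dots> = 1" by (rule mult_char_order[OF phi_char assms(2)])
  finally have "(\<Sum>k<m. char_root \<phi> m x ^ k) = (if char_root \<phi> m x = 1 then of_nat m else 0)"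
    by (rule sum_powers_root_of_unity)
  then show ?thesis by (simp only: char_root_eq[OF assms(2)] phi_eq_1_iff)
qed

lemma gauss_sum_triv: "gauss_sum \<psi> triv_char = 1"
proof -
  have "(\<Sum>x\<in>UNIV - {0}. triv_char x * \<psi> x) = (\<Sum>x\<in>UNIV - {0}. \<psi> x)"
    by (rule sum.cong) (auto simp: triv_char_def)
  then show ?thesis by (simp add: gauss_sum_def sum_psi_units)
qed

lemma gauss_sum_scaled:
  assumes "\<eta> \<in> mult_chars" "a \<noteq> 0"
  shows "(\<Sum>x\<in>UNIV - {0}. \<eta> x * \<psi> (a * x)) = - (inverse (\<eta> a) * gauss_sum \<psi> \<eta>)"
proof -
  have "bij_betw ((*) a) (UNIV - {0}) (UNIV - {0})"
    by (rule bij_betw_byWitness[of _ "\<lambda>x. x / a"]) (use assms in auto)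
  then have "(\<Sum>x\<in>UNIV - {0}. \<eta> (a * x) * \<psi> (a * x)) = (\<Sum>x\<in>UNIV - {0}. \<eta> x * \<psi> x)"
    by (rule sum.reindex_bij_betw)
  then have "\<eta> a * (\<Sum>x\<in>UNIV - {0}. \<eta> x * \<psi> (a * x)) = - gauss_sum \<psi> \<eta>"
    by (simp add: gauss_sum_def mult_char_mult[OF assms(1)] sum_distrib_left mult.assoc)
  then show ?thesis using mult_char_nonzero[OF assms] by (simp add: field_simps)
qed

text \<open>If the Gauss sum of a nontrivial character vanished, so would all Fourier coefficients of
  the character, hence the character itself.\<close>

lemma gauss_sum_nonzero:
  assumes "\<eta> \<in> mult_chars"
  shows "gauss_sum \<psi> \<eta> \<noteq> 0"
proof (cases "\<eta> = triv_char")
  case False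
  show ?thesis
  proof
    assume g: "gauss_sum \<psi> \<eta> = 0"
    have "(\<Sum>x\<in>UNIV - {0}. \<eta> x * \<psi> (a * x)) = 0" for a
    proof (cases "a = 0")
      case True
      then show ?thesis using sum_mult_char[OF assms] False by (simp add: psi_0)
    qed (simp add: gauss_sum_scaled[OF assms] g)
    then have "0 = (\<Sum>a\<in>UNIV. \<psi> (- a) * (\<Sum>x\<in>UNIV - {0}. \<eta> x * \<psi> (a * x)))" by simp
    also have "\<dots> = (\<Sum>a\<in>UNIV. \<Sum>x\<in>UNIV - {0}. \<eta> x * \<psi> ((x - 1) * a))"
    proof -
      have "\<psi> ((x - 1) * a) = \<psi> (- a) * \<psi> (a * x)" for a x
        unfolding psi_add[symmetric] by (simp add: algebra_simps)
      then show ?thesis by (simp add: sum_distrib_left mult_ac)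
    qed
    also have "\<dots> = (\<Sum>x\<in>UNIV - {0}. \<eta> x * (\<Sum>a\<in>UNIV. \<psi> ((x - 1) * a)))"
      unfolding sum_distrib_left by (rule sum.swap)
    also have "\<dots> = (\<Sum>x\<in>UNIV - {0::'a}. if x = 1 then of_nat CARD('a) else 0)"
      by (rule sum.cong) (auto simp: sum_psi mult_char_1[OF assms])
    also have "\<dots> = of_nat CARD('a)" by (subst sum.delta) auto
    finally show False using card_field_ge_2[where 'a = 'a] by simp
  qed
qed (simp add: gauss_sum_triv)

end


section \<open>Multisets that are stable under an injection\<close>

text \<open>The closed walk \<open>a, f a, \<dots>, f\<^sup>r\<^sup>-\<^sup>1 a\<close> of a point with \<open>f\<^sup>r a = a\<close>.  For the Frobenius map this
  is the multiset of roots of the characteristic polynomial of a, an element of the extension of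
  degree r, over the ground field.\<close>

primrec cyc :: "('b \<Rightarrow> 'b) \<Rightarrow> nat \<Rightarrow> 'b \<Rightarrow> 'b multiset" where
  "cyc f 0 a = {#}"
| "cyc f (Suc r) a = add_mset ((f ^^ r) a) (cyc f r a)"

definition stable_msets :: "('b \<Rightarrow> 'b) \<Rightarrow> nat \<Rightarrow> 'b multiset set" where
  "stable_msets f n = {M. size M = n \<and> image_mset f M = M}"

definition periodic_pts :: "('b \<Rightarrow> 'b) \<Rightarrow> nat \<Rightarrow> 'b set" where
  "periodic_pts f r = {a. (f ^^ r) a = a}"

lemma size_cyc [simp]: "size (cyc f r a) = r"
  by (induction r) auto

lemma count_image_mset_inj:
  assumes "inj f"
  shows "count (image_mset f M) (f x) = count M x"
  by (induction M) (simp_all add: inj_eq[OF assms])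

lemma cyc_altdef: "cyc f r a = image_mset (\<lambda>i. (f ^^ i) a) (mset_set {..<r})"
  by (induction r) (simp_all add: lessThan_Suc)

lemma cyc_Suc_image: "cyc f (Suc r) a = add_mset a (image_mset f (cyc f r a))"
proof (induction r)
  case (Suc r)
  have "cyc f (Suc (Suc r)) a = add_mset ((f ^^ Suc r) a) (add_mset a (image_mset f (cyc f r a)))"
    by (simp only: cyc.simps(2)[of f "Suc r"] Suc.IH)
  also have "\<dots> = add_mset a (image_mset f (cyc f (Suc r) a))" by (simp add: add_mset_commute)
  finally show ?case .
qed simp

lemma cyc_add: "cyc f (r + t) a = cyc f r a + cyc f t ((f ^^ r) a)"
proof (induction t)
  case (Suc t)
  have "(f ^^ (r + t)) a = (f ^^ t) ((f ^^ r) a)" by (simp add: add.commute[of r] funpow_add)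
  then show ?case using Suc by simp
qed simp

lemma cyc_in_stable_msets:
  assumes "a \<in> periodic_pts f r"
  shows "cyc f r a \<in> stable_msets f r"
proof -
  have "add_mset a (image_mset f (cyc f r a)) = add_mset a (cyc f r a)"
    using assms by (simp add: periodic_pts_def flip: cyc_Suc_image)
  then show ?thesis by (simp add: stable_msets_def)
qed

lemma cyc_multiple:
  assumes "a \<in> periodic_pts f s"
  shows "cyc f (s * j) a = repeat_mset j (cyc f s a)"
proof (induction j)
  case (Suc j)
  have "cyc f (s * Suc j) a = cyc f (s + s * j) a" by simp
  also have "\<dots> = cyc f s a + cyc f (s * j) a"
    unfolding cyc_add using assms by (simp add: periodic_pts_def)
  finally show ?case using Suc by simp
qed simp

text \<open>If a point has least period s and multiplicity \<open>\<mu>\<close> in a stable multiset M, then exactly the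
  closed walks of length \<open>s, 2s, \<dots>, \<mu>s\<close> from that point are contained in M.\<close>

lemma card_closed_walks_at:
  assumes inj: "inj f" and M: "image_mset f M = M" and a: "a \<in># M"
  shows "card {r \<in> {1..size M}. a \<in> periodic_pts f r \<and> cyc f r a \<subseteq># M} = count M a"
proof -
  have orbit: "count M ((f ^^ i) a) = count M a" for i
  proof (induction i)
    case (Suc i)
    have "count M (f ((f ^^ i) a)) = count M ((f ^^ i) a)"
      using count_image_mset_inj[OF inj, of M "(f ^^ i) a"] by (simp only: M)
    then show ?case using Suc by simp
  qed simp
  have "\<exists>s>0. (f ^^ s) a = a"
  proof -
    have "range (\<lambda>i. (f ^^ i) a) \<subseteq> set_mset M"
      using orbit a by (auto simp flip: count_greater_zero_iff)
    then have "finite (range (\<lambda>i. (f ^^ i) a))" by (rule finite_subset) simp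
    then have "\<not> inj (\<lambda>i. (f ^^ i) a)" using finite_imageD infinite_UNIV_nat by blast
    then obtain i j where ij: "i < j" "(f ^^ i) a = (f ^^ j) a"
      unfolding inj_def by (metis linorder_neqE_nat)
    have "(f ^^ j) a = (f ^^ i) ((f ^^ (j - i)) a)"
      using ij(1) by (simp flip: funpow_add[THEN fun_cong, unfolded comp_apply])
    then have "(f ^^ (j - i)) a = a" using inj_fn[OF inj, of i] ij(2) by (simp add: inj_eq)
    then show ?thesis using ij(1) by (intro exI[of _ "j - i"]) simp
  qed
  then obtain s where s: "s > 0" "(f ^^ s) a = a" "\<And>t. t > 0 \<Longrightarrow> (f ^^ t) a = a \<Longrightarrow> s \<le> t"
  proof -
    let ?s = "LEAST s. s > 0 \<and> (f ^^ s) a = a"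
    have "?s > 0 \<and> (f ^^ ?s) a = a" by (rule LeastI_ex) fact
    moreover have "?s \<le> t" if "t > 0" "(f ^^ t) a = a" for t
      by (rule Least_le) (use that in simp)
    ultimately show ?thesis using that by blast
  qed
  have sa: "a \<in> periodic_pts f s" using s by (simp add: periodic_pts_def)
  have per: "a \<in> periodic_pts f r \<longleftrightarrow> s dvd r" for r
  proof
    assume "a \<in> periodic_pts f r"
    then have "(f ^^ (r mod s)) a = a" using funpow_mod_eq[OF s(2), of r] by (simp add: periodic_pts_def)
    then have "r mod s = 0" using s(1,3) by (metis mod_less_divisor not_gr_zero not_le)
    then show "s dvd r" by auto
  next
    assume "s dvd r"
    then have "r mod s = 0" by simp
    then show "a \<in> periodic_pts f r" using funpow_mod_eq[OF s(2), of r] by (simp add: periodic_pts_def)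
  qed
  have inj_s: "inj_on (\<lambda>i. (f ^^ i) a) {..<s}"
  proof (rule linorder_inj_onI')
    fix i j assume ij: "i \<in> {..<s}" "j \<in> {..<s}" "i < j"
    show "(f ^^ i) a \<noteq> (f ^^ j) a"
    proof
      assume "(f ^^ i) a = (f ^^ j) a"
      moreover have "(f ^^ j) a = (f ^^ i) ((f ^^ (j - i)) a)"
        using ij(3) by (simp flip: funpow_add[THEN fun_cong, unfolded comp_apply])
      ultimately have "(f ^^ i) ((f ^^ (j - i)) a) = (f ^^ i) a" by simp
      then have "(f ^^ (j - i)) a = a" using inj_fn[OF inj, of i] by (simp add: inj_eq)
      then have "s \<le> j - i" using s(3)[of "j - i"] ij by simp
      then show False using ij by simp
    qed
  qed
  define C where "C = cyc f s a"
  have C: "C = mset_set ((\<lambda>i. (f ^^ i) a) ` {..<s})"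
    unfolding C_def cyc_altdef using inj_s by (rule image_mset_mset_set)
  have sub: "repeat_mset j C \<subseteq># M \<longleftrightarrow> j \<le> count M a" for j
  proof
    have "a \<in> (\<lambda>i. (f ^^ i) a) ` {..<s}" using s(1) by (intro image_eqI[of _ _ 0]) auto
    then have "count C a = 1" unfolding C by simp
    moreover assume "repeat_mset j C \<subseteq># M"
    then have "count (repeat_mset j C) a \<le> count M a" by (rule mset_subset_eq_count)
    ultimately show "j \<le> count M a" by simp
  next
    assume j: "j \<le> count M a"
    show "repeat_mset j C \<subseteq># M"
    proof (rule mset_subset_eqI)
      fix x show "count (repeat_mset j C) x \<le> count M x"
      proof (cases "x \<in> (\<lambda>i. (f ^^ i) a) ` {..<s}")
        case True
        then show ?thesis using j orbit by (auto simp: C)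
      qed (simp add: C)
    qed
  qed
  have "{r \<in> {1..size M}. a \<in> periodic_pts f r \<and> cyc f r a \<subseteq># M} = (\<lambda>j. s * j) ` {1..count M a}"
  proof (intro equalityI subsetI)
    fix r assume r: "r \<in> {r \<in> {1..size M}. a \<in> periodic_pts f r \<and> cyc f r a \<subseteq># M}"
    then obtain j where j: "r = s * j" using per by blast
    then have "repeat_mset j C \<subseteq># M" using r cyc_multiple[OF sa] by (simp add: C_def)
    then have "j \<le> count M a" by (simp only: sub)
    moreover have "j \<ge> 1" using j r by (cases j) auto
    ultimately show "r \<in> (\<lambda>j. s * j) ` {1..count M a}" using j by auto
  next
    fix r assume "r \<in> (\<lambda>j. s * j) ` {1..count M a}"
    then obtain j where "j \<in> {1..count M a}" "r = s * j" by blast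
    then have j: "r = s * j" "j \<ge> 1" "j \<le> count M a" by simp_all
    have sub': "cyc f r a \<subseteq># M" using j sub cyc_multiple[OF sa] by (simp add: C_def)
    have "r \<le> size M" using size_mset_mono[OF sub'] by simp
    then show "r \<in> {r \<in> {1..size M}. a \<in> periodic_pts f r \<and> cyc f r a \<subseteq># M}"
      using sub' per j s(1) by auto
  qed
  moreover have "inj_on (\<lambda>j. s * j) {1..count M a}" using s(1) by (auto simp: inj_on_def)
  ultimately show ?thesis by (simp add: card_image)
qed

lemma sum_card_closed_walks:
  assumes inj: "inj f" and M: "M \<in> stable_msets f n"
  shows "(\<Sum>r=1..n. card {a \<in> periodic_pts f r. cyc f r a \<subseteq># M}) = n"
proof -
  have n: "size M = n" and st: "image_mset f M = M" using M by (auto simp: stable_msets_def)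
  have "card {a \<in> periodic_pts f r. cyc f r a \<subseteq># M}
      = (\<Sum>a\<in>set_mset M. if a \<in> periodic_pts f r \<and> cyc f r a \<subseteq># M then 1 else 0)"
    if r: "r \<in> {1..n}" for r
  proof -
    obtain t where "r = Suc t" using r by (cases r) auto
    then have "a \<in># cyc f r a" for a unfolding cyc_Suc_image by (simp add: cyc_Suc_image del: cyc.simps)
    then have "{a \<in> periodic_pts f r. cyc f r a \<subseteq># M}
        = {a \<in> set_mset M. a \<in> periodic_pts f r \<and> cyc f r a \<subseteq># M}"
      by (auto dest: mset_subset_eqD)
    then show ?thesis by (simp add: sum.If_cases Int_def)
  qed
  then have "(\<Sum>r=1..n. card {a \<in> periodic_pts f r. cyc f r a \<subseteq># M})
      = (\<Sum>r=1..n. \<Sum>a\<in>set_mset M. if a \<in> periodic_pts f r \<and> cyc f r a \<subseteq># M then 1 else 0)"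
    by (rule sum.cong[OF refl])
  also have "\<dots> = (\<Sum>a\<in>set_mset M. \<Sum>r=1..n. if a \<in> periodic_pts f r \<and> cyc f r a \<subseteq># M then 1 else 0)"
    by (rule sum.swap)
  also have "\<dots> = (\<Sum>a\<in>set_mset M. count M a)"
  proof (rule sum.cong[OF refl])
    fix a assume "a \<in># M"
    then show "(\<Sum>r=1..n. if a \<in> periodic_pts f r \<and> cyc f r a \<subseteq># M then 1 else 0) = count M a"
      using card_closed_walks_at[OF inj st, of a] n by (simp add: sum.If_cases Int_def)
  qed
  finally show ?thesis using n by (simp add: size_multiset_overloaded_eq)
qed

text \<open>Newton's identity: counting the pairs of a stable multiset M of size n and a closed walk inside
  M by M gives the left-hand side, and removing the walk from M gives the right-hand side.\<close>

lemma newton_stable_msets: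
  fixes L :: "'b multiset \<Rightarrow> 'c::comm_ring_1"
  assumes inj: "inj f" and fin: "\<And>k. finite (stable_msets f k)"
    and fin': "\<And>r. r \<ge> 1 \<Longrightarrow> finite (periodic_pts f r)"
    and L: "\<And>M N j k. M \<in> stable_msets f j \<Longrightarrow> N \<in> stable_msets f k \<Longrightarrow> L (M + N) = L M * L N"
  shows "of_nat n * (\<Sum>M\<in>stable_msets f n. L M)
    = (\<Sum>r=1..n. (\<Sum>a\<in>periodic_pts f r. L (cyc f r a)) * (\<Sum>M\<in>stable_msets f (n - r). L M))"
proof -
  have "of_nat n * (\<Sum>M\<in>stable_msets f n. L M)
      = (\<Sum>M\<in>stable_msets f n. of_nat (\<Sum>r=1..n. card {a \<in> periodic_pts f r. cyc f r a \<subseteq># M}) * L M)"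
    unfolding sum_distrib_left by (intro sum.cong refl) (simp only: sum_card_closed_walks[OF inj])
  also have "\<dots> = (\<Sum>M\<in>stable_msets f n. \<Sum>r=1..n. \<Sum>a\<in>periodic_pts f r. if cyc f r a \<subseteq># M then L M else 0)"
    unfolding of_nat_sum sum_distrib_right
    by (intro sum.cong refl) (simp add: sum.If_cases fin' Int_def)
  also have "\<dots> = (\<Sum>r=1..n. \<Sum>M\<in>stable_msets f n. \<Sum>a\<in>periodic_pts f r. if cyc f r a \<subseteq># M then L M else 0)"
    by (rule sum.swap)
  also have "\<dots> = (\<Sum>r=1..n. \<Sum>a\<in>periodic_pts f r. \<Sum>M\<in>stable_msets f n. if cyc f r a \<subseteq># M then L M else 0)"
    by (intro sum.cong refl sum.swap)
  also have "\<dots> = (\<Sum>r=1..n. \<Sum>a\<in>periodic_pts f r. L (cyc f r a) * (\<Sum>M\<in>stable_msets f (n - r). L M))"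
  proof (intro sum.cong refl)
    fix r a assume r: "r \<in> {1..n}" and a: "a \<in> periodic_pts f r"
    note c = cyc_in_stable_msets[OF a]
    have "(\<Sum>M\<in>stable_msets f n. if cyc f r a \<subseteq># M then L M else 0)
        = (\<Sum>M\<in>{M \<in> stable_msets f n. cyc f r a \<subseteq># M}. L M)"
      by (rule sum.inter_filter[symmetric]) (rule fin)
    also have "\<dots> = (\<Sum>M\<in>stable_msets f (n - r). L (cyc f r a + M))"
    proof (rule sum.reindex_bij_witness[of _ "\<lambda>M. cyc f r a + M" "\<lambda>M. M - cyc f r a"])
      fix M assume "M \<in> stable_msets f (n - r)"
      then show "cyc f r a + M \<in> {M \<in> stable_msets f n. cyc f r a \<subseteq># M}"
        using c r by (auto simp: stable_msets_def)
    next
      fix M assume M: "M \<in> {M \<in> stable_msets f n. cyc f r a \<subseteq># M}"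
      then show "M - cyc f r a \<in> stable_msets f (n - r)"
        using c by (auto simp: stable_msets_def size_Diff_submset image_mset_Diff)
    qed auto
    also have "\<dots> = L (cyc f r a) * (\<Sum>M\<in>stable_msets f (n - r). L M)"
      unfolding sum_distrib_left by (intro sum.cong refl L[OF c])
    finally show "(\<Sum>M\<in>stable_msets f n. if cyc f r a \<subseteq># M then L M else 0)
        = L (cyc f r a) * (\<Sum>M\<in>stable_msets f (n - r). L M)" .
  qed
  finally show ?thesis by (simp add: sum_distrib_right)
qed

text \<open>Comparing coefficients in \<open>X F' = S F\<close> computes the n-th coefficient of F from the earlier ones,
  since n is invertible.\<close>

lemma fps_log_deriv_unique:
  fixes F G S :: "'b::{field_char_0} fps"
  assumes F: "fps_X * fps_deriv F = S * F" and G: "fps_X * fps_deriv G = S * G"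
    and S: "fps_nth S 0 = 0" and FG: "fps_nth F 0 = fps_nth G 0"
  shows "F = G"
proof (rule fps_ext)
  fix n show "fps_nth F n = fps_nth G n"
  proof (induction n rule: less_induct)
    case (less n)
    have rec: "of_nat n * fps_nth H n = (\<Sum>i=1..n. fps_nth S i * fps_nth H (n - i))"
      if "fps_X * fps_deriv H = S * H" for H
    proof -
      have "of_nat n * fps_nth H n = fps_nth (fps_X * fps_deriv H) n"
        by (cases n) (simp_all del: of_nat_Suc)
      also have "\<dots> = (\<Sum>i=0..n. fps_nth S i * fps_nth H (n - i))" by (simp add: that fps_mult_nth)
      finally show ?thesis using S by (simp add: sum.atLeast_Suc_atMost)
    qed
    show ?case
    proof (cases "n = 0")
      case False
      have "of_nat n * fps_nth F n = of_nat n * fps_nth G n"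
        unfolding rec[OF F] rec[OF G] by (intro sum.cong refl) (use less in auto)
      then show ?thesis using False by simp
    qed (simp add: FG)
  qed
qed

lemma fps_log_deriv_prod:
  fixes F S :: "'i \<Rightarrow> 'b::comm_ring_1 fps"
  assumes "finite I" "\<And>i. i \<in> I \<Longrightarrow> fps_X * fps_deriv (F i) = S i * F i"
  shows "fps_X * fps_deriv (\<Prod>i\<in>I. F i) = (\<Sum>i\<in>I. S i) * (\<Prod>i\<in>I. F i)"
  using assms
proof (induction I rule: finite_induct)
  case (insert i I)
  have "fps_X * fps_deriv (F i * prod F I)
      = (fps_X * fps_deriv (F i)) * prod F I + F i * (fps_X * fps_deriv (prod F I))"
    by (simp add: algebra_simps)
  also have "\<dots> = (S i * F i) * prod F I + F i * (sum S I * prod F I)"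
    using insert by (simp only: insert_iff simp_thms)
  finally show ?case using insert by (simp add: algebra_simps)
qed simp

lemma fps_nth_prod_linear:
  fixes c :: "'i \<Rightarrow> 'b::comm_ring_1"
  assumes "finite I"
  shows "fps_nth (\<Prod>i\<in>I. 1 - fps_const (c i) * fps_X) (card I) = (\<Prod>i\<in>I. - c i)
    \<and> (\<forall>n > card I. fps_nth (\<Prod>i\<in>I. 1 - fps_const (c i) * fps_X) n = 0)"
  using assms
proof (induction I rule: finite_induct)
  case (insert i I)
  let ?P = "\<Prod>i\<in>I. 1 - fps_const (c i) * fps_X"
  have step: "fps_nth ((1 - fps_const (c i) * fps_X) * ?P) (Suc n) = fps_nth ?P (Suc n) - c i * fps_nth ?P n" for n
    by (simp add: left_diff_distrib mult.assoc)
  have IH: "fps_nth ?P (card I) = (\<Prod>i\<in>I. - c i)" "\<And>n. n > card I \<Longrightarrow> fps_nth ?P n = 0"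
    using insert.IH by blast+
  have P: "(\<Prod>i\<in>insert i I. 1 - fps_const (c i) * fps_X) = (1 - fps_const (c i) * fps_X) * ?P"
    using insert.hyps by simp
  have card: "card (insert i I) = Suc (card I)" using insert.hyps by simp
  show ?case
  proof (intro conjI allI impI)
    show "fps_nth (\<Prod>i\<in>insert i I. 1 - fps_const (c i) * fps_X) (card (insert i I)) = (\<Prod>i\<in>insert i I. - c i)"
      unfolding P card step using insert.hyps by (simp add: IH)
    fix n assume "n > card (insert i I)"
    then obtain m where m: "n = Suc m" "m > card I" unfolding card by (cases n) auto
    show "fps_nth (\<Prod>i\<in>insert i I. 1 - fps_const (c i) * fps_X) n = 0"
      unfolding P m(1) step using m(2) by (simp add: IH)
  qed
qed simp


section \<open>Monic polynomials and their roots\<close>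

definition lin_prod :: "'b::comm_ring_1 multiset \<Rightarrow> 'b poly" where
  "lin_prod M = (\<Prod>a\<in>#M. [:- a, 1:])"

definition monic_polys :: "nat \<Rightarrow> 'b::comm_ring_1 poly set" where
  "monic_polys n = {f. degree f = n \<and> coeff f n = 1}"

lemma lin_prod_add_mset: "lin_prod (add_mset a M) = [:- a, 1:] * lin_prod M"
  by (simp add: lin_prod_def)

lemma lin_prod_empty [simp]: "lin_prod {#} = 1"
  by (simp add: lin_prod_def)

lemma lin_prod_nonzero [simp]: "lin_prod (M :: 'b::idom multiset) \<noteq> 0"
  by (induction M) (simp_all add: lin_prod_add_mset del: mult_pCons_left)

lemma degree_lin_prod: "degree (lin_prod (M :: 'b::idom multiset)) = size M"
  by (induction M) (simp_all add: lin_prod_add_mset degree_mult_eq del: mult_pCons_left)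

lemma lead_coeff_lin_prod: "lead_coeff (lin_prod (M :: 'b::idom multiset)) = 1"
  by (induction M) (simp_all add: lin_prod_add_mset lead_coeff_mult del: mult_pCons_left)

lemma proots_lin_prod: "proots (lin_prod (M :: 'b::idom multiset)) = M"
  by (induction M) (simp_all add: lin_prod_add_mset proots_mult del: mult_pCons_left)

lemma coeff_0_lin_prod: "coeff (lin_prod M) 0 = (-1) ^ size M * prod_mset M"
  by (induction M) (simp_all add: lin_prod_add_mset coeff_mult del: mult_pCons_left)

lemma lin_prod_proots:
  fixes f :: "'b::alg_closed_field poly"
  assumes "f \<in> monic_polys n"
  shows "lin_prod (proots f) = f" "size (proots f) = n"
proof -
  have "f \<noteq> 0" using assms by (auto simp: monic_polys_def)
  then obtain A where "size A = degree f" "f = smult (lead_coeff f) (\<Prod>x\<in>#A. [:-x, 1:])"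
    using alg_closed_imp_factorization by blast
  moreover have "degree f = n" "lead_coeff f = 1" using assms by (auto simp: monic_polys_def)
  ultimately have A: "size A = n" "f = lin_prod A" by (simp_all only: lin_prod_def smult_1_left)
  then show "lin_prod (proots f) = f" "size (proots f) = n" by (simp_all add: proots_lin_prod)
qed

lemma map_poly_hom_mult:
  fixes h :: "'b::comm_ring_1 \<Rightarrow> 'c::comm_ring_1"
  assumes "h 0 = 0" "\<And>x y. h (x + y) = h x + h y" "\<And>x y. h (x * y) = h x * h y"
  shows "map_poly h (p * r) = map_poly h p * map_poly h r"
proof -
  have "h (\<Sum>i\<in>I. g i) = (\<Sum>i\<in>I. h (g i))" for I and g :: "nat \<Rightarrow> 'b"
    by (induction I rule: infinite_finite_induct) (simp_all add: assms)
  then show ?thesis by (intro poly_eqI) (simp add: coeff_map_poly coeff_mult assms)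
qed

lemma map_poly_lin_prod:
  fixes h :: "'b::comm_ring_1 \<Rightarrow> 'c::comm_ring_1"
  assumes h: "h 0 = 0" "h 1 = 1" "\<And>x y. h (x + y) = h x + h y" "\<And>x y. h (x * y) = h x * h y"
  shows "map_poly h (lin_prod M) = lin_prod (image_mset h M)"
proof (induction M)
  case (add a M)
  have "h (- a) + h a = 0" using h(3)[of "- a" a] h(1) by simp
  then have "h (- a) = - h a" by (simp add: eq_neg_iff_add_eq_0)
  then have "map_poly h [:- a, 1:] = [:- h a, 1:]"
    using h by (intro poly_eqI) (simp add: coeff_map_poly coeff_pCons split: nat.split)
  then show ?case using add
    by (simp add: lin_prod_add_mset map_poly_hom_mult[OF h(1,3,4)] del: mult_pCons_left)
qed (simp add: h(2))

text \<open>The logarithmic derivative of \<open>F = \<Prod>(1 - a X)\<close> is the generating series of the power sums,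
  up to sign.\<close>

lemma newton_power_sums:
  fixes M :: "'b::field multiset"
  defines "F \<equiv> (\<Prod>a\<in>#M. 1 - fps_const a * fps_X)"
  defines "P \<equiv> Abs_fps (\<lambda>k. if k = 0 then 0 else (\<Sum>a\<in>#M. a ^ k))"
  shows "fps_X * fps_deriv F = - P * F"
  unfolding F_def P_def
proof (induction M)
  case (add b M)
  let ?F = "\<lambda>M. \<Prod>a\<in>#M. 1 - fps_const a * fps_X"
  let ?P = "\<lambda>M. Abs_fps (\<lambda>k. if k = 0 then 0 else (\<Sum>a\<in>#M. a ^ k))"
  have geo: "?P {#b#} * (1 - fps_const b * fps_X) = fps_const b * fps_X"
  proof (rule fps_ext)
    fix n
    have "fps_nth (?P {#b#} * (1 - fps_const b * fps_X)) n
        = fps_nth (?P {#b#} - fps_const b * (?P {#b#} * fps_X)) n"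
      by (simp add: algebra_simps)
    also have "\<dots> = fps_nth (fps_const b * fps_X) n"
      by (cases n) (auto simp: fps_X_nth)
    finally show "fps_nth (?P {#b#} * (1 - fps_const b * fps_X)) n = fps_nth (fps_const b * fps_X) n" .
  qed
  have P: "?P (add_mset b M) = ?P {#b#} + ?P M" by (intro fps_ext) auto
  have "fps_X * fps_deriv (?F (add_mset b M))
      = - (fps_const b * fps_X) * ?F M + (1 - fps_const b * fps_X) * (fps_X * fps_deriv (?F M))"
    by (simp add: algebra_simps)
  also have "\<dots> = - (?P {#b#} * (1 - fps_const b * fps_X)) * ?F M
      + (1 - fps_const b * fps_X) * (- ?P M * ?F M)"
    unfolding geo add.IH ..
  also have "\<dots> = - ?P (add_mset b M) * ?F (add_mset b M)"
    unfolding P by (simp add: algebra_simps)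
  finally show ?case .
qed (simp add: fps_eq_iff)

lemma fps_nth_prod_eq_coeff:
  fixes M :: "'b::field multiset"
  assumes "k \<le> size M"
  shows "fps_nth (\<Prod>a\<in>#M. 1 - fps_const a * fps_X) k = coeff (lin_prod M) (size M - k)"
proof -
  have "(\<Prod>a\<in>#M. 1 - fps_const a * fps_X) = fps_of_poly (reflect_poly (lin_prod M))"
  proof (induction M)
    case (add a M)
    have "fps_of_poly (reflect_poly [:- a, 1:]) = 1 - fps_const a * fps_X"
      by (cases "a = 0") (simp_all add: reflect_poly_def fps_of_poly_pCons)
    then show ?case using add
      by (simp add: lin_prod_add_mset reflect_poly_mult fps_of_poly_mult del: mult_pCons_left)
  qed simp
  then show ?thesis using assms by (simp add: coeff_reflect_poly degree_lin_prod)
qed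

lemma power_sum_recurrence:
  fixes M :: "'b::field multiset"
  assumes "k \<le> size M" "k \<ge> 1"
  shows "(\<Sum>a\<in>#M. a ^ k) + of_nat k * coeff (lin_prod M) (size M - k)
    = - (\<Sum>i=1..<k. (\<Sum>a\<in>#M. a ^ i) * coeff (lin_prod M) (size M - (k - i)))"
proof -
  let ?F = "\<Prod>a\<in>#M. 1 - fps_const a * fps_X"
  let ?P = "Abs_fps (\<lambda>k. if k = 0 then 0 else (\<Sum>a\<in>#M. a ^ k))"
  obtain k' where k': "k = Suc k'" using assms(2) by (cases k) auto
  have F0: "fps_nth ?F 0 = 1"
    using fps_nth_prod_eq_coeff[of 0 M] lead_coeff_lin_prod[of M] by (simp add: degree_lin_prod)
  have "of_nat k * fps_nth ?F k = fps_nth (fps_X * fps_deriv ?F) k" by (simp add: k')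
  also have "\<dots> = - fps_nth (?P * ?F) k" by (simp add: newton_power_sums)
  also have "fps_nth (?P * ?F) k = (\<Sum>i=1..k. (\<Sum>a\<in>#M. a ^ i) * fps_nth ?F (k - i))"
    unfolding fps_mult_nth by (subst sum.atLeast_Suc_atMost) auto
  also have "\<dots> = (\<Sum>a\<in>#M. a ^ k) + (\<Sum>i=1..<k. (\<Sum>a\<in>#M. a ^ i) * fps_nth ?F (k - i))"
    using assms(2) F0 by (subst sum.last_plus) (auto simp: k' atLeastLessThanSuc_atLeastAtMost)
  also have "(\<Sum>i=1..<k. (\<Sum>a\<in>#M. a ^ i) * fps_nth ?F (k - i))
      = (\<Sum>i=1..<k. (\<Sum>a\<in>#M. a ^ i) * coeff (lin_prod M) (size M - (k - i)))"
    by (intro sum.cong refl) (use assms in \<open>simp add: fps_nth_prod_eq_coeff\<close>)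
  finally have *: "of_nat k * coeff (lin_prod M) (size M - k) = - ((\<Sum>a\<in>#M. a ^ k)
      + (\<Sum>i=1..<k. (\<Sum>a\<in>#M. a ^ i) * coeff (lin_prod M) (size M - (k - i))))"
    by (simp only: fps_nth_prod_eq_coeff[OF assms(1)])
  show ?thesis unfolding * by simp
qed

text \<open>By the recurrence the power sums of exponent less than n do not involve the constant
  coefficient, and the n-th one involves it only through the term n times that coefficient.\<close>

lemma power_sum_constant_coeff:
  fixes M N :: "'b::field multiset"
  assumes n: "size M = n" "size N = n" "n \<ge> 1"
    and c: "\<And>i. i \<ge> 1 \<Longrightarrow> coeff (lin_prod M) i = coeff (lin_prod N) i"
  shows "(\<Sum>a\<in>#M. a ^ n) + of_nat n * coeff (lin_prod M) 0
    = (\<Sum>a\<in>#N. a ^ n) + of_nat n * coeff (lin_prod N) 0"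
proof -
  have less: "(\<Sum>a\<in>#M. a ^ k) = (\<Sum>a\<in>#N. a ^ k)" if "1 \<le> k" "k < n" for k
    using that
  proof (induction k rule: less_induct)
    case (less k)
    have eS: "(\<Sum>i=1..<k. (\<Sum>a\<in>#M. a ^ i) * coeff (lin_prod M) (n - (k - i)))
        = (\<Sum>i=1..<k. (\<Sum>a\<in>#N. a ^ i) * coeff (lin_prod N) (n - (k - i)))"
      by (intro sum.cong refl) (use less c in auto)
    have eC: "coeff (lin_prod M) (n - k) = coeff (lin_prod N) (n - k)" using less by (intro c) auto
    have eM: "(\<Sum>a\<in>#M. a ^ k) + of_nat k * coeff (lin_prod M) (n - k)
        = - (\<Sum>i=1..<k. (\<Sum>a\<in>#M. a ^ i) * coeff (lin_prod M) (n - (k - i)))"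
      using power_sum_recurrence[of k M] less.prems n(1) by simp
    have eN: "(\<Sum>a\<in>#N. a ^ k) + of_nat k * coeff (lin_prod N) (n - k)
        = - (\<Sum>i=1..<k. (\<Sum>a\<in>#N. a ^ i) * coeff (lin_prod N) (n - (k - i)))"
      using power_sum_recurrence[of k N] less.prems n(2) by simp
    have "(\<Sum>a\<in>#M. a ^ k) + of_nat k * coeff (lin_prod M) (n - k)
        = (\<Sum>a\<in>#N. a ^ k) + of_nat k * coeff (lin_prod N) (n - k)"
      unfolding eM eN eS ..
    then show ?case unfolding eC by simp
  qed
  have "(\<Sum>i=1..<n. (\<Sum>a\<in>#M. a ^ i) * coeff (lin_prod M) (n - (n - i)))
      = (\<Sum>i=1..<n. (\<Sum>a\<in>#N. a ^ i) * coeff (lin_prod N) (n - (n - i)))"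
    by (intro sum.cong refl) (use less c in auto)
  moreover have "(\<Sum>a\<in>#M. a ^ n) + of_nat n * coeff (lin_prod M) 0
      = - (\<Sum>i=1..<n. (\<Sum>a\<in>#M. a ^ i) * coeff (lin_prod M) (n - (n - i)))"
    using power_sum_recurrence[of n M] n(1,3) by simp
  moreover have "(\<Sum>a\<in>#N. a ^ n) + of_nat n * coeff (lin_prod N) 0
      = - (\<Sum>i=1..<n. (\<Sum>a\<in>#N. a ^ i) * coeff (lin_prod N) (n - (n - i)))"
    using power_sum_recurrence[of n N] n(2,3) by simp
  ultimately show ?thesis by simp
qed

lemma sum_mset_eq_coeff:
  fixes M :: "'b::field multiset"
  assumes "size M = n" "n \<ge> 1"
  shows "sum_mset M = - coeff (lin_prod M) (n - 1)"
proof -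
  have "sum_mset M + coeff (lin_prod M) (n - 1) = 0"
    using power_sum_recurrence[of 1 M] assms by simp
  then show ?thesis by (rule eq_neg_iff_add_eq_0[THEN iffD2])
qed


section \<open>The Hasse--Davenport product formula\<close>

abbreviation frobenius :: "'a::{field,finite} alg_closure \<Rightarrow> 'a alg_closure" where
  "frobenius x \<equiv> x ^ CARD('a)"

definition roots_ac :: "'a::{field,finite} poly \<Rightarrow> 'a alg_closure multiset" where
  "roots_ac f = proots (map_poly to_ac f)"

lemma funpow_frobenius: "(frobenius ^^ r) x = (x :: 'a::{field,finite} alg_closure) ^ (CARD('a) ^ r)"
  by (induction r) (simp_all add: power_mult[symmetric] mult.commute)

lemma finite_periodic_pts_frobenius:
  "r \<ge> 1 \<Longrightarrow> finite (periodic_pts (frobenius :: 'a::{field,finite} alg_closure \<Rightarrow> _) r)"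
  using finite_frobenius_power_fixed[of r, where 'a = 'a]
  by (simp add: periodic_pts_def funpow_frobenius)

lemma map_poly_to_ac_monic:
  assumes "f \<in> monic_polys n"
  shows "map_poly to_ac f \<in> monic_polys n"
  using assms by (auto simp: monic_polys_def degree_map_poly coeff_map_poly)

lemma lin_prod_roots_ac: "f \<in> monic_polys n \<Longrightarrow> lin_prod (roots_ac f) = map_poly to_ac f"
  and size_roots_ac: "f \<in> monic_polys n \<Longrightarrow> size (roots_ac f) = n"
  using lin_prod_proots[OF map_poly_to_ac_monic] by (auto simp: roots_ac_def)

lemma map_poly_frobenius_lin_prod:
  fixes M :: "'a::{field,finite} alg_closure multiset"
  shows "map_poly frobenius (lin_prod M) = lin_prod (image_mset frobenius M)"
  by (rule map_poly_lin_prod) (simp_all add: frobenius_add power_mult_distrib)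

text \<open>A monic polynomial over the algebraic closure has coefficients in the finite field if and only
  if its multiset of roots is Frobenius-stable.\<close>

lemma bij_betw_roots_ac:
  "bij_betw roots_ac (monic_polys n) (stable_msets (frobenius :: 'a::{field,finite} alg_closure \<Rightarrow> _) n)"
  unfolding bij_betw_def
proof (intro conjI equalityI subsetI)
  show "inj_on roots_ac (monic_polys n :: 'a poly set)"
  proof (rule inj_onI)
    fix f g :: "'a poly" assume "f \<in> monic_polys n" "g \<in> monic_polys n" "roots_ac f = roots_ac g"
    then have "map_poly to_ac f = map_poly to_ac g" by (metis lin_prod_roots_ac)
    then have "to_ac (coeff f i) = to_ac (coeff g i)" for i by (metis coeff_map_poly to_ac_0)
    then show "f = g" by (intro poly_eqI) simp
  qed
next
  fix M assume "M \<in> roots_ac ` (monic_polys n :: 'a poly set)"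
  then obtain f :: "'a poly" where f: "f \<in> monic_polys n" "M = roots_ac f" by blast
  have "lin_prod (image_mset frobenius M) = map_poly frobenius (map_poly to_ac f)"
    using f by (simp add: lin_prod_roots_ac map_poly_frobenius_lin_prod[symmetric])
  also have "\<dots> = map_poly to_ac f"
    by (intro poly_eqI) (simp add: coeff_map_poly finite_field_power_card flip: to_ac_power)
  also have "\<dots> = lin_prod M" using f by (simp add: lin_prod_roots_ac)
  finally have "image_mset frobenius M = M" by (metis proots_lin_prod)
  then show "M \<in> stable_msets frobenius n" using f by (simp add: stable_msets_def size_roots_ac)
next
  fix M assume M: "M \<in> stable_msets (frobenius :: 'a alg_closure \<Rightarrow> _) n"
  define f where "f = map_poly of_ac (lin_prod M)"
  have "map_poly frobenius (lin_prod M) = lin_prod M"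
    using M by (simp add: map_poly_frobenius_lin_prod stable_msets_def)
  then have "coeff (lin_prod M) i ^ CARD('a) = coeff (lin_prod M) i" for i
    by (metis coeff_map_poly power_zero_numeral zero_less_card_finite power_0_left less_irrefl)
  then have "coeff (lin_prod M) i \<in> range to_ac" for i by (simp only: frobenius_fixed_iff)
  then have f: "map_poly to_ac f = lin_prod M"
    by (intro poly_eqI) (simp add: f_def coeff_map_poly to_ac_of_ac)
  have "degree f = degree (map_poly to_ac f)" by (rule degree_map_poly[symmetric]) auto
  then have deg: "degree f = n" using M by (simp add: f degree_lin_prod stable_msets_def)
  have "to_ac (coeff f n) = coeff (lin_prod M) n" by (simp add: f[symmetric] coeff_map_poly)
  also have "\<dots> = to_ac 1"
    using lead_coeff_lin_prod[of M] M by (simp add: degree_lin_prod stable_msets_def)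
  finally have "coeff f n = 1" by (simp only: to_ac_eq_iff)
  then have "f \<in> monic_polys n" using deg by (simp add: monic_polys_def)
  moreover have "roots_ac f = M" by (simp add: roots_ac_def f proots_lin_prod)
  ultimately show "M \<in> roots_ac ` monic_polys n" by blast
qed

lemma finite_monic_polys: "finite (monic_polys n :: 'a::{field,finite} poly set)"
proof (rule finite_subset)
  show "monic_polys n \<subseteq> (\<lambda>c. \<Sum>i\<le>n. monom (c i) i) ` ({..n} \<rightarrow>\<^sub>E (UNIV :: 'a set))"
  proof
    fix f :: "'a poly" assume "f \<in> monic_polys n"
    then have "f = (\<Sum>i\<le>n. monom (restrict (coeff f) {..n} i) i)"
      using poly_as_sum_of_monoms[of f] by (simp add: monic_polys_def)
    then show "f \<in> (\<lambda>c. \<Sum>i\<le>n. monom (c i) i) ` ({..n} \<rightarrow>\<^sub>E (UNIV :: 'a set))"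
      by (intro image_eqI[of _ _ "restrict (coeff f) {..n}"]) simp_all
  qed
qed (simp add: finite_PiE)

lemma finite_stable_msets_frobenius:
  "finite (stable_msets (frobenius :: 'a::{field,finite} alg_closure \<Rightarrow> _) n)"
  by (rule bij_betw_finite[OF bij_betw_roots_ac, THEN iffD1, OF finite_monic_polys])

lemma power_prod_mset: "prod_mset M ^ k = prod_mset (image_mset (\<lambda>x. x ^ k) (M :: 'b::comm_semiring_1 multiset))"
  by (induction M) (simp_all add: power_mult_distrib)

lemma prod_mset_stable:
  fixes M :: "'a::{field,finite} alg_closure multiset"
  assumes "M \<in> stable_msets frobenius n"
  shows "prod_mset M \<in> range to_ac"
  using assms by (simp add: stable_msets_def power_prod_mset flip: frobenius_fixed_iff)

lemma power_sum_stable: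
  fixes M :: "'a::{field,finite} alg_closure multiset"
  assumes "M \<in> stable_msets frobenius n"
  shows "(\<Sum>a\<in>#M. a ^ m) \<in> range to_ac"
proof -
  have "(\<Sum>a\<in>#N. a ^ m) ^ CARD('a) = (\<Sum>a\<in>#image_mset frobenius N. a ^ m)"
    for N :: "'a alg_closure multiset"
    by (induction N) (simp_all add: frobenius_add power_mult[symmetric] mult.commute)
  then show ?thesis using assms by (simp add: stable_msets_def flip: frobenius_fixed_iff)
qed

lemma of_ac_mult: "x \<in> range to_ac \<Longrightarrow> y \<in> range to_ac \<Longrightarrow> of_ac (x * y) = of_ac x * of_ac y"
  and of_ac_add: "x \<in> range to_ac \<Longrightarrow> y \<in> range to_ac \<Longrightarrow> of_ac (x + y) = of_ac x + of_ac y"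
  and of_ac_power: "x \<in> range to_ac \<Longrightarrow> of_ac (x ^ k) = of_ac x ^ k"
  by (auto simp flip: to_ac_mult to_ac_add to_ac_power)

lemma mult_sum_powers_card:
  assumes "m dvd CARD('a::{field,finite}) - 1"
  shows "m * ((\<Sum>i<r. CARD('a) ^ i) * ((CARD('a) - 1) div m)) = CARD('a) ^ r - 1"
proof -
  have "m * ((\<Sum>i<r. CARD('a) ^ i) * ((CARD('a) - 1) div m)) = (CARD('a) - 1) * (\<Sum>i<r. CARD('a) ^ i)"
    using assms by (simp add: mult.assoc mult.left_commute mult.commute)
  also have "\<dots> = CARD('a) ^ r - 1"
  proof (induction r)
    case (Suc r)
    have "CARD('a) ^ r \<ge> 1" using card_field_ge_2[where 'a = 'a] by simp
    then show ?case using Suc by (simp add: distrib_left diff_mult_distrib)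
  qed simp
  finally show ?thesis .
qed

lemma prod_mset_cyc_frobenius:
  fixes a :: "'a::{field,finite} alg_closure"
  shows "prod_mset (cyc frobenius r a) = a ^ (\<Sum>i<r. CARD('a) ^ i)"
  by (induction r) (simp_all add: funpow_frobenius power_add mult.commute)

lemma cyc_frobenius_power:
  fixes a :: "'a::{field,finite} alg_closure"
  shows "cyc frobenius r (a ^ m) = image_mset (\<lambda>x. x ^ m) (cyc frobenius r a)"
  by (induction r) (simp_all add: funpow_frobenius power_mult[symmetric] mult.commute)

context char_setup
begin

text \<open>For m = 1 this is the Dirichlet character on polynomials over the finite field that gives rise to
  the Gauss sum of \<open>\<beta>\<close>, written as a function of the multiset of roots.  For \<open>\<beta> = \<alpha>\<^sup>m\<close> it is the pullback
  of the one attached to \<open>\<alpha>\<close> under the m-th power map on roots.\<close>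

definition root_weight :: "('a \<Rightarrow> qbar) \<Rightarrow> nat \<Rightarrow> 'a alg_closure multiset \<Rightarrow> qbar" where
  "root_weight \<beta> m M = \<beta> (of_ac (prod_mset M)) * \<psi> (of_ac (\<Sum>a\<in>#M. a ^ m))"

text \<open>The n-th coefficient of the L-function of the weight.\<close>

definition stable_sum :: "('a \<Rightarrow> qbar) \<Rightarrow> nat \<Rightarrow> nat \<Rightarrow> qbar" where
  "stable_sum \<beta> m n = (\<Sum>M\<in>stable_msets frobenius n. root_weight \<beta> m M)"

text \<open>The r-th coefficient of the logarithmic derivative of the L-function.\<close>

definition walk_sum :: "('a \<Rightarrow> qbar) \<Rightarrow> nat \<Rightarrow> nat \<Rightarrow> qbar" where
  "walk_sum \<beta> m r = (\<Sum>a\<in>periodic_pts frobenius r. root_weight \<beta> m (cyc frobenius r a))"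

lemma root_weight_add:
  assumes "\<beta> \<in> mult_chars" "M \<in> stable_msets frobenius j" "N \<in> stable_msets frobenius k"
  shows "root_weight \<beta> m (M + N) = root_weight \<beta> m M * root_weight \<beta> m N"
  using prod_mset_stable[OF assms(2)] prod_mset_stable[OF assms(3)]
    power_sum_stable[OF assms(2), of m] power_sum_stable[OF assms(3), of m]
  by (simp add: root_weight_def of_ac_mult of_ac_add mult_char_mult[OF assms(1)] psi_add)

lemma log_deriv_stable_sum:
  assumes "\<beta> \<in> mult_chars"
  shows "fps_X * fps_deriv (Abs_fps (stable_sum \<beta> m))
    = Abs_fps (\<lambda>r. if r = 0 then 0 else walk_sum \<beta> m r) * Abs_fps (stable_sum \<beta> m)"
proof (rule fps_ext)
  fix n
  have "fps_nth (fps_X * fps_deriv (Abs_fps (stable_sum \<beta> m))) n = of_nat n * stable_sum \<beta> m n"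
    by (cases n) (simp_all del: of_nat_Suc)
  also have "\<dots> = (\<Sum>r=1..n. walk_sum \<beta> m r * stable_sum \<beta> m (n - r))"
    unfolding stable_sum_def walk_sum_def
    by (rule newton_stable_msets[OF inj_frobenius finite_stable_msets_frobenius
          finite_periodic_pts_frobenius root_weight_add[OF assms]])
  also have "\<dots> = fps_nth (Abs_fps (\<lambda>r. if r = 0 then 0 else walk_sum \<beta> m r) * Abs_fps (stable_sum \<beta> m)) n"
    unfolding fps_mult_nth by (subst sum.atLeast_Suc_atMost) auto
  finally show "fps_nth (fps_X * fps_deriv (Abs_fps (stable_sum \<beta> m))) n
    = fps_nth (Abs_fps (\<lambda>r. if r = 0 then 0 else walk_sum \<beta> m r) * Abs_fps (stable_sum \<beta> m)) n" .
qed

lemma stable_sum_eq_sum_monic: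
  "stable_sum \<beta> m n = (\<Sum>f\<in>monic_polys n. root_weight \<beta> m (roots_ac f))"
  unfolding stable_sum_def by (rule sum.reindex_bij_betw[OF bij_betw_roots_ac, symmetric])

lemma of_ac_prod_roots:
  fixes f :: "'a poly"
  assumes "f \<in> monic_polys n"
  shows "of_ac (prod_mset (roots_ac f)) = (-1) ^ n * coeff f 0"
proof (rule of_ac_eqI)
  have "to_ac (coeff f 0) = (-1) ^ n * prod_mset (roots_ac f)"
    using coeff_0_lin_prod[of "roots_ac f"]
    unfolding lin_prod_roots_ac[OF assms] size_roots_ac[OF assms] by (simp add: coeff_map_poly)
  moreover have "(-1) ^ n * (-1) ^ n = (1 :: 'a alg_closure)" by (simp flip: power_mult_distrib)
  ultimately show "to_ac ((-1) ^ n * coeff f 0) = prod_mset (roots_ac f)"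
    by (simp flip: mult.assoc)
qed

lemma of_ac_sum_roots:
  fixes f :: "'a poly"
  assumes "f \<in> monic_polys n" "n \<ge> 1"
  shows "of_ac (sum_mset (roots_ac f)) = - coeff f (n - 1)"
proof (rule of_ac_eqI)
  show "to_ac (- coeff f (n - 1)) = sum_mset (roots_ac f)"
    using sum_mset_eq_coeff[OF size_roots_ac[OF assms(1)] assms(2)]
    unfolding lin_prod_roots_ac[OF assms(1)] by (simp add: coeff_map_poly)
qed

lemma stable_sum_0: "\<beta> \<in> mult_chars \<Longrightarrow> stable_sum \<beta> m 0 = 1"
proof -
  have "stable_msets frobenius 0 = {{#} :: 'a alg_closure multiset}" by (auto simp: stable_msets_def)
  then show "\<beta> \<in> mult_chars \<Longrightarrow> stable_sum \<beta> m 0 = 1"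
    by (simp add: stable_sum_def root_weight_def mult_char_1 psi_0)
qed

lemma stable_sum_1:
  assumes "\<beta> \<in> mult_chars"
  shows "stable_sum \<beta> 1 1 = - gauss_sum \<psi> \<beta>"
proof -
  have "stable_sum \<beta> 1 1 = (\<Sum>x\<in>UNIV. root_weight \<beta> 1 {#to_ac x#})"
    unfolding stable_sum_def
  proof (rule sum.reindex_bij_betw[symmetric])
    show "bij_betw (\<lambda>x. {#to_ac x#}) UNIV (stable_msets frobenius 1 :: 'a alg_closure multiset set)"
      unfolding bij_betw_def
    proof (intro conjI equalityI subsetI)
      fix M assume M: "M \<in> stable_msets (frobenius :: 'a alg_closure \<Rightarrow> _) 1"
      then have "size M = 1" by (simp only: stable_msets_def mem_Collect_eq)
      then obtain b where b: "M = {#b#}" using size_1_singleton_mset by blast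
      then have "b \<in> range to_ac" using M by (simp add: stable_msets_def frobenius_fixed_iff)
      then show "M \<in> range (\<lambda>x. {#to_ac x#})" using b by blast
    qed (auto simp: inj_def stable_msets_def finite_field_power_card simp flip: to_ac_power)
  qed
  also have "\<dots> = (\<Sum>x\<in>UNIV. \<beta> x * \<psi> x)" by (simp add: root_weight_def)
  also have "\<dots> = (\<Sum>x\<in>UNIV - {0}. \<beta> x * \<psi> x)"
    by (rule sum.mono_neutral_right) (auto simp: mult_char_0[OF assms])
  finally show ?thesis by (simp add: gauss_sum_def)
qed

text \<open>Changing the coefficient of \<open>X\<^sup>n\<^sup>-\<^sup>1\<close> multiplies the weight by a nontrivial value of
  \<open>\<psi>\<close> and leaves the constant coefficient alone, since \<open>n \<ge> 2\<close>.\<close>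

lemma stable_sum_vanishes:
  assumes "\<beta> \<in> mult_chars" "n \<ge> 2"
  shows "stable_sum \<beta> 1 n = 0"
proof -
  obtain c where c: "\<psi> c \<noteq> 1" using psi by (auto simp: nontrivial_add_char_def)
  have wt: "root_weight \<beta> 1 (roots_ac f) = \<beta> ((-1) ^ n * coeff f 0) * \<psi> (- coeff f (n - 1))"
    if "f \<in> monic_polys n" for f
    using of_ac_prod_roots[OF that] of_ac_sum_roots[OF that] assms(2) by (simp add: root_weight_def)
  have shift: "f + monom c (n - 1) \<in> monic_polys n" if "f \<in> monic_polys n" for f :: "'a poly" and c
  proof -
    have "degree (monom c (n - 1)) < degree f"
      using that assms(2) degree_monom_le[of c "n - 1"] by (auto simp: monic_polys_def)
    then show ?thesis
      using that assms(2) by (simp add: monic_polys_def degree_add_eq_left)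
  qed
  have "stable_sum \<beta> 1 n = (\<Sum>f\<in>monic_polys n. root_weight \<beta> 1 (roots_ac (f + monom (- c) (n - 1))))"
    unfolding stable_sum_eq_sum_monic
    by (rule sum.reindex_bij_witness[of _ "\<lambda>f. f + monom (- c) (n - 1)" "\<lambda>f. f + monom c (n - 1)"])
       (auto simp: shift add.assoc add_monom simp del: One_nat_def)
  also have "\<dots> = (\<Sum>f\<in>monic_polys n. \<psi> c * root_weight \<beta> 1 (roots_ac f))"
  proof (rule sum.cong[OF refl])
    fix f :: "'a poly" assume f: "f \<in> monic_polys n"
    have "\<psi> (- (coeff f (n - 1) - c)) = \<psi> c * \<psi> (- coeff f (n - 1))"
      by (simp flip: psi_add)
    then show "root_weight \<beta> 1 (roots_ac (f + monom (- c) (n - 1))) = \<psi> c * root_weight \<beta> 1 (roots_ac f)"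
      using assms(2) by (simp add: wt[OF f] wt[OF shift[OF f]] del: One_nat_def)
  qed
  also have "\<dots> = \<psi> c * stable_sum \<beta> 1 n"
    unfolding stable_sum_eq_sum_monic by (rule sum_distrib_left[symmetric])
  finally show ?thesis using c by simp
qed

lemma stable_sum_fps:
  assumes "\<beta> \<in> mult_chars"
  shows "Abs_fps (stable_sum \<beta> 1) = 1 - fps_const (gauss_sum \<psi> \<beta>) * fps_X"
proof (rule fps_ext)
  fix n show "fps_nth (Abs_fps (stable_sum \<beta> 1)) n = fps_nth (1 - fps_const (gauss_sum \<psi> \<beta>) * fps_X) n"
  proof (cases "n \<ge> 2")
    case False
    then have "n = 0 \<or> n = 1" by auto
    then show ?thesis using stable_sum_0[OF assms, of 1] stable_sum_1[OF assms] by (auto simp: fps_X_nth)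
  qed (simp add: stable_sum_vanishes[OF assms] del: One_nat_def)
qed

text \<open>A nonzero element a of the field with \<open>q\<^sup>r\<close> elements has m or no m-th roots there, according
  to whether its norm is an m-th power in the ground field.  The sum of the values at the norm of the m
  characters of order dividing m is the number of roots in both cases.\<close>

lemma walk_sum_eq:
  assumes al: "\<alpha> \<in> mult_chars" and m: "m dvd CARD('a) - 1" and r: "r \<ge> 1"
  shows "walk_sum (char_pow \<alpha> m) m r
    = (\<Sum>k<m. walk_sum (char_mult \<alpha> (char_pow (char_root \<phi> m) k)) 1 r)"
proof -
  let ?q = "CARD('a)" and ?P = "periodic_pts (frobenius :: 'a alg_closure \<Rightarrow> _) r"
  let ?nm = "\<lambda>a. of_ac (prod_mset (cyc frobenius r a)) :: 'a"
  have m0: "m > 0" using m card_field_ge_2[where 'a = 'a] by (auto intro!: Nat.gr0I)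
  have q0: "?q ^ r \<ge> 1" using card_field_ge_2[where 'a = 'a] by simp
  note finP = finite_periodic_pts_frobenius[OF r, where 'a = 'a]
  have P: "a \<in> ?P \<longleftrightarrow> a ^ (?q ^ r) = a" for a by (simp add: periodic_pts_def funpow_frobenius)
  have P1: "a \<in> ?P \<longleftrightarrow> a ^ (?q ^ r - 1) = 1" if "a \<noteq> 0" for a
  proof -
    have "a ^ (?q ^ r) = a * a ^ (?q ^ r - 1)" using q0 by (simp flip: power_Suc)
    then show ?thesis using that by (simp add: P)
  qed
  have nm: "to_ac (?nm a) = a ^ (\<Sum>i<r. ?q ^ i)" if "a \<in> ?P" for a
    using prod_mset_stable[OF cyc_in_stable_msets[OF that]]
    by (simp add: to_ac_of_ac prod_mset_cyc_frobenius)
  have roots: "card {b \<in> ?P. b ^ m = a} = (if ?nm a ^ ((?q - 1) div m) = 1 then m else 0)"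
    if a: "a \<in> ?P" "a \<noteq> 0" for a
  proof -
    let ?E = "(\<Sum>i<r. ?q ^ i) * ((?q - 1) div m)"
    have "b \<in> ?P \<longleftrightarrow> ?nm a ^ ((?q - 1) div m) = 1" if "b ^ m = a" for b
    proof -
      have b0: "b \<noteq> 0" using that a(2) m0 by (auto simp: power_0_left)
      have "b \<in> ?P \<longleftrightarrow> b ^ (m * ?E) = 1"
        unfolding mult_sum_powers_card[OF m] by (rule P1[OF b0])
      also have "b ^ (m * ?E) = to_ac (?nm a ^ ((?q - 1) div m))"
        by (simp add: power_mult that nm[OF a(1)])
      finally show ?thesis by (metis to_ac_1 to_ac_eq_iff)
    qed
    then have "{b \<in> ?P. b ^ m = a} = (if ?nm a ^ ((?q - 1) div m) = 1 then {b. b ^ m = a} else {})" by auto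
    moreover have "card {b. b ^ m = a} = m"
      using card_nth_roots_alg_closure[OF m a(2)] card_mu[OF m] by (metis bij_betw_same_card)
    ultimately show ?thesis by simp
  qed
  have weight: "root_weight (char_pow \<alpha> m) m (cyc frobenius r b) = root_weight \<alpha> 1 (cyc frobenius r (b ^ m))"
    if b: "b \<in> ?P" for b
  proof -
    have "char_pow \<alpha> m x = \<alpha> (x ^ m)" for x
      using m0 by (simp add: char_pow_def mult_char_power[OF al] mult_char_0[OF al] power_0_left)
    then show ?thesis
      using prod_mset_stable[OF cyc_in_stable_msets[OF b]]
      by (simp add: root_weight_def cyc_frobenius_power power_prod_mset[symmetric] of_ac_power)
  qed
  have zero: "root_weight \<beta> 1 (cyc frobenius r 0) = 0" if "\<beta> \<in> mult_chars" for \<beta>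
  proof -
    obtain r' where "r = Suc r'" using r by (cases r) auto
    then have "prod_mset (cyc frobenius r (0 :: 'a alg_closure)) = 0"
      by (simp only: cyc_Suc_image) simp
    then show ?thesis by (simp only: root_weight_def of_ac_0 mult_char_0[OF that] mult_zero_left)
  qed
  have pw: "(\<lambda>b. b ^ m) ` ?P \<subseteq> ?P"
    by (auto simp: P power_mult[symmetric] mult.commute[of m]) (simp add: power_mult)
  have "walk_sum (char_pow \<alpha> m) m r = (\<Sum>b\<in>?P. root_weight \<alpha> 1 (cyc frobenius r (b ^ m)))"
    unfolding walk_sum_def by (rule sum.cong[OF refl weight])
  also have "\<dots> = (\<Sum>a\<in>?P. \<Sum>b\<in>{b \<in> ?P. b ^ m = a}. root_weight \<alpha> 1 (cyc frobenius r (b ^ m)))"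
    by (rule sum.group[symmetric, OF finP finP pw])
  also have "\<dots> = (\<Sum>a\<in>?P. of_nat (card {b \<in> ?P. b ^ m = a}) * root_weight \<alpha> 1 (cyc frobenius r a))"
    by (rule sum.cong[OF refl]) simp
  also have "\<dots> = (\<Sum>a\<in>?P. \<Sum>k<m. root_weight (char_mult \<alpha> (char_pow (char_root \<phi> m) k)) 1 (cyc frobenius r a))"
  proof (rule sum.cong[OF refl])
    fix a assume a: "a \<in> ?P"
    show "of_nat (card {b \<in> ?P. b ^ m = a}) * root_weight \<alpha> 1 (cyc frobenius r a)
      = (\<Sum>k<m. root_weight (char_mult \<alpha> (char_pow (char_root \<phi> m) k)) 1 (cyc frobenius r a))"
    proof (cases "a = 0")
      case False
      have "to_ac (?nm a) \<noteq> 0" using nm[OF a] False by simp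
      then have n0: "?nm a \<noteq> 0" by simp
      have "of_nat (card {b \<in> ?P. b ^ m = a}) = (\<Sum>k<m. char_root \<phi> m (?nm a) ^ k)"
        by (simp add: roots[OF a False] sum_char_root_powers[OF m n0])
      then show ?thesis using n0
        by (simp add: root_weight_def char_mult_def char_pow_def sum_distrib_left sum_distrib_right mult_ac)
    qed (simp add: zero al del: One_nat_def)
  qed
  also have "\<dots> = (\<Sum>k<m. walk_sum (char_mult \<alpha> (char_pow (char_root \<phi> m) k)) 1 r)"
    unfolding walk_sum_def by (rule sum.swap)
  finally show ?thesis .
qed

text \<open>The L-function attached to \<open>\<alpha>\<^sup>m\<close> and the product of the L-functions attached to the characters
  \<open>\<alpha>\<phi>\<^sub>m\<^sup>k\<close> have the same logarithmic derivative, so they agree.  The latter are linear, and the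
  coefficient of degree m is compared.\<close>

lemma stable_sum_eq_prod_gauss_sums:
  assumes al: "\<alpha> \<in> mult_chars" and m: "m dvd CARD('a) - 1"
  shows "stable_sum (char_pow \<alpha> m) m m = (\<Prod>k<m. - gauss_sum \<psi> (char_mult \<alpha> (char_pow (char_root \<phi> m) k)))"
proof -
  let ?be = "\<lambda>k. char_mult \<alpha> (char_pow (char_root \<phi> m) k)"
  let ?S = "\<lambda>\<beta> m. Abs_fps (\<lambda>r. if r = 0 then 0 else walk_sum \<beta> m r)"
  have be: "?be k \<in> mult_chars" for k using al by simp
  have S: "?S (char_pow \<alpha> m) m = (\<Sum>k<m. ?S (?be k) 1)"
    by (rule fps_ext) (auto simp: fps_sum_nth walk_sum_eq[OF al m])
  have "Abs_fps (stable_sum (char_pow \<alpha> m) m) = (\<Prod>k<m. Abs_fps (stable_sum (?be k) 1))"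
  proof (rule fps_log_deriv_unique)
    show "fps_X * fps_deriv (Abs_fps (stable_sum (char_pow \<alpha> m) m))
        = ?S (char_pow \<alpha> m) m * Abs_fps (stable_sum (char_pow \<alpha> m) m)"
      using al by (intro log_deriv_stable_sum) simp
    show "fps_X * fps_deriv (\<Prod>k<m. Abs_fps (stable_sum (?be k) 1))
        = ?S (char_pow \<alpha> m) m * (\<Prod>k<m. Abs_fps (stable_sum (?be k) 1))"
      unfolding S by (rule fps_log_deriv_prod) (rule finite_lessThan, rule log_deriv_stable_sum[OF be])
    have "fps_nth (\<Prod>k\<in>I. Abs_fps (stable_sum (?be k) 1)) 0 = 1" for I
      by (induction I rule: infinite_finite_induct) (simp_all add: stable_sum_0 be)
    then show "fps_nth (Abs_fps (stable_sum (char_pow \<alpha> m) m)) 0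
        = fps_nth (\<Prod>k<m. Abs_fps (stable_sum (?be k) 1)) 0"
      using al by (simp add: stable_sum_0)
  qed simp
  also have "\<dots> = (\<Prod>k<m. 1 - fps_const (gauss_sum \<psi> (?be k)) * fps_X)"
    by (intro prod.cong refl stable_sum_fps be)
  finally have "stable_sum (char_pow \<alpha> m) m m
      = fps_nth (\<Prod>k<m. 1 - fps_const (gauss_sum \<psi> (?be k)) * fps_X) (card {..<m})"
    by (simp add: fps_eq_iff)
  then show ?thesis
    using conjunct1[OF fps_nth_prod_linear[OF finite_lessThan[of m], of "\<lambda>k. gauss_sum \<psi> (?be k)"]]
    by simp
qed

text \<open>The sum of the m-th powers of the roots of a monic polynomial of degree m is -m times its constant
  coefficient plus a function of the other coefficients.  So the sum over all such polynomials factors: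
  the constant coefficient contributes a Gauss sum of \<open>\<alpha>\<^sup>m\<close>, and the other coefficients contribute a sum
  B in which \<open>\<alpha>\<close> does not occur.\<close>

lemma stable_sum_eq_gauss_sum:
  assumes m: "m dvd CARD('a) - 1"
  obtains B where "\<And>\<alpha>. \<alpha> \<in> mult_chars \<Longrightarrow>
    stable_sum (char_pow \<alpha> m) m m = - (B * inverse (\<alpha> (of_nat m)) ^ m * gauss_sum \<psi> (char_pow \<alpha> m))"
proof -
  define Q where "Q = {g \<in> monic_polys m. coeff g 0 = (0::'a)}"
  define B where "B = (\<Sum>g\<in>Q. \<psi> (of_ac (\<Sum>a\<in>#roots_ac g. a ^ m)))"
  have m0: "m > 0" using m card_field_ge_2[where 'a = 'a] by (auto intro!: Nat.gr0I)
  have mnz: "of_nat m \<noteq> (0::'a)" by (rule of_nat_neq_0_if_dvd[OF m])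
  have add_const: "g + [:c:] \<in> monic_polys m" if "g \<in> monic_polys m" for g :: "'a poly" and c
  proof -
    have "degree [:c:] < degree g" using that m0 by (simp add: monic_polys_def)
    then show ?thesis using that m0 by (simp add: monic_polys_def degree_add_eq_left coeff_pCons split: nat.split)
  qed
  have pow_sum: "of_ac (\<Sum>a\<in>#roots_ac (g + [:c:]). a ^ m) = of_ac (\<Sum>a\<in>#roots_ac g. a ^ m) + - of_nat m * c"
    if g: "g \<in> Q" for g c
  proof -
    have gm: "g \<in> monic_polys m" and g0: "coeff g 0 = 0" using g by (simp_all add: Q_def)
    note h = add_const[OF gm, of c]
    have st: "roots_ac f \<in> stable_msets frobenius m" if "f \<in> monic_polys m" for f :: "'a poly"
      using that bij_betw_roots_ac[of m, where 'a = 'a] by (auto simp: bij_betw_def)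
    have "(\<Sum>a\<in>#roots_ac (g + [:c:]). a ^ m) + of_nat m * to_ac c = (\<Sum>a\<in>#roots_ac g. a ^ m)"
      using power_sum_constant_coeff[of "roots_ac (g + [:c:])" m "roots_ac g"] m0 g0
      by (simp add: size_roots_ac[OF gm] size_roots_ac[OF h] lin_prod_roots_ac[OF gm]
          lin_prod_roots_ac[OF h] coeff_map_poly coeff_pCons split: nat.splits)
    then have "to_ac (of_ac (\<Sum>a\<in>#roots_ac (g + [:c:]). a ^ m) + of_nat m * c)
        = to_ac (of_ac (\<Sum>a\<in>#roots_ac g. a ^ m))"
      by (simp add: to_ac_of_ac power_sum_stable[OF st[OF gm]] power_sum_stable[OF st[OF h]])
    then have "of_ac (\<Sum>a\<in>#roots_ac (g + [:c:]). a ^ m) + of_nat m * c = of_ac (\<Sum>a\<in>#roots_ac g. a ^ m)"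
      by (simp only: to_ac_eq_iff)
    then show ?thesis by (simp add: eq_diff_eq)
  qed
  have "stable_sum (char_pow \<alpha> m) m m = - (B * inverse (\<alpha> (of_nat m)) ^ m * gauss_sum \<psi> (char_pow \<alpha> m))"
    if al: "\<alpha> \<in> mult_chars" for \<alpha>
  proof -
    let ?be = "char_pow \<alpha> m"
    have be: "?be \<in> mult_chars" using al by simp
    have "stable_sum ?be m m = (\<Sum>(g, c)\<in>Q \<times> UNIV. root_weight ?be m (roots_ac (g + [:c:])))"
      unfolding stable_sum_eq_sum_monic
      by (rule sum.reindex_bij_witness[of _ "\<lambda>(g, c). g + [:c:]" "\<lambda>f. (f + [:- coeff f 0:], coeff f 0)"])
         (auto simp: Q_def add_const add.assoc)
    also have "\<dots> = (\<Sum>(g, c)\<in>Q \<times> UNIV. \<psi> (of_ac (\<Sum>a\<in>#roots_ac g. a ^ m))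
        * (?be ((-1) ^ m) * (?be c * \<psi> (- of_nat m * c))))"
    proof (rule sum.cong[OF refl], clarify)
      fix g c assume g: "g \<in> Q"
      then have gm: "g \<in> monic_polys m" and g0: "coeff g 0 = 0" by (simp_all add: Q_def)
      show "root_weight ?be m (roots_ac (g + [:c:])) = \<psi> (of_ac (\<Sum>a\<in>#roots_ac g. a ^ m))
        * (?be ((-1) ^ m) * (?be c * \<psi> (- of_nat m * c)))"
        unfolding root_weight_def of_ac_prod_roots[OF add_const[OF gm]] pow_sum[OF g] psi_add
        by (simp add: g0 mult_char_mult[OF be] mult_ac)
    qed
    also have "\<dots> = B * (?be ((-1) ^ m) * (\<Sum>c\<in>UNIV. ?be c * \<psi> (- of_nat m * c)))"
      by (simp only: B_def sum_distrib_left[of "?be ((-1) ^ m)"] sum_product sum.cartesian_product)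
    also have "(\<Sum>c\<in>UNIV. ?be c * \<psi> (- of_nat m * c)) = (\<Sum>c\<in>UNIV - {0}. ?be c * \<psi> (- of_nat m * c))"
      by (rule sum.mono_neutral_right) (auto simp: mult_char_0[OF be])
    also have "\<dots> = - (inverse (?be (- of_nat m)) * gauss_sum \<psi> ?be)"
      using mnz by (intro gauss_sum_scaled be) simp
    also have "?be (- of_nat m) = \<alpha> (-1) ^ m * \<alpha> (of_nat m) ^ m"
      using mnz mult_char_mult[OF al, of "-1" "of_nat m"]
      by (simp add: char_pow_def power_mult_distrib)
    also have "?be ((-1) ^ m) = \<alpha> (-1) ^ m"
    proof -
      have "\<alpha> (-1) * \<alpha> (-1) = 1" by (simp add: mult_char_1[OF al] flip: mult_char_mult[OF al])
      then have pm: "\<alpha> (-1) = 1 \<or> \<alpha> (-1) = -1" using square_eq_1_iff by blast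
      have "?be ((-1) ^ m) = (\<alpha> (-1) ^ m) ^ m" by (simp add: char_pow_def mult_char_power[OF al])
      also have "\<dots> = \<alpha> (-1) ^ m" using pm by (cases "even m") auto
      finally show ?thesis .
    qed
    finally show ?thesis
      using mult_char_nonzero[OF al, of "-1"]
      by (simp add: power_inverse[symmetric] inverse_mult_distrib field_simps)
  qed
  then show ?thesis by (rule that)
qed

text \<open>The two evaluations of the same coefficient give the formula up to the constant B, which the case
  of the trivial character determines.\<close>

theorem hasse_davenport_product:
  assumes al: "\<alpha> \<in> mult_chars" and m: "m dvd CARD('a) - 1"
  shows "(\<Prod>k<m. gauss_sum \<psi> (char_mult \<alpha> (char_pow (char_root \<phi> m) k)))
    = inverse (\<alpha> (of_nat m)) ^ m * gauss_sum \<psi> (char_pow \<alpha> m)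
      * (\<Prod>k<m. gauss_sum \<psi> (char_pow (char_root \<phi> m) k))"
proof -
  obtain B where B: "\<And>\<alpha>. \<alpha> \<in> mult_chars \<Longrightarrow>
    stable_sum (char_pow \<alpha> m) m m = - (B * inverse (\<alpha> (of_nat m)) ^ m * gauss_sum \<psi> (char_pow \<alpha> m))"
    using stable_sum_eq_gauss_sum[OF m] by blast
  have mnz: "of_nat m \<noteq> (0::'a)" by (rule of_nat_neq_0_if_dvd[OF m])
  have neg: "(\<Prod>k<m. - gauss_sum \<psi> (char_mult \<beta> (char_pow (char_root \<phi> m) k)))
      = (-1) ^ m * (\<Prod>k<m. gauss_sum \<psi> (char_mult \<beta> (char_pow (char_root \<phi> m) k)))" for \<beta>
    by (simp add: prod_uminus)
  let ?D = "\<Prod>k<m. gauss_sum \<psi> (char_pow (char_root \<phi> m) k)"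
  let ?X = "inverse (\<alpha> (of_nat m)) ^ m * gauss_sum \<psi> (char_pow \<alpha> m)"
  have D: "(-1) ^ m * ?D = - B"
    using stable_sum_eq_prod_gauss_sums[OF triv_char_in_mult_chars m] B[OF triv_char_in_mult_chars] mnz
    by (simp add: prod_uminus gauss_sum_triv triv_char_def)
  have "(-1) ^ m * (\<Prod>k<m. gauss_sum \<psi> (char_mult \<alpha> (char_pow (char_root \<phi> m) k))) = - B * ?X"
    using stable_sum_eq_prod_gauss_sums[OF al m] B[OF al] by (simp add: neg mult.assoc)
  also have "\<dots> = (-1) ^ m * (?X * ?D)" unfolding D[symmetric] by (simp only: mult_ac)
  finally show ?thesis by simp
qed

end


section \<open>Jacobi sums\<close>

definition level_sum :: "nat \<Rightarrow> (nat \<Rightarrow> 'a::{field,finite} \<Rightarrow> qbar) \<Rightarrow> 'a \<Rightarrow> qbar" where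
  "level_sum n \<eta> s =
     (\<Sum>x \<in> {x \<in> {1..n} \<rightarrow>\<^sub>E UNIV - {0}. (\<Sum>i=1..n. x i) = s}. \<Prod>i=1..n. \<eta> i (x i))"

lemma finite_PiE_finite_type [simp]:
  fixes B :: "'i \<Rightarrow> 'a::finite set"
  shows "finite A \<Longrightarrow> finite (PiE A B)"
  by (simp add: finite_PiE)

lemma jacobi_sum_eq_level_sum: "jacobi_sum n \<eta> = (-1) ^ (n - 1) * level_sum n \<eta> 1"
  by (simp add: jacobi_sum_def level_sum_def)

lemma bij_betw_scale:
  fixes s :: "'a::{field,finite}"
  assumes "s \<noteq> 0"
  shows "bij_betw (\<lambda>x. \<lambda>i\<in>{1..n}. s * x i)
    {x \<in> {1..n} \<rightarrow>\<^sub>E UNIV - {0}. (\<Sum>i=1..n. x i) = 1}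
    {x \<in> {1..n} \<rightarrow>\<^sub>E UNIV - {0}. (\<Sum>i=1..n. x i) = s}"
proof (rule bij_betw_byWitness[of _ "\<lambda>x. \<lambda>i\<in>{1..n}. x i / s"])
  show "\<forall>x\<in>{x \<in> {1..n} \<rightarrow>\<^sub>E UNIV - {0}. (\<Sum>i=1..n. x i) = 1}.
      (\<lambda>i\<in>{1..n}. (\<lambda>i\<in>{1..n}. s * x i) i / s) = x"
    using assms by (auto simp: fun_eq_iff PiE_def extensional_def)
  show "\<forall>x\<in>{x \<in> {1..n} \<rightarrow>\<^sub>E UNIV - {0}. (\<Sum>i=1..n. x i) = s}.
      (\<lambda>i\<in>{1..n}. s * (\<lambda>i\<in>{1..n}. x i / s) i) = x"
    using assms by (auto simp: fun_eq_iff PiE_def extensional_def)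
  show "(\<lambda>x. \<lambda>i\<in>{1..n}. s * x i) ` {x \<in> {1..n} \<rightarrow>\<^sub>E UNIV - {0}. (\<Sum>i=1..n. x i) = 1}
      \<subseteq> {x \<in> {1..n} \<rightarrow>\<^sub>E UNIV - {0}. (\<Sum>i=1..n. x i) = s}"
    using assms by (auto simp: PiE_def Pi_def sum_distrib_left[symmetric])
  show "(\<lambda>x. \<lambda>i\<in>{1..n}. x i / s) ` {x \<in> {1..n} \<rightarrow>\<^sub>E UNIV - {0}. (\<Sum>i=1..n. x i) = s}
      \<subseteq> {x \<in> {1..n} \<rightarrow>\<^sub>E UNIV - {0}. (\<Sum>i=1..n. x i) = 1}"
    using assms by (auto simp: PiE_def Pi_def sum_divide_distrib[symmetric])
qed

lemma level_sum_scale: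
  fixes s :: "'a::{field,finite}"
  assumes "\<And>i. i \<in> {1..n} \<Longrightarrow> \<eta> i \<in> mult_chars" "s \<noteq> 0"
  shows "level_sum n \<eta> s = (\<Prod>i=1..n. \<eta> i s) * level_sum n \<eta> 1"
proof -
  have "level_sum n \<eta> s
      = (\<Sum>x \<in> {x \<in> {1..n} \<rightarrow>\<^sub>E UNIV - {0}. (\<Sum>i=1..n. x i) = 1}. \<Prod>i=1..n. \<eta> i ((\<lambda>i\<in>{1..n}. s * x i) i))"
    unfolding level_sum_def by (rule sum.reindex_bij_betw[OF bij_betw_scale[OF assms(2)], symmetric])
  also have "\<dots> = (\<Prod>i=1..n. \<eta> i s) * level_sum n \<eta> 1"
    unfolding level_sum_def sum_distrib_left prod.distrib[symmetric]
    by (intro sum.cong refl prod.cong) (simp add: mult_char_mult[OF assms(1)])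
  finally show ?thesis .
qed

lemma sum_level_sum:
  fixes f :: "'a::{field,finite} \<Rightarrow> qbar"
  shows "(\<Sum>s\<in>UNIV. level_sum n \<eta> s * f s)
    = (\<Sum>x\<in>{1..n} \<rightarrow>\<^sub>E UNIV - {0}. (\<Prod>i=1..n. \<eta> i (x i)) * f (\<Sum>i=1..n. x i))"
proof -
  have "(\<Sum>x\<in>{1..n} \<rightarrow>\<^sub>E UNIV - {0}. (\<Prod>i=1..n. \<eta> i (x i)) * f (\<Sum>i=1..n. x i))
      = (\<Sum>s\<in>UNIV. \<Sum>x\<in>{x \<in> {1..n} \<rightarrow>\<^sub>E UNIV - {0}. (\<Sum>i=1..n. x i) = s}.
          (\<Prod>i=1..n. \<eta> i (x i)) * f (\<Sum>i=1..n. x i))"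
    by (rule sum.group[symmetric]) auto
  also have "\<dots> = (\<Sum>s\<in>UNIV. level_sum n \<eta> s * f s)"
    unfolding level_sum_def sum_distrib_right by (intro sum.cong refl) auto
  finally show ?thesis ..
qed

lemma prod_chars_in_mult_chars:
  fixes \<eta> :: "nat \<Rightarrow> 'a::{field,finite} \<Rightarrow> qbar"
  assumes "n \<ge> 1" "\<And>i. i \<in> {1..n} \<Longrightarrow> \<eta> i \<in> mult_chars"
  shows "(\<lambda>x. \<Prod>i=1..n. \<eta> i x) \<in> mult_chars"
  unfolding mult_chars_def
proof (intro CollectI conjI allI impI)
  have "\<eta> 1 0 = 0" using assms by (intro mult_char_0) auto
  then show "(\<Prod>i=1..n. \<eta> i 0) = 0" using assms(1) by (intro prod_zero) auto
  show "(\<Prod>i=1..n. \<eta> i x) \<noteq> 0" if "x \<noteq> 0" for x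
    using mult_char_nonzero[OF assms(2) that] by (simp add: prod_zero_iff)
  show "(\<Prod>i=1..n. \<eta> i (x * y)) = (\<Prod>i=1..n. \<eta> i x) * (\<Prod>i=1..n. \<eta> i y)" for x y
    unfolding prod.distrib[symmetric] by (intro prod.cong refl mult_char_mult assms(2))
qed

lemma sum_level_sums:
  fixes \<eta> :: "nat \<Rightarrow> 'a::{field,finite} \<Rightarrow> qbar"
  assumes "\<And>i. i \<in> {1..n} \<Longrightarrow> \<eta> i \<in> mult_chars"
  shows "(\<Sum>s\<in>UNIV. level_sum n \<eta> s)
    = (if \<forall>i\<in>{1..n}. \<eta> i = triv_char then (of_nat CARD('a) - 1) ^ n else 0)"
proof -
  have "(\<Sum>s\<in>UNIV. level_sum n \<eta> s) = (\<Sum>x\<in>{1..n} \<rightarrow>\<^sub>E UNIV - {0}. \<Prod>i=1..n. \<eta> i (x i))"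
    using sum_level_sum[of n \<eta> "\<lambda>_. 1"] by simp
  also have "\<dots> = (\<Prod>i=1..n. \<Sum>x\<in>UNIV - {0}. \<eta> i x)" by (rule prod_sum_PiE[symmetric]) auto
  also have "\<dots> = (\<Prod>i=1..n. if \<eta> i = triv_char then of_nat CARD('a) - 1 else 0)"
  proof (rule prod.cong[OF refl])
    fix i assume i: "i \<in> {1..n}"
    have "(of_nat (CARD('a) - 1) :: qbar) = of_nat CARD('a) - 1"
      using card_field_ge_2[where 'a = 'a] by (simp add: of_nat_diff)
    then show "(\<Sum>x\<in>UNIV - {0}. \<eta> i x) = (if \<eta> i = triv_char then of_nat CARD('a) - 1 else 0)"
      using sum_mult_char[OF assms[OF i]] by simp
  qed
  also have "\<dots> = (if \<forall>i\<in>{1..n}. \<eta> i = triv_char then (of_nat CARD('a) - 1) ^ n else 0)"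
  proof (cases "\<forall>i\<in>{1..n}. \<eta> i = triv_char")
    case False
    then obtain i where "i \<in> {1..n}" "\<eta> i \<noteq> triv_char" by blast
    then have "(\<Prod>i=1..n. if \<eta> i = triv_char then of_nat CARD('a) - 1 else 0 :: qbar) = 0"
      by (intro prod_zero bexI[of _ i]) simp_all
    then show ?thesis unfolding if_not_P[OF False] .
  qed simp
  finally show ?thesis .
qed

lemma sum_UNIV_split:
  fixes f :: "'a::{field,finite} \<Rightarrow> qbar"
  shows "(\<Sum>s\<in>UNIV. f s) = f 0 + (\<Sum>s\<in>UNIV - {0}. f s)"
  by (rule sum.remove) auto

lemma level_sum_0:
  fixes \<eta> :: "nat \<Rightarrow> 'a::{field,finite} \<Rightarrow> qbar"
  assumes n: "n \<ge> 1" and \<eta>: "\<And>i. i \<in> {1..n} \<Longrightarrow> \<eta> i \<in> mult_chars"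
    and P: "(\<lambda>x. \<Prod>i=1..n. \<eta> i x) = triv_char"
  shows "level_sum n \<eta> 0 = (if \<forall>i\<in>{1..n}. \<eta> i = triv_char then (of_nat CARD('a) - 1) ^ n else 0)
    - (of_nat CARD('a) - 1) * level_sum n \<eta> 1"
proof -
  have scale: "level_sum n \<eta> s = level_sum n \<eta> 1" if "s \<noteq> 0" for s
  proof -
    have "(\<Prod>i=1..n. \<eta> i s) = 1" using fun_cong[OF P, of s] that by (simp only: triv_char_def if_False)
    then show ?thesis by (simp only: level_sum_scale[OF \<eta> that] mult_1)
  qed
  have "(\<Sum>s\<in>UNIV - {0}. level_sum n \<eta> s) = (\<Sum>s\<in>UNIV - {0::'a}. level_sum n \<eta> 1)"
    by (intro sum.cong refl scale) simp
  also have "\<dots> = (of_nat CARD('a) - 1) * level_sum n \<eta> 1"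
    using card_field_ge_2[where 'a = 'a] by (simp add: card_Diff_singleton of_nat_diff)
  finally have "(\<Sum>s\<in>UNIV - {0::'a}. level_sum n \<eta> s) = (of_nat CARD('a) - 1) * level_sum n \<eta> 1" .
  then show ?thesis
    using sum_UNIV_split[of "level_sum n \<eta>"] by (simp only: sum_level_sums[OF \<eta>]) simp
qed

lemma gauss_sum0_triv: "gauss_sum0 \<psi> triv_char = of_nat CARD('a) * gauss_sum \<psi> (triv_char :: 'a::{field,finite} \<Rightarrow> qbar)"
  by (simp add: gauss_sum0_def)

lemma gauss_sum0_nontriv: "\<eta> \<noteq> triv_char \<Longrightarrow> gauss_sum0 \<psi> \<eta> = gauss_sum \<psi> \<eta>"
  by (simp add: gauss_sum0_def)

context char_setup
begin

text \<open>Expand the product of the Gauss sums according to the value s of \<open>x\<^sub>1 + \<dots> + x\<^sub>n\<close>.  The part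
  with \<open>s \<noteq> 0\<close> is a Jacobi sum times a Gauss sum by homogeneity; the part with \<open>s = 0\<close> is determined by
  the total sum over all x.\<close>

lemma jacobi_sum_eq_gauss_sums:
  assumes n: "n \<ge> 1" and \<eta>: "\<And>i. i \<in> {1..n} \<Longrightarrow> \<eta> i \<in> mult_chars"
  shows "jacobi_sum n \<eta> = (\<Prod>i=1..n. gauss_sum \<psi> (\<eta> i)) / gauss_sum0 \<psi> (\<lambda>x. \<Prod>i=1..n. \<eta> i x)
    - (if \<forall>i\<in>{1..n}. \<eta> i = triv_char then (1 - of_nat CARD('a)) ^ n / of_nat CARD('a) else 0)"
proof -
  let ?P = "\<lambda>x. \<Prod>i=1..n. \<eta> i x"
  let ?q = "of_nat CARD('a) :: qbar"
  let ?T = "if \<forall>i\<in>{1..n}. \<eta> i = triv_char then (?q - 1) ^ n else 0"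
  have q0: "?q \<noteq> 0" using card_field_ge_2[where 'a = 'a] by simp
  have P: "?P \<in> mult_chars" by (rule prod_chars_in_mult_chars[OF n \<eta>])
  obtain n' where n': "n = Suc n'" using n by (cases n) auto
  have "(\<Prod>i=1..n. - gauss_sum \<psi> (\<eta> i)) = (\<Prod>i=1..n. \<Sum>x\<in>UNIV - {0}. \<eta> i x * \<psi> x)"
    by (simp add: gauss_sum_def)
  also have "\<dots> = (\<Sum>x\<in>{1..n} \<rightarrow>\<^sub>E UNIV - {0}. \<Prod>i=1..n. \<eta> i (x i) * \<psi> (x i))"
    by (rule prod_sum_PiE) auto
  also have "\<dots> = (\<Sum>s\<in>UNIV. level_sum n \<eta> s * \<psi> s)"
    unfolding sum_level_sum by (simp add: prod.distrib psi_sum)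
  also have "\<dots> = level_sum n \<eta> 0 + (\<Sum>s\<in>UNIV - {0}. level_sum n \<eta> s * \<psi> s)"
    by (subst sum_UNIV_split) (simp add: psi_0)
  also have "(\<Sum>s\<in>UNIV - {0}. level_sum n \<eta> s * \<psi> s) = level_sum n \<eta> 1 * (\<Sum>s\<in>UNIV - {0}. ?P s * \<psi> s)"
    unfolding sum_distrib_left
  proof (rule sum.cong[OF refl])
    fix s :: 'a assume "s \<in> UNIV - {0}"
    then have "level_sum n \<eta> s = ?P s * level_sum n \<eta> 1" by (intro level_sum_scale \<eta>) auto
    then show "level_sum n \<eta> s * \<psi> s = level_sum n \<eta> 1 * (?P s * \<psi> s)" by (simp only: mult_ac)
  qed
  also have "(\<Sum>s\<in>UNIV - {0}. ?P s * \<psi> s) = - gauss_sum \<psi> ?P" by (simp add: gauss_sum_def)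
  finally have main: "(-1) ^ n * (\<Prod>i=1..n. gauss_sum \<psi> (\<eta> i))
      = level_sum n \<eta> 0 - level_sum n \<eta> 1 * gauss_sum \<psi> ?P"
    by (simp add: prod_uminus)
  have sq: "(-1) ^ n' * ((-1) ^ n' * z) = z" for z :: qbar by (simp flip: mult.assoc power_mult_distrib)
  show ?thesis
  proof (cases "?P = triv_char")
    case True
    have "(-1) ^ n * (\<Prod>i=1..n. gauss_sum \<psi> (\<eta> i)) = ?T - ?q * level_sum n \<eta> 1"
    proof -
      have "gauss_sum \<psi> ?P = 1" by (simp only: True gauss_sum_triv)
      moreover have "level_sum n \<eta> 0 = ?T - (?q - 1) * level_sum n \<eta> 1" by (rule level_sum_0[OF n \<eta> True])
      ultimately have "(-1) ^ n * (\<Prod>i=1..n. gauss_sum \<psi> (\<eta> i))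
          = ?T - (?q - 1) * level_sum n \<eta> 1 - level_sum n \<eta> 1 * 1"
        by (simp only: main)
      also have "\<dots> = ?T - ?q * level_sum n \<eta> 1" by (simp only: left_diff_distrib) simp
      finally show ?thesis .
    qed
    then have "(-1) ^ n' * (\<Prod>i=1..n. gauss_sum \<psi> (\<eta> i)) = ?q * level_sum n \<eta> 1 - ?T"
      by (simp add: n' algebra_simps)
    then have "(-1) ^ n' * ((-1) ^ n' * (\<Prod>i=1..n. gauss_sum \<psi> (\<eta> i)))
        = ?q * ((-1) ^ n' * level_sum n \<eta> 1) - (-1) ^ n' * ?T"
      by (simp only: right_diff_distrib mult.left_commute)
    then have e: "(\<Prod>i=1..n. gauss_sum \<psi> (\<eta> i)) = ?q * jacobi_sum n \<eta> - (-1) ^ n' * ?T"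
      unfolding sq jacobi_sum_eq_level_sum by (simp add: n')
    have "(-1) ^ n' * (?q - 1) ^ n = - ((1 - ?q) ^ n)"
    proof -
      have "(1 - ?q) ^ n = ((-1) * (?q - 1)) ^ n" by simp
      then show ?thesis unfolding power_mult_distrib by (simp add: n')
    qed
    moreover define U where "U = (if \<forall>i\<in>{1..n}. \<eta> i = triv_char then (1 - ?q) ^ n else 0)"
    moreover have "(-1) ^ n' * ?T = (if \<forall>i\<in>{1..n}. \<eta> i = triv_char then (-1) ^ n' * (?q - 1) ^ n else 0)"
      by (simp only: if_distrib[of "(*) _"] mult_zero_right)
    ultimately have "(-1) ^ n' * ?T = - U" by (simp only: if_distrib[of uminus] minus_zero)
    then have g: "(\<Prod>i=1..n. gauss_sum \<psi> (\<eta> i)) = ?q * jacobi_sum n \<eta> + U"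
      using e by (simp only: diff_minus_eq_add)
    have "gauss_sum0 \<psi> ?P = ?q" by (simp only: True gauss_sum0_triv gauss_sum_triv mult_1_right)
    moreover have "(if \<forall>i\<in>{1..n}. \<eta> i = triv_char then (1 - ?q) ^ n / ?q else 0) = U / ?q"
      by (simp only: U_def if_distrib[of "\<lambda>x. x / _"] div_0)
    moreover have "jacobi_sum n \<eta> = (?q * jacobi_sum n \<eta> + U) / ?q - U / ?q"
      using q0 by (simp add: add_divide_distrib)
    ultimately show ?thesis by (simp only: g)
  next
    case False
    have nt: "\<not> (\<forall>i\<in>{1..n}. \<eta> i = triv_char)"
    proof
      assume "\<forall>i\<in>{1..n}. \<eta> i = triv_char"
      then have "?P = triv_char" using n by (auto simp: fun_eq_iff triv_char_def)
      then show False using False by contradiction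
    qed
    have "(\<Sum>s\<in>UNIV - {0}. level_sum n \<eta> s) = (\<Sum>s\<in>UNIV - {0}. ?P s) * level_sum n \<eta> 1"
      unfolding sum_distrib_right by (intro sum.cong refl level_sum_scale \<eta>) auto
    then have "level_sum n \<eta> 0 = 0"
      using sum_UNIV_split[of "level_sum n \<eta>"] sum_level_sums[of n \<eta>, OF \<eta>] nt sum_mult_char[OF P] False
      by auto
    then have "(-1) ^ n' * (\<Prod>i=1..n. gauss_sum \<psi> (\<eta> i)) = level_sum n \<eta> 1 * gauss_sum \<psi> ?P"
      using main by (simp add: n')
    then have "(-1) ^ n' * ((-1) ^ n' * (\<Prod>i=1..n. gauss_sum \<psi> (\<eta> i))) = (-1) ^ n' * level_sum n \<eta> 1 * gauss_sum \<psi> ?P"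
      by (simp only: mult.assoc)
    then have "(\<Prod>i=1..n. gauss_sum \<psi> (\<eta> i)) = jacobi_sum n \<eta> * gauss_sum \<psi> ?P"
      unfolding sq jacobi_sum_eq_level_sum by (simp add: n')
    then show ?thesis
      unfolding if_not_P[OF nt] gauss_sum0_nontriv[OF False] using gauss_sum_nonzero[OF P] by simp
  qed
qed

end


section \<open>The hypergeometric function as a sum of products of Gauss sums\<close>

locale diag_setup = char_setup +
  fixes d n :: nat and h :: "nat \<Rightarrow> nat" and lam :: 'a
  assumes d_ge: "d \<ge> 2" and n_ge: "n \<ge> 2" and h_ge: "\<And>i. i \<in> {1..n} \<Longrightarrow> h i \<ge> 1"
    and h_sum: "(\<Sum>i=1..n. h i) = d" and h_gcd: "Gcd (insert d (h ` {1..n})) = 1"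
    and h_dvd: "\<And>i. i \<in> {1..n} \<Longrightarrow> d * h i dvd CARD('a) - 1" and lam_nz: "lam \<noteq> 0"
begin

lemma d_dvd: "d dvd CARD('a) - 1"
  by (rule dvd_mult_left[OF h_dvd[of 1]]) (use n_ge in simp)

lemma hi_dvd: "i \<in> {1..n} \<Longrightarrow> h i dvd CARD('a) - 1"
  by (rule dvd_mult_right[OF h_dvd])

lemma d_nz: "of_nat d \<noteq> (0::'a)" by (rule of_nat_neq_0_if_dvd[OF d_dvd])

lemma h_nz: "i \<in> {1..n} \<Longrightarrow> of_nat (h i) \<noteq> (0::'a)" by (rule of_nat_neq_0_if_dvd[OF hi_dvd])

lemma d_dvd_if_dvd_mult_h:
  assumes "\<And>i. i \<in> {1..n} \<Longrightarrow> d dvd t * h i"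
  shows "d dvd t"
proof -
  have "d dvd Gcd ((*) t ` insert d (h ` {1..n}))" using assms by (intro Gcd_greatest) auto
  then show ?thesis unfolding Gcd_mult h_gcd by simp
qed

abbreviation chi_d :: "'a \<Rightarrow> qbar" where "chi_d \<equiv> char_root \<phi> d"

lemma char_pow_chi_d_eq_triv_iff: "char_pow chi_d k = triv_char \<longleftrightarrow> d dvd k"
proof -
  obtain e where e: "CARD('a) - 1 = d * e" using d_dvd by blast
  have d0: "d > 0" using d_ge by simp
  have "e > 0" using e card_field_ge_2[where 'a = 'a] by (intro Nat.gr0I) auto
  then show ?thesis
    unfolding char_root_def char_pow_char_pow char_pow_phi_eq_triv_iff e using d0
    by (simp add: mult.commute[of d])
qed

lemma char_pow_chi_d_mod: "char_pow chi_d (k mod d) = char_pow chi_d k"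
proof -
  have "char_pow chi_d k = char_mult (char_pow (char_pow chi_d d) (k div d)) (char_pow chi_d (k mod d))"
    by (simp add: char_pow_char_pow char_mult_char_pow)
  moreover have "char_pow chi_d d = triv_char" by (simp add: char_pow_chi_d_eq_triv_iff)
  ultimately show ?thesis by simp
qed

lemma char_pow_d_eq_triv_iff:
  assumes "\<nu> \<in> mult_chars"
  shows "char_pow \<nu> d = triv_char \<longleftrightarrow> (\<exists>t<d. \<nu> = char_pow chi_d t)"
proof
  assume \<nu>: "char_pow \<nu> d = triv_char"
  obtain e where e: "\<nu> = char_pow \<phi> e" using assms phi by (auto simp: char_generator_def)
  obtain f where f: "CARD('a) - 1 = d * f" using d_dvd by blast
  have d0: "d > 0" using d_ge by simp
  have "d * f dvd e * d" using \<nu> unfolding e char_pow_char_pow char_pow_phi_eq_triv_iff f .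
  then have "f dvd e" using d0 by (simp add: mult.commute[of d])
  then obtain t where "e = f * t" by blast
  then have "\<nu> = char_pow chi_d t" using f d0 by (simp add: e char_root_def char_pow_char_pow)
  then have "\<nu> = char_pow chi_d (t mod d)" by (simp add: char_pow_chi_d_mod)
  then show "\<exists>t<d. \<nu> = char_pow chi_d t" using mod_less_divisor[OF d0, of t] by blast
next
  assume "\<exists>t<d. \<nu> = char_pow chi_d t"
  then show "char_pow \<nu> d = triv_char" by (auto simp: char_pow_char_pow char_pow_chi_d_eq_triv_iff)
qed

text \<open>The characters \<open>\<phi>\<^sub>d\<^sub>h\<^sup>a\<^sup>+\<^sup>d\<^sup>k\<close> for \<open>k < h\<close> are the products of one of them with the characters of order
  dividing h, so the product formula for Gauss sums applies to numerator and denominator.\<close>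

lemma poch_product:
  assumes i: "i \<in> {1..n}" and \<nu>: "\<nu> \<in> mult_chars"
  shows "(\<Prod>k<h i. poch \<psi> (char_pow (char_root \<phi> (d * h i)) (a + d * k)) \<nu>)
    = inverse (\<nu> (of_nat (h i))) ^ h i
      * (gauss_sum \<psi> (char_mult (char_pow chi_d a) (char_pow \<nu> (h i))) / gauss_sum \<psi> (char_pow chi_d a))"
proof -
  let ?h = "h i" and ?N = "CARD('a) - 1"
  let ?A = "char_pow (char_root \<phi> (d * ?h)) a" and ?x = "char_root \<phi> ?h"
  have h0: "?h > 0" using h_ge[OF i] by simp
  obtain e where e: "?N = d * ?h * e" using h_dvd[OF i] by blast
  have d0: "d > 0" using d_ge by simp
  have Nd: "?N div (d * ?h) = e" "?N div ?h = d * e" "?N div d = ?h * e"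
    using d0 h0 unfolding e by (simp_all add: mult.assoc mult.left_commute[of d])
  have ch: "char_pow (char_root \<phi> (d * ?h)) (a + d * k) = char_mult ?A (char_pow ?x k)" for k
    by (simp only: char_root_def Nd char_pow_char_pow char_mult_char_pow distrib_left mult_ac)
  have comm: "char_mult (char_mult ?A (char_pow ?x k)) \<nu> = char_mult (char_mult ?A \<nu>) (char_pow ?x k)" for k
    by (simp add: char_mult_def fun_eq_iff mult_ac)
  have A: "?A \<in> mult_chars" and An: "char_mult ?A \<nu> \<in> mult_chars" using \<nu> by simp_all
  have Ah: "char_pow ?A ?h = char_pow chi_d a"
    by (simp only: char_root_def Nd char_pow_char_pow mult_ac)
  have Anh: "char_pow (char_mult ?A \<nu>) ?h = char_mult (char_pow chi_d a) (char_pow \<nu> ?h)"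
    unfolding Ah[symmetric] by (auto simp: char_mult_def char_pow_def power_mult_distrib)
  let ?D = "\<Prod>k<?h. gauss_sum \<psi> (char_pow ?x k)"
  have D: "?D \<noteq> 0" by (simp add: gauss_sum_nonzero)
  have "?A (of_nat ?h) \<noteq> 0" using mult_char_nonzero[OF A h_nz[OF i]] .
  moreover have "gauss_sum \<psi> (char_pow chi_d a) \<noteq> 0" by (simp add: gauss_sum_nonzero)
  moreover have "\<nu> (of_nat ?h) \<noteq> 0" using mult_char_nonzero[OF \<nu> h_nz[OF i]] .
  moreover have "(\<Prod>k<?h. poch \<psi> (char_pow (char_root \<phi> (d * ?h)) (a + d * k)) \<nu>)
      = (inverse (?A (of_nat ?h) * \<nu> (of_nat ?h)) ^ ?h
        * gauss_sum \<psi> (char_mult (char_pow chi_d a) (char_pow \<nu> ?h)) * ?D)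
      / (inverse (?A (of_nat ?h)) ^ ?h * gauss_sum \<psi> (char_pow chi_d a) * ?D)"
    unfolding poch_def ch comm prod_dividef hasse_davenport_product[OF A hi_dvd[OF i]]
      hasse_davenport_product[OF An hi_dvd[OF i]] Ah Anh by (simp add: char_mult_def)
  ultimately show ?thesis using D by (simp add: power_mult_distrib field_simps)
qed

text \<open>The modified Gauss sums bring in a power of q.  If \<open>\<nu>\<^sup>d\<close> is trivial, exactly one of the characters
  \<open>\<phi>\<^sub>d\<^sup>k\<nu>\<close> is trivial, and otherwise none; so the exponent is the one that turns \<open>g(\<nu>\<^sup>d)\<close> into
  \<open>g\<degree>(\<nu>\<^sup>d)\<close>.  The same count with \<open>\<nu>\<close> trivial leaves a factor q in the denominator.\<close>

lemma poch0_product: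
  assumes \<nu>: "\<nu> \<in> mult_chars"
  shows "(\<Prod>k<d. poch0 \<psi> (char_pow chi_d k) \<nu>)
    = inverse (\<nu> (of_nat d)) ^ d * gauss_sum0 \<psi> (char_pow \<nu> d) / of_nat CARD('a)"
proof -
  let ?q = "of_nat CARD('a) :: qbar"
  have d0: "d > 0" using d_ge by simp
  have q0: "?q \<noteq> 0" using card_field_ge_2[where 'a = 'a] by simp
  let ?D = "\<Prod>k<d. gauss_sum \<psi> (char_pow chi_d k)"
  have D: "?D \<noteq> 0" by (simp add: gauss_sum_nonzero)
  have single: "(\<Prod>k<d. ?q ^ (if d dvd k + t then 1 else 0)) = ?q" if t: "t < d" for t
  proof -
    let ?k = "(d - t) mod d"
    have "d dvd k + t \<longleftrightarrow> k = ?k" if k: "k < d" for k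
    proof (cases "t = 0")
      case True
      then show ?thesis using k by (auto dest: dvd_imp_le)
    next
      case False
      have "d dvd k + t \<longleftrightarrow> k + t = d"
      proof
        assume "d dvd k + t"
        then obtain c where c: "k + t = d * c" by blast
        have "c < 2" using c k t by (metis add_strict_mono mult.commute mult_2 mult_less_cancel1)
        moreover have "c \<noteq> 0" using c False by (cases "c = 0") auto
        ultimately show "k + t = d" using c by (simp add: numeral_2_eq_2 less_Suc_eq)
      qed simp
      then show ?thesis using False t k by (auto simp: mod_less)
    qed
    then have "(\<Prod>k<d. ?q ^ (if d dvd k + t then 1 else 0)) = (\<Prod>k<d. if k = ?k then ?q else 1)"
      by (intro prod.cong refl) auto
    also have "\<dots> = ?q" using d0 by (simp add: prod.delta)
    finally show ?thesis .
  qed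
  have up: "(\<Prod>k<d. gauss_sum0 \<psi> (char_mult (char_pow chi_d k) \<nu>))
      = inverse (\<nu> (of_nat d)) ^ d * gauss_sum0 \<psi> (char_pow \<nu> d) * ?D"
  proof -
    have "(\<Prod>k<d. ?q ^ (if char_mult (char_pow chi_d k) \<nu> = triv_char then 1 else 0))
        = ?q ^ (if char_pow \<nu> d = triv_char then 1 else 0)"
    proof (cases "char_pow \<nu> d = triv_char")
      case True
      then obtain t where "t < d" "\<nu> = char_pow chi_d t" using char_pow_d_eq_triv_iff[OF \<nu>] by blast
      then show ?thesis using True single[of t]
        by (simp add: char_mult_char_pow char_pow_chi_d_eq_triv_iff)
    next
      case False
      have "char_mult (char_pow chi_d k) \<nu> \<noteq> triv_char" for k
      proof
        assume "char_mult (char_pow chi_d k) \<nu> = triv_char"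
        then have "char_pow (char_mult (char_pow chi_d k) \<nu>) d = triv_char" by simp
        moreover have "char_pow (char_mult (char_pow chi_d k) \<nu>) d
            = char_mult (char_pow (char_pow chi_d k) d) (char_pow \<nu> d)"
          by (auto simp: char_mult_def char_pow_def power_mult_distrib)
        moreover have "char_pow (char_pow chi_d k) d = triv_char"
          by (simp add: char_pow_char_pow char_pow_chi_d_eq_triv_iff)
        ultimately show False using False \<nu> by simp
      qed
      then show ?thesis using False by simp
    qed
    moreover have "(\<Prod>k<d. gauss_sum \<psi> (char_mult (char_pow chi_d k) \<nu>))
        = inverse (\<nu> (of_nat d)) ^ d * gauss_sum \<psi> (char_pow \<nu> d) * ?D"
    proof -
      have "char_mult (char_pow chi_d k) \<nu> = char_mult \<nu> (char_pow chi_d k)" for k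
        by (simp add: char_mult_def fun_eq_iff mult.commute)
      then show ?thesis by (simp only: hasse_davenport_product[OF \<nu> d_dvd])
    qed
    ultimately show ?thesis
      unfolding gauss_sum0_def prod.distrib by (simp only: mult_ac)
  qed
  have low: "(\<Prod>k<d. gauss_sum0 \<psi> (char_pow chi_d k)) = ?q * ?D"
    using single[of 0] d0 unfolding gauss_sum0_def prod.distrib char_pow_chi_d_eq_triv_iff by simp
  show ?thesis unfolding poch0_def prod_dividef up low using D q0 by simp
qed

lemma Fw_eq:
  "Fw \<psi> \<phi> d n h w lam = of_nat CARD('a) / (1 - of_nat CARD('a)) *
    (\<Sum>\<nu>\<in>mult_chars. \<nu> ((of_nat d * lam) ^ d)
      * ((\<Prod>i=1..n. gauss_sum \<psi> (char_mult (char_pow chi_d (w i)) (char_pow \<nu> (h i)))) / gauss_sum0 \<psi> (char_pow \<nu> d)))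
    / (\<Prod>i=1..n. gauss_sum \<psi> (char_pow chi_d (w i)))"
proof -
  let ?q = "of_nat CARD('a) :: qbar"
  let ?G = "\<Prod>i=1..n. gauss_sum \<psi> (char_pow chi_d (w i))"
  let ?R = "\<lambda>\<nu>. \<Prod>i=1..n. gauss_sum \<psi> (char_mult (char_pow chi_d (w i)) (char_pow \<nu> (h i)))"
  let ?al = "\<lambda>i k. char_pow (char_root \<phi> (d * h i)) (w i + d * k)"
  let ?z = "of_nat (\<Prod>j=1..n. h j ^ h j) * lam ^ d :: 'a"
  have summand: "(\<Prod>\<alpha>\<leftarrow>concat (map (\<lambda>i. map (?al i) [0..<h i]) [1..<n+1]). poch \<psi> \<alpha> \<nu>)
      / (\<Prod>\<beta>\<leftarrow>map (char_pow chi_d) [0..<d]. poch0 \<psi> \<beta> \<nu>) * \<nu> ?z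
    = \<nu> ((of_nat d * lam) ^ d) * (?R \<nu> / gauss_sum0 \<psi> (char_pow \<nu> d)) * (?q / ?G)"
    if \<nu>: "\<nu> \<in> mult_chars" for \<nu>
  proof -
    have pl: "prod_list (map f [a..<b]) = prod f {a..<b}" for f :: "nat \<Rightarrow> qbar" and a b
      using prod.distinct_set_conv_list[of "[a..<b]" f] by simp
    have "(\<Prod>\<alpha>\<leftarrow>concat (map (\<lambda>i. map (?al i) [0..<h i]) xs). poch \<psi> \<alpha> \<nu>)
        = prod_list (map (\<lambda>i. \<Prod>k<h i. poch \<psi> (?al i k) \<nu>) xs)" for xs
      by (induction xs) (simp_all add: pl comp_def lessThan_atLeast0)
    then have "(\<Prod>\<alpha>\<leftarrow>concat (map (\<lambda>i. map (?al i) [0..<h i]) [1..<n+1]). poch \<psi> \<alpha> \<nu>)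
        = (\<Prod>i\<in>{1..<n+1}. \<Prod>k<h i. poch \<psi> (?al i k) \<nu>)" by (simp only: pl)
    also have "\<dots> = (\<Prod>i=1..n. inverse (\<nu> (of_nat (h i))) ^ h i
        * (gauss_sum \<psi> (char_mult (char_pow chi_d (w i)) (char_pow \<nu> (h i))) / gauss_sum \<psi> (char_pow chi_d (w i))))"
      by (intro prod.cong) (auto simp: poch_product[OF _ \<nu>])
    also have "\<dots> = inverse (\<Prod>i=1..n. \<nu> (of_nat (h i)) ^ h i) * (?R \<nu> / ?G)"
      by (simp add: prod.distrib prod_dividef power_inverse prod_inversef[symmetric])
    finally have up: "(\<Prod>\<alpha>\<leftarrow>concat (map (\<lambda>i. map (?al i) [0..<h i]) [1..<n+1]). poch \<psi> \<alpha> \<nu>)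
        = inverse (\<Prod>i=1..n. \<nu> (of_nat (h i)) ^ h i) * (?R \<nu> / ?G)" .
    have low: "(\<Prod>\<beta>\<leftarrow>map (char_pow chi_d) [0..<d]. poch0 \<psi> \<beta> \<nu>)
        = inverse (\<nu> (of_nat d)) ^ d * gauss_sum0 \<psi> (char_pow \<nu> d) / ?q"
      using poch0_product[OF \<nu>] by (simp add: pl comp_def lessThan_atLeast0)
    have gen: "inverse K * (R / G) / (inverse b ^ d * g / r) * (K * L) = b ^ d * L * (R / g) * (r / G)"
      if "K \<noteq> 0" "b \<noteq> 0" for K R G b g r L :: qbar
      using that by (simp add: power_inverse field_simps)
    have z: "\<nu> ?z = (\<Prod>i=1..n. \<nu> (of_nat (h i)) ^ h i) * \<nu> lam ^ d"
      by (simp add: mult_char_mult[OF \<nu>] mult_char_power[OF \<nu>] mult_char_prod[OF \<nu>] of_nat_prod)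
    have dl: "\<nu> ((of_nat d * lam) ^ d) = \<nu> (of_nat d) ^ d * \<nu> lam ^ d"
      by (simp add: mult_char_mult[OF \<nu>] mult_char_power[OF \<nu>] power_mult_distrib)
    have "(\<Prod>i=1..n. \<nu> (of_nat (h i)) ^ h i) \<noteq> 0"
      using mult_char_nonzero[OF \<nu> h_nz] by simp
    moreover have "\<nu> (of_nat d) \<noteq> 0" using mult_char_nonzero[OF \<nu> d_nz] .
    ultimately show ?thesis unfolding up low z dl by (rule gen)
  qed
  have "Fw \<psi> \<phi> d n h w lam = 1 / (1 - ?q) * (\<Sum>\<nu>\<in>mult_chars.
      \<nu> ((of_nat d * lam) ^ d) * (?R \<nu> / gauss_sum0 \<psi> (char_pow \<nu> d)) * (?q / ?G))"
    unfolding Fw_def hyperF_def by (intro arg_cong2[where f = "(*)"] refl sum.cong summand)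
  then show ?thesis unfolding sum_distrib_right[symmetric] by (simp add: mult_ac)
qed

end


section \<open>Averages over the symmetry group\<close>

context diag_setup
begin

definition mu_tuples :: "(nat \<Rightarrow> 'a) set" where
  "mu_tuples = {1..n} \<rightarrow>\<^sub>E mu d"

definition sym_tuples :: "(nat \<Rightarrow> 'a) set" where
  "sym_tuples = {\<xi> \<in> mu_tuples. (\<Prod>i=1..n. \<xi> i ^ h i) = 1}"

lemma carrier_Gtilde: "carrier (Gtilde d n h) = sym_tuples"
  by (simp add: Gtilde_def sym_tuples_def mu_tuples_def)

lemma finite_mu_tuples [simp]: "finite mu_tuples"
  by (simp add: mu_tuples_def)

lemma mu_prod:
  assumes "\<xi> \<in> mu_tuples"
  shows "(\<Prod>i=1..n. \<xi> i ^ k i) \<in> mu d"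
proof -
  have "(\<Prod>i=1..n. (\<xi> i ^ k i) ^ d) = 1"
  proof (rule prod.neutral, rule ballI)
    fix i assume "i \<in> {1..n}"
    then have "\<xi> i ^ d = 1" using assms by (auto simp: mu_tuples_def mu_def PiE_def Pi_def)
    then have "(\<xi> i ^ d) ^ k i = 1" by simp
    then show "(\<xi> i ^ k i) ^ d = 1" by (simp only: power_mult[symmetric] mult.commute)
  qed
  then show ?thesis by (simp add: mu_def prod_power_distrib)
qed

lemma phi_mu_prod: "\<phi> (\<Prod>i=1..n. \<xi> i ^ k i) = (\<Prod>i=1..n. \<phi> (\<xi> i) ^ k i)"
  by (simp add: mult_char_prod mult_char_power)

lemma sum_phi_powers_mu:
  assumes "z \<in> mu d"
  shows "(\<Sum>m<d. \<phi> z ^ m) = (if z = 1 then of_nat d else 0)"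
proof -
  have "\<phi> z ^ d = 1" using assms by (simp add: mu_def mult_char_1 flip: mult_char_power)
  from sum_powers_root_of_unity[OF this] show ?thesis by (simp only: phi_eq_1_iff)
qed

lemma sum_over_mu: "(\<Sum>\<xi>\<in>mu d. \<phi> \<xi> ^ k) = (if d dvd k then of_nat d else 0)"
proof (cases "d dvd k")
  case True
  then obtain c where c: "k = d * c" by blast
  have "\<phi> \<xi> ^ k = 1" if "\<xi> \<in> mu d" for \<xi>
    using that by (simp add: mu_def c power_mult mult_char_1 flip: mult_char_power)
  then have "(\<Sum>\<xi>\<in>mu d. \<phi> \<xi> ^ k) = (\<Sum>\<xi>\<in>(mu d :: 'a set). 1)" by (intro sum.cong refl)
  then show ?thesis using True card_mu[OF d_dvd] by simp
next
  case False
  then have "char_pow chi_d k \<noteq> triv_char" by (simp add: char_pow_chi_d_eq_triv_iff)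
  then obtain x where x: "char_pow chi_d k x \<noteq> triv_char x" by (auto simp: fun_eq_iff)
  then have x0: "x \<noteq> 0" by (auto simp: char_pow_def triv_char_def)
  define a where "a = x ^ ((CARD('a) - 1) div d)"
  have "a ^ d = x ^ (CARD('a) - 1)" using d_dvd by (simp add: a_def flip: power_mult)
  then have ad: "a ^ d = 1" using finite_field_power_card_minus_1[OF x0] by simp
  have a1: "\<phi> a ^ k \<noteq> 1" using x x0 by (simp add: a_def char_pow_def triv_char_def char_root_eq)
  have a0: "a \<noteq> 0" using x0 by (simp add: a_def)
  have "bij_betw ((*) a) (mu d) (mu d)"
    by (rule bij_betw_byWitness[of _ "\<lambda>x. x / a"])
       (use a0 ad in \<open>auto simp: mu_def power_mult_distrib power_divide\<close>)
  then have "(\<Sum>\<xi>\<in>mu d. \<phi> (a * \<xi>) ^ k) = (\<Sum>\<xi>\<in>mu d. \<phi> \<xi> ^ k)"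
    by (rule sum.reindex_bij_betw)
  then have "\<phi> a ^ k * (\<Sum>\<xi>\<in>mu d. \<phi> \<xi> ^ k) = (\<Sum>\<xi>\<in>mu d. \<phi> \<xi> ^ k)"
    by (simp add: mult_char_mult power_mult_distrib sum_distrib_left)
  then show ?thesis using a1 False by simp
qed

lemma sum_over_mu_tuples:
  "(\<Sum>\<xi>\<in>mu_tuples. \<phi> (\<Prod>i=1..n. \<xi> i ^ k i)) = (if \<forall>i\<in>{1..n}. d dvd k i then of_nat d ^ n else 0)"
proof -
  have "(\<Sum>\<xi>\<in>mu_tuples. \<phi> (\<Prod>i=1..n. \<xi> i ^ k i)) = (\<Prod>i=1..n. \<Sum>\<xi>\<in>mu d. \<phi> \<xi> ^ k i)"
    unfolding phi_mu_prod mu_tuples_def by (rule prod_sum_PiE[symmetric]) auto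
  also have "\<dots> = (\<Prod>i=1..n. if d dvd k i then of_nat d else 0)" by (simp only: sum_over_mu)
  also have "\<dots> = (if \<forall>i\<in>{1..n}. d dvd k i then of_nat d ^ n else 0)"
  proof (cases "\<forall>i\<in>{1..n}. d dvd k i")
    case False
    then obtain i where "i \<in> {1..n}" "\<not> d dvd k i" by blast
    then have "(\<Prod>i=1..n. if d dvd k i then of_nat d else 0 :: qbar) = 0"
      by (intro prod_zero bexI[of _ i]) simp_all
    then show ?thesis unfolding if_not_P[OF False] .
  qed simp
  finally show ?thesis .
qed

lemma of_nat_d_nz: "(of_nat d :: qbar) \<noteq> 0"
  using d_ge by simp

text \<open>Orthogonality on the group of d-th roots of unity picks out the tuples with
  \<open>\<xi>\<^sub>1\<^sup>h\<^sup>1 \<cdots> \<xi>\<^sub>n\<^sup>h\<^sup>n = 1\<close>.\<close>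

lemma sum_sym_tuples:
  fixes f :: "(nat \<Rightarrow> 'a) \<Rightarrow> qbar"
  shows "(\<Sum>\<xi>\<in>sym_tuples. \<phi> (\<Prod>i=1..n. \<xi> i ^ k i) * f \<xi>)
    = 1 / of_nat d * (\<Sum>m<d. \<Sum>\<xi>\<in>mu_tuples. \<phi> (\<Prod>i=1..n. \<xi> i ^ (k i + m * h i)) * f \<xi>)"
proof -
  have "(\<Sum>m<d. \<Sum>\<xi>\<in>mu_tuples. \<phi> (\<Prod>i=1..n. \<xi> i ^ (k i + m * h i)) * f \<xi>)
      = (\<Sum>\<xi>\<in>mu_tuples. \<Sum>m<d. \<phi> (\<Prod>i=1..n. \<xi> i ^ (k i + m * h i)) * f \<xi>)"
    by (rule sum.swap)
  also have "\<dots> = (\<Sum>\<xi>\<in>mu_tuples. if (\<Prod>i=1..n. \<xi> i ^ h i) = 1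
      then of_nat d * (\<phi> (\<Prod>i=1..n. \<xi> i ^ k i) * f \<xi>) else 0)"
  proof (rule sum.cong[OF refl])
    fix \<xi> assume \<xi>: "\<xi> \<in> mu_tuples"
    have "(\<Prod>i=1..n. \<xi> i ^ (k i + m * h i)) = (\<Prod>i=1..n. \<xi> i ^ k i) * (\<Prod>i=1..n. \<xi> i ^ h i) ^ m" for m
      by (simp add: power_add power_mult prod.distrib prod_power_distrib mult.commute[of m])
    then have "(\<Sum>m<d. \<phi> (\<Prod>i=1..n. \<xi> i ^ (k i + m * h i)) * f \<xi>)
        = (\<Sum>m<d. \<phi> (\<Prod>i=1..n. \<xi> i ^ h i) ^ m * (\<phi> (\<Prod>i=1..n. \<xi> i ^ k i) * f \<xi>))"
      by (simp only: mult_char_mult[OF phi_char] mult_char_power[OF phi_char] mult_ac)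
    then have "(\<Sum>m<d. \<phi> (\<Prod>i=1..n. \<xi> i ^ (k i + m * h i)) * f \<xi>)
        = (\<Sum>m<d. \<phi> (\<Prod>i=1..n. \<xi> i ^ h i) ^ m) * (\<phi> (\<Prod>i=1..n. \<xi> i ^ k i) * f \<xi>)"
      by (simp only: sum_distrib_right)
    then show "(\<Sum>m<d. \<phi> (\<Prod>i=1..n. \<xi> i ^ (k i + m * h i)) * f \<xi>)
        = (if (\<Prod>i=1..n. \<xi> i ^ h i) = 1 then of_nat d * (\<phi> (\<Prod>i=1..n. \<xi> i ^ k i) * f \<xi>) else 0)"
      by (simp only: sum_phi_powers_mu[OF mu_prod[OF \<xi>]] if_distrib[of "\<lambda>x. x * _"] mult_zero_left)
  qed
  also have "\<dots> = (\<Sum>\<xi>\<in>sym_tuples. of_nat d * (\<phi> (\<Prod>i=1..n. \<xi> i ^ k i) * f \<xi>))"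
    unfolding sym_tuples_def by (rule sum.inter_filter[symmetric]) simp
  finally show ?thesis using of_nat_d_nz by (simp flip: sum_distrib_left)
qed

text \<open>In the expansion by characters of \<open>\<mu>\<^sub>d\<close>, the m-th term vanishes unless d divides all \<open>m h\<^sub>i\<close>, which by
  the condition on the greatest common divisor forces m = 0.\<close>

lemma card_mu_tuples_fibre:
  assumes z: "z \<in> mu d"
  shows "card {\<xi> \<in> mu_tuples. (\<Prod>i=1..n. \<xi> i ^ h i) = z} = d ^ (n - 1)"
proof -
  have z0: "z \<noteq> 0" using mu_nonzero[of d z] z d_ge by simp
  have iz: "inverse z * u \<in> mu d" if "u \<in> mu d" for u
    using z that by (simp add: mu_def power_mult_distrib power_inverse)
  have "of_nat d * of_nat (card {\<xi> \<in> mu_tuples. (\<Prod>i=1..n. \<xi> i ^ h i) = z})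
      = (\<Sum>\<xi>\<in>mu_tuples. if (\<Prod>i=1..n. \<xi> i ^ h i) = z then of_nat d else 0 :: qbar)"
    by (simp add: sum.If_cases Int_def)
  also have "\<dots> = (\<Sum>\<xi>\<in>mu_tuples. \<Sum>m<d. \<phi> (inverse z * (\<Prod>i=1..n. \<xi> i ^ h i)) ^ m)"
  proof (rule sum.cong[OF refl])
    fix \<xi> assume \<xi>: "\<xi> \<in> mu_tuples"
    have "inverse z * (\<Prod>i=1..n. \<xi> i ^ h i) = 1 \<longleftrightarrow> (\<Prod>i=1..n. \<xi> i ^ h i) = z"
      using z0 by (auto simp: field_simps)
    then show "(if (\<Prod>i=1..n. \<xi> i ^ h i) = z then of_nat d else 0)
        = (\<Sum>m<d. \<phi> (inverse z * (\<Prod>i=1..n. \<xi> i ^ h i)) ^ m)"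
      by (simp only: sum_phi_powers_mu[OF iz[OF mu_prod[OF \<xi>]]])
  qed
  also have "\<dots> = (\<Sum>m<d. \<Sum>\<xi>\<in>mu_tuples. \<phi> (inverse z * (\<Prod>i=1..n. \<xi> i ^ h i)) ^ m)"
    by (rule sum.swap)
  also have "\<dots> = (\<Sum>m<d. \<phi> (inverse z) ^ m * (\<Sum>\<xi>\<in>mu_tuples. \<phi> (\<Prod>i=1..n. \<xi> i ^ (m * h i))))"
  proof (rule sum.cong[OF refl])
    fix m
    have "(\<Prod>i=1..n. \<xi> i ^ h i) ^ m = (\<Prod>i=1..n. \<xi> i ^ (m * h i))" for \<xi> :: "nat \<Rightarrow> 'a"
      by (simp add: prod_power_distrib mult.commute[of m] flip: power_mult)
    then show "(\<Sum>\<xi>\<in>mu_tuples. \<phi> (inverse z * (\<Prod>i=1..n. \<xi> i ^ h i)) ^ m)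
        = \<phi> (inverse z) ^ m * (\<Sum>\<xi>\<in>mu_tuples. \<phi> (\<Prod>i=1..n. \<xi> i ^ (m * h i)))"
      unfolding sum_distrib_left
      by (intro sum.cong refl) (simp add: mult_char_mult[OF phi_char] power_mult_distrib mult_char_power[OF phi_char, symmetric])
  qed
  also have "\<dots> = (\<Sum>m<d. if m = 0 then of_nat d ^ n else 0)"
  proof (rule sum.cong[OF refl])
    fix m assume m: "m \<in> {..<d}"
    have "(\<forall>i\<in>{1..n}. d dvd m * h i) \<longleftrightarrow> m = 0"
      using d_dvd_if_dvd_mult_h[of m] m by (auto dest!: dvd_imp_le)
    then show "\<phi> (inverse z) ^ m * (\<Sum>\<xi>\<in>mu_tuples. \<phi> (\<Prod>i=1..n. \<xi> i ^ (m * h i)))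
        = (if m = 0 then of_nat d ^ n else 0)"
      by (simp only: sum_over_mu_tuples) simp
  qed
  also have "\<dots> = of_nat d ^ n" using d_ge by simp
  also have "\<dots> = of_nat d * of_nat (d ^ (n - 1))" using n_ge by (cases n) simp_all
  finally show ?thesis
    using of_nat_d_nz by (simp only: mult_cancel_left of_nat_eq_iff simp_thms)
qed

lemma card_sym_tuples: "card sym_tuples = d ^ (n - 1)"
  unfolding sym_tuples_def by (rule card_mu_tuples_fibre) (simp add: mu_def)

end


section \<open>Fixed points and vectors\<close>

context diag_setup
begin

definition line :: "(nat \<Rightarrow> 'a alg_closure) \<Rightarrow> (nat \<Rightarrow> 'a alg_closure) set" where
  "line x = {(\<lambda>i\<in>{1..n}. c * x i) | c. c \<noteq> 0}"

definition on_hyp :: "(nat \<Rightarrow> 'a alg_closure) \<Rightarrow> bool" where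
  "on_hyp x \<longleftrightarrow> (\<Sum>i=1..n. x i ^ d) = of_nat d * to_ac lam * (\<Prod>i=1..n. x i ^ h i)"

definition twisted_vecs :: "(nat \<Rightarrow> 'a) \<Rightarrow> (nat \<Rightarrow> 'a alg_closure) set" where
  "twisted_vecs \<xi> = {x \<in> {1..n} \<rightarrow>\<^sub>E UNIV. \<forall>i\<in>{1..n}. x i ^ CARD('a) = to_ac (\<xi> i) * x i}"

definition twisted_sols :: "(nat \<Rightarrow> 'a) \<Rightarrow> (nat \<Rightarrow> 'a alg_closure) set" where
  "twisted_sols \<xi> = {x \<in> twisted_vecs \<xi>. (\<exists>i\<in>{1..n}. x i \<noteq> 0) \<and> on_hyp x}"

lemma line_altdef: "line x = (\<lambda>c. \<lambda>i\<in>{1..n}. c * x i) ` {c. c \<noteq> 0}"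
  by (auto simp: line_def)

lemma in_line_self: "x \<in> extensional {1..n} \<Longrightarrow> x \<in> line x"
  unfolding line_altdef by (rule image_eqI[of _ _ 1]) (auto simp: fun_eq_iff extensional_def)

lemma line_eq:
  assumes "y \<in> line x"
  shows "line y = line x"
proof -
  obtain c where c: "c \<noteq> 0" "y = (\<lambda>i\<in>{1..n}. c * x i)" using assms by (auto simp: line_def)
  show ?thesis
  proof (intro equalityI subsetI)
    fix z assume "z \<in> line y"
    then obtain e where "e \<noteq> 0" "z = (\<lambda>i\<in>{1..n}. e * y i)" by (auto simp: line_def)
    then show "z \<in> line x" unfolding line_altdef using c
      by (intro image_eqI[of _ _ "e * c"]) (auto simp: fun_eq_iff)
  next
    fix z assume "z \<in> line x"
    then obtain e where "e \<noteq> 0" "z = (\<lambda>i\<in>{1..n}. e * x i)" by (auto simp: line_def)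
    then show "z \<in> line y" unfolding line_altdef using c
      by (intro image_eqI[of _ _ "e / c"]) (auto simp: fun_eq_iff)
  qed
qed

lemma line_in_proj_space:
  "x \<in> {1..n} \<rightarrow>\<^sub>E UNIV \<Longrightarrow> \<exists>i\<in>{1..n}. x i \<noteq> 0 \<Longrightarrow> line x \<in> proj_space n"
  by (auto simp: proj_space_def line_def)

lemma proj_space_cases:
  assumes "P \<in> proj_space n"
  obtains x where "x \<in> {1..n} \<rightarrow>\<^sub>E UNIV" "\<exists>i\<in>{1..n}. x i \<noteq> 0" "P = line x"
  using assms by (auto simp: proj_space_def line_def)

lemma on_hyp_scale:
  assumes "c \<noteq> 0"
  shows "on_hyp (\<lambda>i\<in>{1..n}. c * x i) \<longleftrightarrow> on_hyp x"
proof -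
  have "(\<Sum>i=1..n. (\<lambda>i\<in>{1..n}. c * x i) i ^ d) = c ^ d * (\<Sum>i=1..n. x i ^ d)"
    by (simp add: power_mult_distrib sum_distrib_left)
  moreover have "(\<Prod>i=1..n. (\<lambda>i\<in>{1..n}. c * x i) i ^ h i) = c ^ d * (\<Prod>i=1..n. x i ^ h i)"
    by (simp add: power_mult_distrib prod.distrib h_sum[simplified] flip: power_sum)
  moreover have "c ^ d \<noteq> 0" using assms by simp
  ultimately show ?thesis unfolding on_hyp_def by (simp only: mult.left_commute[of _ "c ^ d"] mult_cancel_left simp_thms)
qed

lemma line_in_diag_hyp_iff:
  assumes "x \<in> {1..n} \<rightarrow>\<^sub>E UNIV" "\<exists>i\<in>{1..n}. x i \<noteq> 0"
  shows "line x \<in> diag_hyp d n h lam \<longleftrightarrow> on_hyp x"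
proof -
  have "line x \<in> diag_hyp d n h lam \<longleftrightarrow> (\<forall>y\<in>line x. on_hyp y)"
    using line_in_proj_space[OF assms] by (simp add: diag_hyp_def on_hyp_def)
  also have "\<dots> \<longleftrightarrow> on_hyp x"
  proof
    assume "\<forall>y\<in>line x. on_hyp y"
    then show "on_hyp x" using in_line_self assms(1) by (auto simp: PiE_def)
  qed (auto simp: line_def on_hyp_scale simp del: One_nat_def)
  finally show ?thesis .
qed

lemma frob_line: "frob n (line x) = line (\<lambda>i\<in>{1..n}. x i ^ CARD('a))"
proof (intro equalityI subsetI)
  fix y assume "y \<in> frob n (line x)"
  then obtain c where "c \<noteq> 0" "y = (\<lambda>i\<in>{1..n}. (c * x i) ^ CARD('a))"
    by (auto simp: frob_def line_def fun_eq_iff)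
  then show "y \<in> line (\<lambda>i\<in>{1..n}. x i ^ CARD('a))"
    unfolding line_altdef by (intro image_eqI[of _ _ "c ^ CARD('a)"]) (auto simp: fun_eq_iff power_mult_distrib)
next
  fix y assume "y \<in> line (\<lambda>i\<in>{1..n}. x i ^ CARD('a))"
  then obtain c where c: "c \<noteq> 0" "y = (\<lambda>i\<in>{1..n}. c * x i ^ CARD('a))"
    by (auto simp: line_def fun_eq_iff)
  have q: "CARD('a) > 0" by simp
  then obtain e where e: "e ^ CARD('a) = c" using nth_root_exists by blast
  then have "e \<noteq> 0" using c(1) q by (auto simp: power_0_left)
  then have mem: "(\<lambda>i\<in>{1..n}. e * x i) \<in> line x" unfolding line_altdef by (intro imageI) simp
  have eq: "y = (\<lambda>x. \<lambda>i\<in>{1..n}. x i ^ CARD('a)) (\<lambda>i\<in>{1..n}. e * x i)"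
    using c e by (auto simp: fun_eq_iff power_mult_distrib)
  show "y \<in> frob n (line x)" unfolding frob_def eq by (rule imageI) (rule mem)
qed

lemma finite_twisted_vecs: "finite (twisted_vecs \<xi>)"
proof (rule finite_subset)
  show "twisted_vecs \<xi> \<subseteq> PiE {1..n} (\<lambda>i. {x. x ^ CARD('a) = to_ac (\<xi> i) * x})"
    by (auto simp: twisted_vecs_def PiE_def Pi_def)
  have "finite {x. x ^ CARD('a) = to_ac c * x}" for c :: 'a
  proof -
    have "monom 1 CARD('a) - monom (to_ac c) 1 \<noteq> 0"
      using card_field_ge_2[where 'a = 'a] by (auto simp: poly_eq_iff intro!: exI[of _ "CARD('a)"])
    from poly_roots_finite[OF this] show ?thesis by (simp add: poly_monom)
  qed
  then show "finite (PiE {1..n} (\<lambda>i. {x. x ^ CARD('a) = to_ac (\<xi> i) * x}))" by (intro finite_PiE) auto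
qed

text \<open>A fixed point of \<open>\<xi>\<inverse>\<Phi>\<close> is a line whose points satisfy \<open>x\<^sup>q = c \<xi> x\<close> for some scalar c.  Rescaling
  by a (q-1)-th root of \<open>1/c\<close> makes c = 1, and the remaining freedom is the group of nonzero elements of
  the ground field.\<close>

lemma card_twisted_sols:
  assumes \<xi>: "\<And>i. i \<in> {1..n} \<Longrightarrow> \<xi> i \<noteq> 0"
  shows "card (twisted_sols \<xi>) = (CARD('a) - 1) *
    card {P \<in> diag_hyp d n h lam. \<exists>x. P = line x \<and> line (\<lambda>i\<in>{1..n}. to_ac (inverse (\<xi> i)) * x i ^ CARD('a)) = line x}"
    (is "_ = _ * card ?FP")
proof -
  let ?q = "CARD('a)"
  have q: "?q - 1 > 0" "?q = Suc (?q - 1)" using card_field_ge_2[where 'a = 'a] by auto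
  have fin: "finite (twisted_sols \<xi>)"
    by (rule finite_subset[OF _ finite_twisted_vecs]) (auto simp: twisted_sols_def)
  have fixed: "line x \<in> ?FP" if x: "x \<in> twisted_sols \<xi>" for x
  proof -
    have "x \<in> {1..n} \<rightarrow>\<^sub>E UNIV" "\<exists>i\<in>{1..n}. x i \<noteq> 0" "on_hyp x"
      using x by (auto simp: twisted_sols_def twisted_vecs_def)
    then have "line x \<in> diag_hyp d n h lam" by (simp only: line_in_diag_hyp_iff)
    moreover have "(\<lambda>i\<in>{1..n}. to_ac (inverse (\<xi> i)) * x i ^ ?q) = x"
      using x \<xi> by (auto simp: twisted_sols_def twisted_vecs_def fun_eq_iff PiE_def extensional_def)
    ultimately show ?thesis by auto
  qed
  have repr: "\<exists>x\<in>twisted_sols \<xi>. P = line x" if P: "P \<in> ?FP" for P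
  proof -
    obtain x0 where x0: "P = line x0" "line (\<lambda>i\<in>{1..n}. to_ac (inverse (\<xi> i)) * x0 i ^ ?q) = line x0"
      and D: "P \<in> diag_hyp d n h lam" using P by blast
    obtain x where x: "x \<in> {1..n} \<rightarrow>\<^sub>E UNIV" "\<exists>i\<in>{1..n}. x i \<noteq> 0" "P = line x"
      using D proj_space_cases unfolding diag_hyp_def by blast
    have on: "on_hyp x" using D x line_in_diag_hyp_iff by simp
    have "x \<in> line x0" using in_line_self[of x] x x0(1) by (auto simp: PiE_def)
    then obtain b where b: "b \<noteq> 0" "x = (\<lambda>i\<in>{1..n}. b * x0 i)" by (auto simp: line_def)
    have "(\<lambda>i\<in>{1..n}. to_ac (inverse (\<xi> i)) * x i ^ ?q) \<in> line (\<lambda>i\<in>{1..n}. to_ac (inverse (\<xi> i)) * x0 i ^ ?q)"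
      unfolding line_altdef using b
      by (intro image_eqI[of _ _ "b ^ ?q"]) (auto simp: fun_eq_iff power_mult_distrib)
    then have "(\<lambda>i\<in>{1..n}. to_ac (inverse (\<xi> i)) * x i ^ ?q) \<in> line x" using x0 x(3) by simp
    then obtain c where c: "c \<noteq> 0" "(\<lambda>i\<in>{1..n}. to_ac (inverse (\<xi> i)) * x i ^ ?q) = (\<lambda>i\<in>{1..n}. c * x i)"
      by (auto simp: line_def)
    have eq: "x i ^ ?q = c * (to_ac (\<xi> i) * x i)" if "i \<in> {1..n}" for i
    proof -
      have "to_ac (inverse (\<xi> i)) * x i ^ ?q = c * x i" using fun_cong[OF c(2), of i] that by simp
      then show ?thesis using \<xi>[OF that] by (simp add: field_simps)
    qed
    obtain e where e: "e ^ (?q - 1) = inverse c" using nth_root_exists[OF q(1)] by blast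
    have e0: "e \<noteq> 0" using e c(1) q(1) by (auto simp: power_0_left)
    have eq': "e ^ ?q = e * inverse c" using e q(2) by (metis power_Suc)
    let ?y = "\<lambda>i\<in>{1..n}. e * x i"
    have "?y \<in> line x" unfolding line_altdef using e0 by (intro imageI) simp
    then have "P = line ?y" using line_eq x(3) by simp
    moreover have "?y i ^ ?q = to_ac (\<xi> i) * ?y i" if "i \<in> {1..n}" for i
      using that c(1) by (simp add: power_mult_distrib eq' eq[OF that])
    then have "?y \<in> twisted_vecs \<xi>" by (auto simp: twisted_vecs_def)
    then have "?y \<in> twisted_sols \<xi>"
      using x(2) e0 on on_hyp_scale[OF e0, of x] by (auto simp: twisted_sols_def)
    ultimately show ?thesis by blast
  qed
  have fibre: "card {y \<in> twisted_sols \<xi>. line y = P} = ?q - 1" if P: "P \<in> ?FP" for P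
  proof -
    obtain x where x: "x \<in> twisted_sols \<xi>" "P = line x" using repr[OF P] by blast
    obtain j where j: "j \<in> {1..n}" "x j \<noteq> 0" using x by (auto simp: twisted_sols_def)
    have tw: "x i ^ ?q = to_ac (\<xi> i) * x i" if "i \<in> {1..n}" for i
      using x that by (auto simp: twisted_sols_def twisted_vecs_def)
    let ?f = "\<lambda>c. \<lambda>i\<in>{1..n}. to_ac c * x i"
    have "{y \<in> twisted_sols \<xi>. line y = P} = ?f ` (UNIV - {0})"
    proof (intro equalityI subsetI)
      fix y assume y: "y \<in> {y \<in> twisted_sols \<xi>. line y = P}"
      then have "y \<in> line x" using in_line_self[of y] x(2)
        by (auto simp: twisted_sols_def twisted_vecs_def PiE_def)
      then obtain c where c: "c \<noteq> 0" "y = (\<lambda>i\<in>{1..n}. c * x i)" by (auto simp: line_def)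
      have "y j ^ ?q = to_ac (\<xi> j) * y j" using y j by (auto simp: twisted_sols_def twisted_vecs_def)
      then have "c ^ ?q * (to_ac (\<xi> j) * x j) = c * (to_ac (\<xi> j) * x j)"
        using c j tw[OF j(1)] by (simp add: power_mult_distrib mult_ac)
      then have "c ^ ?q = c" using j \<xi>[OF j(1)] by simp
      then obtain c' where "c = to_ac c'" by (auto simp: frobenius_fixed_iff)
      then show "y \<in> ?f ` (UNIV - {0})" using c by auto
    next
      fix y assume "y \<in> ?f ` (UNIV - {0})"
      then obtain c where c: "c \<noteq> 0" "y = ?f c" by auto
      then have yl: "y \<in> line x" unfolding line_altdef by (intro image_eqI[of _ _ "to_ac c"]) auto
      have "y i ^ ?q = to_ac (\<xi> i) * y i" if "i \<in> {1..n}" for i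
        using that c tw[OF that]
        by (simp add: power_mult_distrib finite_field_power_card mult_ac flip: to_ac_power)
      then have "y \<in> twisted_vecs \<xi>" using c by (auto simp: twisted_vecs_def)
      moreover have "y j \<noteq> 0" using c j by simp
      moreover have "on_hyp y" using x(1) c on_hyp_scale[of "to_ac c" x] by (simp add: twisted_sols_def)
      ultimately show "y \<in> {y \<in> twisted_sols \<xi>. line y = P}"
        using j line_eq[OF yl] x(2) by (auto simp: twisted_sols_def)
    qed
    moreover have "inj_on ?f (UNIV - {0})"
    proof (rule inj_onI)
      fix a b assume "?f a = ?f b"
      then have "?f a j = ?f b j" by simp
      then show "a = b" using j by simp
    qed
    ultimately show ?thesis by (simp add: card_image card_Diff_singleton)
  qed
  have finFP: "finite ?FP"
  proof (rule finite_subset)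
    show "?FP \<subseteq> line ` twisted_sols \<xi>" using repr by blast
  qed (use fin in simp)
  have "card (twisted_sols \<xi>) = (\<Sum>x\<in>twisted_sols \<xi>. 1)" by simp
  also have "\<dots> = (\<Sum>P\<in>?FP. \<Sum>y\<in>{y \<in> twisted_sols \<xi>. line y = P}. 1)"
    by (rule sum.group[symmetric, OF fin finFP]) (use fixed in blast)
  also have "\<dots> = (\<Sum>P\<in>?FP. ?q - 1)" by (rule sum.cong[OF refl]) (simp add: fibre)
  finally show ?thesis by simp
qed

lemma Gtilde_inv:
  assumes "\<xi> \<in> sym_tuples"
  shows "inv\<^bsub>Gtilde d n h\<^esub> \<xi> = (\<lambda>i\<in>{1..n}. inverse (\<xi> i))" "(\<lambda>i\<in>{1..n}. inverse (\<xi> i)) \<in> sym_tuples"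
proof -
  interpret comm_group "Gtilde d n h :: (nat \<Rightarrow> 'a) monoid"
    using d_ge by (intro comm_group_Gtilde) simp
  have nz: "\<xi> i \<noteq> 0" if "i \<in> {1..n}" for i
    using assms that d_ge mu_nonzero[of d "\<xi> i"] by (auto simp: sym_tuples_def mu_tuples_def PiE_def Pi_def)
  have "(\<Prod>i=1..n. inverse (\<xi> i) ^ h i) = inverse (\<Prod>i=1..n. \<xi> i ^ h i)"
    by (simp add: power_inverse flip: prod_inversef)
  then show mem: "(\<lambda>i\<in>{1..n}. inverse (\<xi> i)) \<in> sym_tuples"
    using assms by (auto simp: sym_tuples_def mu_tuples_def mu_def PiE_def Pi_def power_inverse)
  show "inv\<^bsub>Gtilde d n h\<^esub> \<xi> = (\<lambda>i\<in>{1..n}. inverse (\<xi> i))"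
  proof (rule inv_equality)
    show "(\<lambda>i\<in>{1..n}. inverse (\<xi> i)) \<otimes>\<^bsub>Gtilde d n h\<^esub> \<xi> = \<one>\<^bsub>Gtilde d n h\<^esub>"
      using nz by (auto simp: Gtilde_def fun_eq_iff)
  qed (use assms mem in \<open>simp_all add: carrier_Gtilde\<close>)
qed

lemma sum_Ggrp:
  fixes f :: "(nat \<Rightarrow> 'a) set \<Rightarrow> qbar"
  shows "(\<Sum>\<xi>\<in>sym_tuples. f (Delta d n #>\<^bsub>Gtilde d n h\<^esub> \<xi>))
    = of_nat (card (Delta d n :: (nat \<Rightarrow> 'a) set)) * (\<Sum>A\<in>carrier (Ggrp d n h). f A)"
proof -
  let ?G = "Gtilde d n h :: (nat \<Rightarrow> 'a) monoid" and ?D = "Delta d n :: (nat \<Rightarrow> 'a) set"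
  interpret N: normal ?D ?G using d_ge h_sum by (intro normal_Delta) auto
  have carr: "carrier (Ggrp d n h) = rcosets\<^bsub>?G\<^esub> ?D" by (simp add: Ggrp_def FactGroup_def)
  have finG: "finite (carrier ?G)" by (simp add: carrier_Gtilde sym_tuples_def)
  have part: "\<Union>(rcosets\<^bsub>?G\<^esub> ?D) = carrier ?G" by (rule N.rcosets_part_G) (rule N.is_subgroup)
  have "(\<Sum>\<xi>\<in>sym_tuples. f (?D #>\<^bsub>?G\<^esub> \<xi>)) = (\<Sum>\<xi>\<in>\<Union>(rcosets\<^bsub>?G\<^esub> ?D). f (?D #>\<^bsub>?G\<^esub> \<xi>))"
    by (simp only: part carrier_Gtilde)
  also have "\<dots> = (\<Sum>A\<in>rcosets\<^bsub>?G\<^esub> ?D. \<Sum>\<xi>\<in>A. f (?D #>\<^bsub>?G\<^esub> \<xi>))"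
  proof (rule sum.Union_disjoint[unfolded comp_def])
    show "\<forall>A\<in>rcosets\<^bsub>?G\<^esub> ?D. finite A" using part finG by (metis Union_upper finite_subset)
    show "\<forall>A\<in>rcosets\<^bsub>?G\<^esub> ?D. \<forall>B\<in>rcosets\<^bsub>?G\<^esub> ?D. A \<noteq> B \<longrightarrow> A \<inter> B = {}"
      using N.rcos_disjoint[OF N.is_subgroup] by (auto simp: pairwise_def disjnt_def)
  qed
  also have "\<dots> = (\<Sum>A\<in>rcosets\<^bsub>?G\<^esub> ?D. of_nat (card ?D) * f A)"
  proof (rule sum.cong[OF refl])
    fix A assume A: "A \<in> rcosets\<^bsub>?G\<^esub> ?D"
    have "?D #>\<^bsub>?G\<^esub> \<xi> = A" if "\<xi> \<in> A" for \<xi>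
    proof -
      obtain x where x: "x \<in> carrier ?G" "A = ?D #>\<^bsub>?G\<^esub> x" using A by (auto simp: RCOSETS_def)
      then show ?thesis using N.repr_independence[OF _ x(1) N.is_subgroup, of \<xi>] that by simp
    qed
    then have "(\<Sum>\<xi>\<in>A. f (?D #>\<^bsub>?G\<^esub> \<xi>)) = (\<Sum>\<xi>\<in>A. f A)" by (intro sum.cong refl) simp
    moreover have "card A = card ?D"
      using N.card_rcosets_equal[OF A] N.subset by simp
    ultimately show "(\<Sum>\<xi>\<in>A. f (?D #>\<^bsub>?G\<^esub> \<xi>)) = of_nat (card ?D) * f A" by simp
  qed
  finally show ?thesis by (simp only: carr sum_distrib_left)
qed

lemma N1_eq:
  assumes w: "w \<in> Wset d n"
  shows "N1 \<phi> d n h lam w = 1 / (of_nat (d ^ (n - 1)) * (of_nat CARD('a) - 1)) *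
    (\<Sum>\<xi>\<in>sym_tuples. \<phi> (\<Prod>i=1..n. \<xi> i ^ w i) * of_nat (card (twisted_sols \<xi>)))"
proof -
  let ?G = "Gtilde d n h :: (nat \<Rightarrow> 'a) monoid" and ?D = "Delta d n :: (nat \<Rightarrow> 'a) set"
  let ?q = "of_nat CARD('a) :: qbar"
  define FP where "FP = (\<lambda>A. {P \<in> diag_hyp d n h lam. act n (inv\<^bsub>Ggrp d n h\<^esub> A) (frob n P) = P})"
  define f where "f = (\<lambda>A. chi \<phi> n w A * of_nat (card (FP A)))"
  interpret N: normal ?D ?G using d_ge h_sum by (intro normal_Delta) auto
  have q: "of_nat (CARD('a) - 1) = ?q - 1" "?q - 1 \<noteq> 0"
    using card_field_ge_2[where 'a = 'a] by (simp_all add: of_nat_diff)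
  have summand: "f (?D #>\<^bsub>?G\<^esub> \<xi>) = \<phi> (\<Prod>i=1..n. \<xi> i ^ w i) * (of_nat (card (twisted_sols \<xi>)) / (?q - 1))"
    if \<xi>: "\<xi> \<in> sym_tuples" for \<xi>
  proof -
    have nz: "\<xi> i \<noteq> 0" if "i \<in> {1..n}" for i
      using \<xi> that d_ge mu_nonzero[of d "\<xi> i"] by (auto simp: sym_tuples_def mu_tuples_def PiE_def Pi_def)
    have "?D #>\<^bsub>?G\<^esub> \<xi> \<in> carrier (?G Mod ?D)"
      using \<xi> by (auto simp: FactGroup_def RCOSETS_def carrier_Gtilde)
    then have "inv\<^bsub>Ggrp d n h\<^esub> (?D #>\<^bsub>?G\<^esub> \<xi>) = ?D #>\<^bsub>?G\<^esub> (inv\<^bsub>?G\<^esub> \<xi>)"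
      using N.inv_FactGroup N.rcos_inv \<xi> unfolding Ggrp_def by (simp add: carrier_Gtilde)
    then have inv: "inv\<^bsub>Ggrp d n h\<^esub> (?D #>\<^bsub>?G\<^esub> \<xi>) = ?D #>\<^bsub>?G\<^esub> (\<lambda>i\<in>{1..n}. inverse (\<xi> i))"
      by (simp only: Gtilde_inv(1)[OF \<xi>])
    have act: "act n (inv\<^bsub>Ggrp d n h\<^esub> (?D #>\<^bsub>?G\<^esub> \<xi>)) (frob n (line x))
        = line (\<lambda>i\<in>{1..n}. to_ac (inverse (\<xi> i)) * x i ^ CARD('a))" for x
    proof -
      have "act n (?D #>\<^bsub>?G\<^esub> (\<lambda>i\<in>{1..n}. inverse (\<xi> i))) (line (\<lambda>i\<in>{1..n}. x i ^ CARD('a)))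
          = {(\<lambda>i\<in>{1..n}. c * (to_ac ((\<lambda>i\<in>{1..n}. inverse (\<xi> i)) i) * (\<lambda>i\<in>{1..n}. x i ^ CARD('a)) i)) | c. c \<noteq> 0}"
        unfolding line_def using d_ge by (intro act_coset) simp
      also have "\<dots> = line (\<lambda>i\<in>{1..n}. to_ac (inverse (\<xi> i)) * x i ^ CARD('a))"
        unfolding line_def by (simp cong: restrict_cong)
      finally show ?thesis by (simp only: inv frob_line)
    qed
    have "FP (?D #>\<^bsub>?G\<^esub> \<xi>) = {P \<in> diag_hyp d n h lam. \<exists>x. P = line x \<and>
        line (\<lambda>i\<in>{1..n}. to_ac (inverse (\<xi> i)) * x i ^ CARD('a)) = line x}"
    proof (intro equalityI subsetI)
      fix P assume P: "P \<in> FP (?D #>\<^bsub>?G\<^esub> \<xi>)"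
      then have "P \<in> proj_space n" by (simp add: FP_def diag_hyp_def)
      then obtain x where "P = line x" by (rule proj_space_cases)
      then show "P \<in> {P \<in> diag_hyp d n h lam. \<exists>x. P = line x \<and>
          line (\<lambda>i\<in>{1..n}. to_ac (inverse (\<xi> i)) * x i ^ CARD('a)) = line x}"
        using P act[of x] by (auto simp: FP_def)
    next
      fix P assume "P \<in> {P \<in> diag_hyp d n h lam. \<exists>x. P = line x \<and>
          line (\<lambda>i\<in>{1..n}. to_ac (inverse (\<xi> i)) * x i ^ CARD('a)) = line x}"
      then show "P \<in> FP (?D #>\<^bsub>?G\<^esub> \<xi>)" using act by (auto simp: FP_def)
    qed
    then have "of_nat (card (twisted_sols \<xi>)) = (?q - 1) * of_nat (card (FP (?D #>\<^bsub>?G\<^esub> \<xi>)))"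
      using card_twisted_sols[of \<xi>, OF nz] by (simp only: of_nat_mult q(1))
    then show ?thesis using q(2) by (simp add: f_def chi_coset[OF w])
  qed
  have D0: "of_nat (card ?D) \<noteq> (0 :: qbar)"
  proof -
    have "finite ?D" using N.subset by (rule finite_subset) (simp add: carrier_Gtilde sym_tuples_def)
    moreover have "?D \<noteq> {}" using subgroup.one_closed[OF N.is_subgroup] by blast
    ultimately show ?thesis by (simp add: card_eq_0_iff)
  qed
  have "of_nat (card ?D) * of_nat (Coset.order (Ggrp d n h :: (nat \<Rightarrow> 'a) set monoid)) = (of_nat (d ^ (n - 1)) :: qbar)"
    using sum_Ggrp[of "\<lambda>_. 1"] by (simp add: card_sym_tuples Coset.order_def)
  then have order: "1 / of_nat (Coset.order (Ggrp d n h :: (nat \<Rightarrow> 'a) set monoid))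
      = of_nat (card ?D) / (of_nat (d ^ (n - 1)) :: qbar)"
    using D0 by (metis nonzero_divide_mult_cancel_left)
  have "N1 \<phi> d n h lam w = of_nat (card ?D) / of_nat (d ^ (n - 1)) * (\<Sum>A\<in>carrier (Ggrp d n h). f A)"
    unfolding N1_def order f_def FP_def ..
  also have "\<dots> = 1 / of_nat (d ^ (n - 1)) * (\<Sum>\<xi>\<in>sym_tuples. f (?D #>\<^bsub>?G\<^esub> \<xi>))"
    unfolding sum_Ggrp by simp
  also have "(\<Sum>\<xi>\<in>sym_tuples. f (?D #>\<^bsub>?G\<^esub> \<xi>))
      = (\<Sum>\<xi>\<in>sym_tuples. \<phi> (\<Prod>i=1..n. \<xi> i ^ w i) * of_nat (card (twisted_sols \<xi>))) / (?q - 1)"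
    unfolding sum_divide_distrib by (intro sum.cong refl) (simp add: summand)
  finally show ?thesis by simp
qed

end


section \<open>Counting twisted solutions by the d-th powers of their coordinates\<close>

context diag_setup
begin

text \<open>The d-torsion characters, extended to 0 so that the trivial one has value 1 there.\<close>

definition ext_char :: "nat \<Rightarrow> 'a \<Rightarrow> qbar" where
  "ext_char k y = (if y = 0 then (if d dvd k then 1 else 0) else char_pow chi_d k y)"

text \<open>The possible i-th coordinates \<open>(\<xi>\<^sub>i, x\<^sub>i)\<close> of a tuple of roots of unity and a vector twisted by it,
  when the d-th power of \<open>x\<^sub>i\<close> is prescribed.\<close>

definition coord_pairs :: "'a \<Rightarrow> ('a \<times> 'a alg_closure) set" where
  "coord_pairs y = {(z, x). z \<in> mu d \<and> x ^ CARD('a) = to_ac z * x \<and> x ^ d = to_ac y}"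

definition fibre :: "(nat \<Rightarrow> 'a) \<Rightarrow> ((nat \<Rightarrow> 'a) \<times> (nat \<Rightarrow> 'a alg_closure)) set" where
  "fibre y = {(\<xi>, x). \<xi> \<in> mu_tuples \<and> x \<in> twisted_vecs \<xi> \<and> (\<forall>i\<in>{1..n}. x i ^ d = to_ac (y i))}"

lemma d_pos: "d > 0" using d_ge by simp

lemma mult_div_d: "d * ((CARD('a) - 1) div d) = CARD('a) - 1"
  using d_dvd by simp

lemma CARD_eq: "CARD('a) = Suc (CARD('a) - 1)"
  using card_field_ge_2[where 'a = 'a] by simp

lemma power_frobenius_twist:
  fixes x :: "'a alg_closure"
  assumes "x ^ d = to_ac y" "y \<noteq> 0"
  shows "x ^ CARD('a) = to_ac (y ^ ((CARD('a) - 1) div d)) * x"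
proof -
  have "x ^ CARD('a) = x ^ (CARD('a) - 1) * x" by (metis CARD_eq power_Suc2)
  also have "x ^ (CARD('a) - 1) = (x ^ d) ^ ((CARD('a) - 1) div d)"
    unfolding power_mult[symmetric] mult_div_d ..
  finally show ?thesis by (simp add: assms)
qed

lemma coord_pairs_nonzero:
  assumes "y \<noteq> 0"
  shows "coord_pairs y = Pair (y ^ ((CARD('a) - 1) div d)) ` {x. x ^ d = to_ac y}"
proof (intro equalityI subsetI)
  fix p assume "p \<in> coord_pairs y"
  then obtain z x where p: "p = (z, x)" "z \<in> mu d" "x ^ CARD('a) = to_ac z * x" "x ^ d = to_ac y"
    by (auto simp: coord_pairs_def)
  have "x \<noteq> 0" using p(4) assms d_pos by (auto simp: power_0_left)
  then have "to_ac z = to_ac (y ^ ((CARD('a) - 1) div d))"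
    using p(3) power_frobenius_twist[OF p(4) assms] by simp
  then have "z = y ^ ((CARD('a) - 1) div d)" by (simp only: to_ac_eq_iff)
  then show "p \<in> Pair (y ^ ((CARD('a) - 1) div d)) ` {x. x ^ d = to_ac y}" using p by blast
next
  fix p assume "p \<in> Pair (y ^ ((CARD('a) - 1) div d)) ` {x. x ^ d = to_ac y}"
  then obtain x where x: "p = (y ^ ((CARD('a) - 1) div d), x)" "x ^ d = to_ac y" by blast
  have "(y ^ ((CARD('a) - 1) div d)) ^ d = y ^ (CARD('a) - 1)"
    using d_dvd by (simp flip: power_mult)
  also have "\<dots> = 1" by (rule finite_field_power_card_minus_1[OF assms])
  finally have "y ^ ((CARD('a) - 1) div d) \<in> mu d" by (simp add: mu_def)
  then show "p \<in> coord_pairs y"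
    using x power_frobenius_twist[OF x(2) assms] by (simp add: coord_pairs_def)
qed

lemma coord_pairs_0: "coord_pairs 0 = (\<lambda>z. (z, 0)) ` mu d"
  using d_pos by (auto simp: coord_pairs_def)

lemma card_roots_d:
  assumes "y \<noteq> 0"
  shows "card {x. x ^ d = to_ac (y :: 'a)} = d" "finite {x. x ^ d = to_ac (y :: 'a)}"
proof -
  have "to_ac y \<noteq> 0" using assms by simp
  then obtain b where "bij_betw (\<lambda>z. to_ac z * b) (mu d :: 'a set) {x. x ^ d = to_ac y}"
    by (rule card_nth_roots_alg_closure[OF d_dvd])
  then show "card {x. x ^ d = to_ac (y :: 'a)} = d" "finite {x. x ^ d = to_ac (y :: 'a)}"
    using card_mu[OF d_dvd] bij_betw_same_card bij_betw_finite by (metis, metis finite)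
qed

lemma finite_coord_pairs: "finite (coord_pairs y)"
  by (cases "y = 0") (simp_all add: coord_pairs_0 coord_pairs_nonzero card_roots_d)

text \<open>If \<open>y \<noteq> 0\<close>, there are d choices for x, and \<open>\<xi>\<close> is determined by y.  If y = 0, then x = 0 and
  \<open>\<xi>\<close> is free, so the sum runs over all d-th roots of unity.\<close>

lemma sum_coord_pairs: "(\<Sum>p\<in>coord_pairs y. \<phi> (fst p) ^ k) = of_nat d * ext_char k y"
proof (cases "y = 0")
  case True
  have "(\<Sum>p\<in>coord_pairs 0. \<phi> (fst p) ^ k) = (\<Sum>z\<in>mu d. \<phi> z ^ k)"
    unfolding coord_pairs_0 by (subst sum.reindex) (auto simp: inj_on_def)
  then show ?thesis using True by (simp add: sum_over_mu ext_char_def)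
next
  case False
  have "(\<Sum>p\<in>coord_pairs y. \<phi> (fst p) ^ k)
      = (\<Sum>x\<in>{x. x ^ d = to_ac y}. \<phi> (y ^ ((CARD('a) - 1) div d)) ^ k)"
    unfolding coord_pairs_nonzero[OF False] by (subst sum.reindex) (auto simp: inj_on_def)
  then show ?thesis
    using False by (simp add: card_roots_d ext_char_def char_pow_def char_root_eq)
qed

lemma sum_fibre:
  "(\<Sum>p\<in>fibre y. \<phi> (\<Prod>i=1..n. fst p i ^ k i)) = of_nat d ^ n * (\<Prod>i=1..n. ext_char (k i) (y i))"
proof -
  have "(\<Sum>p\<in>fibre y. \<phi> (\<Prod>i=1..n. fst p i ^ k i))
      = (\<Sum>g\<in>PiE {1..n} (\<lambda>i. coord_pairs (y i)). \<Prod>i=1..n. \<phi> (fst (g i)) ^ k i)"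
    unfolding phi_mu_prod
  proof (rule sum.reindex_bij_witness[of _
      "\<lambda>g. (\<lambda>i\<in>{1..n}. fst (g i), \<lambda>i\<in>{1..n}. snd (g i))" "\<lambda>p. \<lambda>i\<in>{1..n}. (fst p i, snd p i)"])
    fix p assume p: "p \<in> fibre y"
    show "(\<lambda>i\<in>{1..n}. fst ((\<lambda>i\<in>{1..n}. (fst p i, snd p i)) i),
        \<lambda>i\<in>{1..n}. snd ((\<lambda>i\<in>{1..n}. (fst p i, snd p i)) i)) = p"
      using p by (auto simp: fibre_def mu_tuples_def twisted_vecs_def fun_eq_iff PiE_def extensional_def)
    show "(\<lambda>i\<in>{1..n}. (fst p i, snd p i)) \<in> PiE {1..n} (\<lambda>i. coord_pairs (y i))"
      using p by (auto simp: fibre_def mu_tuples_def twisted_vecs_def coord_pairs_def PiE_def Pi_def)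
    show "(\<Prod>i=1..n. \<phi> (fst ((\<lambda>i\<in>{1..n}. (fst p i, snd p i)) i)) ^ k i) = (\<Prod>i=1..n. \<phi> (fst p i) ^ k i)"
      by (intro prod.cong refl) simp
  next
    fix g assume g: "g \<in> PiE {1..n} (\<lambda>i. coord_pairs (y i))"
    show "(\<lambda>i\<in>{1..n}. (fst (\<lambda>i\<in>{1..n}. fst (g i), \<lambda>i\<in>{1..n}. snd (g i)) i,
        snd (\<lambda>i\<in>{1..n}. fst (g i), \<lambda>i\<in>{1..n}. snd (g i)) i)) = g"
      using g by (auto simp: fun_eq_iff PiE_def extensional_def)
    have "fst (g i) \<in> mu d \<and> snd (g i) ^ CARD('a) = to_ac (fst (g i)) * snd (g i)
        \<and> snd (g i) ^ d = to_ac (y i)" if "i \<in> {1..n}" for i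
      using PiE_mem[OF g that] by (auto simp: coord_pairs_def)
    then show "(\<lambda>i\<in>{1..n}. fst (g i), \<lambda>i\<in>{1..n}. snd (g i)) \<in> fibre y"
      by (auto simp: fibre_def mu_tuples_def twisted_vecs_def)
  qed
  also have "\<dots> = (\<Prod>i=1..n. \<Sum>p\<in>coord_pairs (y i). \<phi> (fst p) ^ k i)"
    by (rule prod_sum_PiE[symmetric]) (auto simp: finite_coord_pairs)
  also have "\<dots> = of_nat d ^ n * (\<Prod>i=1..n. ext_char (k i) (y i))"
    by (simp add: sum_coord_pairs prod.distrib)
  finally show ?thesis .
qed

lemma sum_by_fibres:
  fixes F :: "(nat \<Rightarrow> 'a) \<Rightarrow> (nat \<Rightarrow> 'a alg_closure) \<Rightarrow> qbar"
  shows "(\<Sum>\<xi>\<in>mu_tuples. \<Sum>x\<in>twisted_vecs \<xi>. F \<xi> x)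
    = (\<Sum>y\<in>{1..n} \<rightarrow>\<^sub>E UNIV. \<Sum>p\<in>fibre y. F (fst p) (snd p))"
proof -
  let ?g = "\<lambda>p :: (nat \<Rightarrow> 'a) \<times> (nat \<Rightarrow> 'a alg_closure). \<lambda>i\<in>{1..n}. of_ac (snd p i ^ d)"
  have fin: "finite (Sigma mu_tuples twisted_vecs)" by (auto simp: finite_twisted_vecs)
  have rng: "x i ^ d \<in> range to_ac" if "\<xi> \<in> mu_tuples" "x \<in> twisted_vecs \<xi>" "i \<in> {1..n}" for \<xi> x i
  proof -
    have "(x i ^ d) ^ CARD('a) = (x i ^ CARD('a)) ^ d" by (simp only: power_mult[symmetric] mult.commute)
    also have "x i ^ CARD('a) = to_ac (\<xi> i) * x i" using that(2,3) by (auto simp: twisted_vecs_def)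
    also have "(to_ac (\<xi> i) * x i) ^ d = to_ac (\<xi> i ^ d) * x i ^ d" by (simp add: power_mult_distrib)
    also have "\<xi> i ^ d = 1" using that(1,3) by (auto simp: mu_tuples_def mu_def PiE_def Pi_def)
    finally show ?thesis by (simp flip: frobenius_fixed_iff)
  qed
  have "(\<Sum>\<xi>\<in>mu_tuples. \<Sum>x\<in>twisted_vecs \<xi>. F \<xi> x) = (\<Sum>p\<in>Sigma mu_tuples twisted_vecs. F (fst p) (snd p))"
    by (subst sum.Sigma) (auto simp: finite_twisted_vecs case_prod_beta)
  also have "\<dots> = (\<Sum>y\<in>{1..n} \<rightarrow>\<^sub>E UNIV. \<Sum>p\<in>{p \<in> Sigma mu_tuples twisted_vecs. ?g p = y}. F (fst p) (snd p))"
    by (rule sum.group[symmetric, OF fin]) auto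
  also have "\<dots> = (\<Sum>y\<in>{1..n} \<rightarrow>\<^sub>E UNIV. \<Sum>p\<in>fibre y. F (fst p) (snd p))"
  proof (rule sum.cong[OF refl])
    fix y :: "nat \<Rightarrow> 'a" assume y: "y \<in> {1..n} \<rightarrow>\<^sub>E UNIV"
    have "{p \<in> Sigma mu_tuples twisted_vecs. ?g p = y} = fibre y"
    proof (intro equalityI subsetI)
      fix p assume p: "p \<in> {p \<in> Sigma mu_tuples twisted_vecs. ?g p = y}"
      have "snd p i ^ d = to_ac (y i)" if i: "i \<in> {1..n}" for i
      proof -
        have "y i = of_ac (snd p i ^ d)" using p i by auto
        then show ?thesis using p i rng[of "fst p" "snd p" i] by (auto simp: to_ac_of_ac)
      qed
      then show "p \<in> fibre y" using p by (auto simp: fibre_def)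
    next
      fix p assume p: "p \<in> fibre y"
      then have "?g p = y" using y by (auto simp: fibre_def fun_eq_iff PiE_def extensional_def)
      then show "p \<in> {p \<in> Sigma mu_tuples twisted_vecs. ?g p = y}" using p by (auto simp: fibre_def)
    qed
    then show "(\<Sum>p\<in>{p \<in> Sigma mu_tuples twisted_vecs. ?g p = y}. F (fst p) (snd p))
        = (\<Sum>p\<in>fibre y. F (fst p) (snd p))" by simp
  qed
  finally show ?thesis .
qed


subsection \<open>Solutions with all coordinates nonzero\<close>

definition full_vec :: "(nat \<Rightarrow> 'b::zero) \<Rightarrow> bool" where
  "full_vec x \<longleftrightarrow> (\<forall>i\<in>{1..n}. x i \<noteq> 0)"

definition mixed_vec :: "(nat \<Rightarrow> 'b::zero) \<Rightarrow> bool" where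
  "mixed_vec x \<longleftrightarrow> (\<exists>i\<in>{1..n}. x i = 0) \<and> (\<exists>i\<in>{1..n}. x i \<noteq> 0)"

lemma card_twisted_sols_split:
  "of_nat (card (twisted_sols \<xi>)) = (\<Sum>x\<in>twisted_vecs \<xi>. if full_vec x \<and> on_hyp x then 1 else 0 :: qbar)
    + (\<Sum>x\<in>twisted_vecs \<xi>. if mixed_vec x \<and> (\<Sum>i=1..n. x i ^ d) = 0 then 1 else 0)"
proof -
  have "of_nat (card (twisted_sols \<xi>)) = (\<Sum>x\<in>twisted_vecs \<xi>. if (\<exists>i\<in>{1..n}. x i \<noteq> 0) \<and> on_hyp x then 1 else 0 :: qbar)"
    unfolding twisted_sols_def by (simp add: sum.If_cases finite_twisted_vecs Int_def)
  also have "\<dots> = (\<Sum>x\<in>twisted_vecs \<xi>. (if full_vec x \<and> on_hyp x then 1 else 0)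
      + (if mixed_vec x \<and> (\<Sum>i=1..n. x i ^ d) = 0 then 1 else 0))"
  proof (rule sum.cong[OF refl])
    fix x :: "nat \<Rightarrow> 'a alg_closure"
    show "(if (\<exists>i\<in>{1..n}. x i \<noteq> 0) \<and> on_hyp x then 1 else 0 :: qbar)
      = (if full_vec x \<and> on_hyp x then 1 else 0) + (if mixed_vec x \<and> (\<Sum>i=1..n. x i ^ d) = 0 then 1 else 0)"
    proof (cases "full_vec x")
      case True
      moreover have "1 \<in> {1..n}" using n_ge by simp
      ultimately show ?thesis by (auto simp: full_vec_def mixed_vec_def)
    next
      case False
      then obtain i where i: "i \<in> {1..n}" "x i = 0" by (auto simp: full_vec_def)
      have "(\<Prod>i=1..n. x i ^ h i) = 0"
        using i h_ge[OF i(1)] by (intro prod_zero bexI[of _ i]) (auto simp: power_0_left)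
      then have "on_hyp x \<longleftrightarrow> (\<Sum>i=1..n. x i ^ d) = 0" by (simp only: on_hyp_def mult_zero_right)
      then show ?thesis using False i by (auto simp: mixed_vec_def)
    qed
  qed
  finally show ?thesis by (simp only: sum.distrib)
qed

text \<open>The vectors with prescribed d-th powers are the products of one of them with all tuples of d-th
  roots of unity.  The equation of the hypersurface prescribes \<open>\<Prod>x\<^sub>i\<^sup>h\<^sup>i\<close>, hence the value of
  \<open>\<Prod>\<xi>\<^sub>i\<^sup>h\<^sup>i\<close>, which is possible only if the d-th powers agree.\<close>

lemma card_roots_on_hyp:
  assumes y: "y \<in> {1..n} \<rightarrow>\<^sub>E UNIV - {0}"
  shows "card {x \<in> {1..n} \<rightarrow>\<^sub>E UNIV. (\<forall>i\<in>{1..n}. x i ^ d = to_ac (y i)) \<and> on_hyp x}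
    = (if ((\<Sum>i=1..n. y i) / (of_nat d * lam)) ^ d = (\<Prod>i=1..n. y i ^ h i) then d ^ (n - 1) else 0)"
proof -
  let ?X = "{x \<in> {1..n} \<rightarrow>\<^sub>E UNIV. \<forall>i\<in>{1..n}. x i ^ d = to_ac (y i)}"
  have y0: "y i \<noteq> 0" if "i \<in> {1..n}" for i using y that by (auto simp: PiE_def Pi_def)
  have "\<exists>b. b ^ d = to_ac (y i) \<and> bij_betw (\<lambda>z. to_ac z * b) (mu d :: 'a set) {x. x ^ d = to_ac (y i)}"
    if "i \<in> {1..n}" for i
  proof -
    have "to_ac (y i) \<noteq> 0" using y0[OF that] by simp
    from card_nth_roots_alg_closure[OF d_dvd this] show ?thesis by metis
  qed
  then obtain b where b: "\<And>i. i \<in> {1..n} \<Longrightarrow> b i ^ d = to_ac (y i)"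
    "\<And>i. i \<in> {1..n} \<Longrightarrow> bij_betw (\<lambda>z. to_ac z * b i) (mu d :: 'a set) {x. x ^ d = to_ac (y i)}"
    by metis
  have b0: "b i \<noteq> 0" if "i \<in> {1..n}" for i
    using b(1)[OF that] y0[OF that] d_pos by (auto simp: power_0_left)
  let ?f = "\<lambda>\<xi>. \<lambda>i\<in>{1..n}. to_ac (\<xi> i) * b i"
  have inj: "inj_on ?f mu_tuples"
  proof (rule inj_onI)
    fix \<xi> \<zeta> assume *: "\<xi> \<in> mu_tuples" "\<zeta> \<in> mu_tuples" "?f \<xi> = ?f \<zeta>"
    have "\<xi> i = \<zeta> i" if "i \<in> {1..n}" for i
      using fun_cong[OF *(3), of i] that b0[OF that] by simp
    then show "\<xi> = \<zeta>" using *(1,2) unfolding mu_tuples_def by (intro PiE_ext) auto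
  qed
  have img: "?f ` mu_tuples = ?X"
  proof (intro equalityI subsetI)
    fix x assume "x \<in> ?f ` mu_tuples"
    then obtain \<xi> where \<xi>: "\<xi> \<in> mu_tuples" "x = ?f \<xi>" by blast
    have "x i ^ d = to_ac (y i)" if "i \<in> {1..n}" for i
      using b(2)[OF that] \<xi> that by (auto simp: bij_betw_def mu_tuples_def PiE_def Pi_def)
    then show "x \<in> ?X" using \<xi>(2) by auto
  next
    fix x assume x: "x \<in> ?X"
    have "\<exists>z\<in>mu d. x i = to_ac z * b i" if "i \<in> {1..n}" for i
    proof -
      have "x i \<in> (\<lambda>z. to_ac z * b i) ` (mu d :: 'a set)"
        using b(2)[OF that] x that by (auto simp: bij_betw_def)
      then show ?thesis by blast
    qed
    then obtain z where z: "\<And>i. i \<in> {1..n} \<Longrightarrow> z i \<in> mu d" "\<And>i. i \<in> {1..n} \<Longrightarrow> x i = to_ac (z i) * b i"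
      by metis
    then have "x = ?f (restrict z {1..n})"
      using x by (auto simp: fun_eq_iff PiE_def extensional_def)
    moreover have "restrict z {1..n} \<in> mu_tuples" using z(1) by (auto simp: mu_tuples_def)
    ultimately show "x \<in> ?f ` mu_tuples" by blast
  qed
  define t where "t = (\<Sum>i=1..n. y i) / (of_nat d * lam)"
  define u where "u = (\<Prod>i=1..n. b i ^ h i)"
  have u0: "u \<noteq> 0" using b0 by (simp add: u_def)
  have ud: "u ^ d = to_ac (\<Prod>i=1..n. y i ^ h i)"
  proof -
    have "u ^ d = (\<Prod>i=1..n. (b i ^ d) ^ h i)"
      unfolding u_def prod_power_distrib by (intro prod.cong refl) (simp only: power_mult[symmetric] mult.commute)
    also have "\<dots> = (\<Prod>i=1..n. to_ac (y i) ^ h i)" by (intro prod.cong refl) (simp only: b(1))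
    finally show ?thesis by (simp add: to_ac_prod)
  qed
  have on: "on_hyp (?f \<xi>) \<longleftrightarrow> to_ac t = to_ac (\<Prod>i=1..n. \<xi> i ^ h i) * u" if "\<xi> \<in> mu_tuples" for \<xi>
  proof -
    have "?f \<xi> \<in> ?X" using img that by blast
    then have "(\<Sum>i=1..n. (?f \<xi>) i ^ d) = to_ac (\<Sum>i=1..n. y i)" by (simp add: to_ac_sum)
    moreover have "(\<Prod>i=1..n. (?f \<xi>) i ^ h i) = to_ac (\<Prod>i=1..n. \<xi> i ^ h i) * u"
      by (simp add: u_def power_mult_distrib prod.distrib to_ac_prod)
    moreover have "of_nat d * lam \<noteq> 0" using d_nz lam_nz by (simp only: mult_eq_0_iff simp_thms)
    then have "(\<Sum>i=1..n. y i) = of_nat d * lam * t"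
      unfolding t_def times_divide_eq_right by (rule nonzero_mult_div_cancel_left[symmetric])
    then have "to_ac (\<Sum>i=1..n. y i) = to_ac (of_nat d * lam) * to_ac t" by (simp only: to_ac_mult)
    moreover have "to_ac (of_nat d * lam) \<noteq> 0"
      using d_nz lam_nz by (simp only: to_ac_eq_0_iff mult_eq_0_iff simp_thms)
    moreover have "of_nat d * to_ac lam = to_ac (of_nat d * lam)" by simp
    ultimately show ?thesis unfolding on_hyp_def by (simp only: mult.assoc mult_cancel_left simp_thms)
  qed
  have "{x \<in> {1..n} \<rightarrow>\<^sub>E UNIV. (\<forall>i\<in>{1..n}. x i ^ d = to_ac (y i)) \<and> on_hyp x} = {x \<in> ?X. on_hyp x}" by blast
  also have "\<dots> = ?f ` {\<xi> \<in> mu_tuples. to_ac t = to_ac (\<Prod>i=1..n. \<xi> i ^ h i) * u}"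
    unfolding img[symmetric] using on by auto
  finally have "card {x \<in> {1..n} \<rightarrow>\<^sub>E UNIV. (\<forall>i\<in>{1..n}. x i ^ d = to_ac (y i)) \<and> on_hyp x}
      = card {\<xi> \<in> mu_tuples. to_ac t = to_ac (\<Prod>i=1..n. \<xi> i ^ h i) * u}"
    using inj by (simp only:) (rule card_image, auto intro: inj_on_subset)
  also have "\<dots> = (if t ^ d = (\<Prod>i=1..n. y i ^ h i) then d ^ (n - 1) else 0)"
  proof (cases "t ^ d = (\<Prod>i=1..n. y i ^ h i)")
    case True
    define v where "v = to_ac t / u"
    have "to_ac t ^ d = u ^ d" using ud True by (simp only: to_ac_power[symmetric])
    then have vd: "v ^ d = 1" using u0 by (simp add: v_def power_divide)
    have "v ^ CARD('a) = v ^ (CARD('a) - 1) * v" by (metis CARD_eq power_Suc2)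
    also have "v ^ (CARD('a) - 1) = (v ^ d) ^ ((CARD('a) - 1) div d)"
      unfolding power_mult[symmetric] mult_div_d ..
    finally have "v \<in> range to_ac" by (simp add: vd flip: frobenius_fixed_iff)
    then obtain z where z: "v = to_ac z" by blast
    have "to_ac (z ^ d) = to_ac 1" using vd z by simp
    then have "z \<in> mu d" unfolding mu_def by (simp only: to_ac_eq_iff mem_Collect_eq)
    moreover have "to_ac t = to_ac (\<Prod>i=1..n. \<xi> i ^ h i) * u \<longleftrightarrow> (\<Prod>i=1..n. \<xi> i ^ h i) = z" for \<xi>
    proof -
      have "to_ac t = to_ac z * u" using z u0 by (simp add: v_def field_simps)
      then have "to_ac t = to_ac (\<Prod>i=1..n. \<xi> i ^ h i) * u \<longleftrightarrow> to_ac z = to_ac (\<Prod>i=1..n. \<xi> i ^ h i)"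
        using u0 by (simp only: mult_cancel_right simp_thms)
      then show ?thesis by (simp only: to_ac_eq_iff eq_commute)
    qed
    ultimately show ?thesis using True card_mu_tuples_fibre by simp
  next
    case False
    have "to_ac t \<noteq> to_ac (\<Prod>i=1..n. \<xi> i ^ h i) * u" if "\<xi> \<in> mu_tuples" for \<xi>
    proof
      assume "to_ac t = to_ac (\<Prod>i=1..n. \<xi> i ^ h i) * u"
      then have "to_ac (t ^ d) = to_ac ((\<Prod>i=1..n. \<xi> i ^ h i) ^ d) * u ^ d"
        by (simp only: to_ac_power power_mult_distrib)
      also have "(\<Prod>i=1..n. \<xi> i ^ h i) ^ d = 1" using mu_prod[OF that, of h] by (simp add: mu_def)
      finally have "to_ac (t ^ d) = to_ac (\<Prod>i=1..n. y i ^ h i)" by (simp only: ud to_ac_1 mult_1)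
      then show False using False by (simp only: to_ac_eq_iff)
    qed
    then have "{\<xi> \<in> mu_tuples. to_ac t = to_ac (\<Prod>i=1..n. \<xi> i ^ h i) * u} = {}" by blast
    then show ?thesis using False by (simp only: card.empty if_False)
  qed
  finally show ?thesis unfolding t_def .
qed

text \<open>If all coordinates are nonzero, the equation itself forces \<open>\<xi>\<^sub>1\<^sup>h\<^sup>1 \<cdots> \<xi>\<^sub>n\<^sup>h\<^sup>n = 1\<close>: both sides of
  \<open>\<Sum>x\<^sub>i\<^sup>d = d\<lambda>\<Prod>x\<^sub>i\<^sup>h\<^sup>i\<close> lie in the ground field.\<close>

lemma full_on_hyp_imp_sym:
  assumes \<xi>: "\<xi> \<in> mu_tuples" and x: "x \<in> twisted_vecs \<xi>" and "full_vec x" "on_hyp x"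
  shows "\<xi> \<in> sym_tuples"
proof -
  let ?u = "\<Prod>i=1..n. x i ^ h i"
  have tw: "x i ^ CARD('a) = to_ac (\<xi> i) * x i" if "i \<in> {1..n}" for i
    using x that by (auto simp: twisted_vecs_def)
  have swap: "(x i ^ k) ^ CARD('a) = (to_ac (\<xi> i) * x i) ^ k" if "i \<in> {1..n}" for i k
    unfolding tw[OF that, symmetric] by (simp only: power_mult[symmetric] mult.commute)
  have u0: "?u \<noteq> 0" using assms(3) by (simp add: full_vec_def)
  have "?u ^ CARD('a) = (\<Prod>i=1..n. (to_ac (\<xi> i) * x i) ^ h i)"
    unfolding prod_power_distrib by (intro prod.cong refl swap)
  also have "\<dots> = to_ac (\<Prod>i=1..n. \<xi> i ^ h i) * ?u"
    by (simp add: power_mult_distrib prod.distrib to_ac_prod)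
  finally have u: "?u ^ CARD('a) = to_ac (\<Prod>i=1..n. \<xi> i ^ h i) * ?u" .
  have "x i ^ d \<in> range to_ac" if i: "i \<in> {1..n}" for i
  proof -
    have "\<xi> i ^ d = 1" using \<xi> i by (auto simp: mu_tuples_def mu_def PiE_def Pi_def)
    then have "(x i ^ d) ^ CARD('a) = x i ^ d"
      unfolding swap[OF i] power_mult_distrib by (simp flip: to_ac_power)
    then show ?thesis by (simp only: frobenius_fixed_iff)
  qed
  then have "\<forall>i\<in>{1..n}. \<exists>s. x i ^ d = to_ac s" by blast
  then obtain s where s: "\<forall>i\<in>{1..n}. x i ^ d = to_ac (s i)" by metis
  then have "(\<Sum>i=1..n. x i ^ d) = to_ac (\<Sum>i=1..n. s i)" by (simp add: to_ac_sum)
  then have "to_ac (of_nat d * lam) * ?u = to_ac (\<Sum>i=1..n. s i)"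
    using assms(4) by (simp add: on_hyp_def)
  then have "?u = to_ac ((\<Sum>i=1..n. s i) / (of_nat d * lam))"
    using d_nz lam_nz by (simp add: field_simps flip: to_ac_of_nat)
  then have "?u \<in> range to_ac" by blast
  then have "?u ^ CARD('a) = ?u" by (simp only: frobenius_fixed_iff)
  then have "to_ac (\<Prod>i=1..n. \<xi> i ^ h i) * ?u = to_ac 1 * ?u" using u by (simp only: to_ac_1 mult_1)
  then have "to_ac (\<Prod>i=1..n. \<xi> i ^ h i) = to_ac 1" using u0 by (simp only: mult_cancel_right simp_thms)
  then have "(\<Prod>i=1..n. \<xi> i ^ h i) = 1" by (simp only: to_ac_eq_iff)
  then show ?thesis using \<xi> by (simp add: sym_tuples_def)
qed

lemma full_part:
  "(\<Sum>\<xi>\<in>sym_tuples. \<phi> (\<Prod>i=1..n. \<xi> i ^ w i) * (\<Sum>x\<in>twisted_vecs \<xi>. if full_vec x \<and> on_hyp x then 1 else 0))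
    = of_nat (d ^ (n - 1)) * (\<Sum>y\<in>{1..n} \<rightarrow>\<^sub>E UNIV - {0}.
        if ((\<Sum>i=1..n. y i) / (of_nat d * lam)) ^ d = (\<Prod>i=1..n. y i ^ h i)
        then \<Prod>i=1..n. char_pow chi_d (w i) (y i) else 0)"
proof -
  let ?I = "\<lambda>x. if full_vec x \<and> on_hyp x then 1 else 0 :: qbar"
  let ?c = "\<lambda>y. ((\<Sum>i=1..n. y i) / (of_nat d * lam)) ^ d = (\<Prod>i=1..n. y i ^ h i)"
  have "(\<Sum>\<xi>\<in>sym_tuples. \<phi> (\<Prod>i=1..n. \<xi> i ^ w i) * (\<Sum>x\<in>twisted_vecs \<xi>. ?I x))
      = (\<Sum>\<xi>\<in>mu_tuples. \<phi> (\<Prod>i=1..n. \<xi> i ^ w i) * (\<Sum>x\<in>twisted_vecs \<xi>. ?I x))"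
  proof (rule sum.mono_neutral_left)
    show "\<forall>\<xi>\<in>mu_tuples - sym_tuples. \<phi> (\<Prod>i=1..n. \<xi> i ^ w i) * (\<Sum>x\<in>twisted_vecs \<xi>. ?I x) = 0"
    proof
      fix \<xi> assume "\<xi> \<in> mu_tuples - sym_tuples"
      then have "(\<Sum>x\<in>twisted_vecs \<xi>. ?I x) = 0"
        using full_on_hyp_imp_sym by (intro sum.neutral ballI) auto
      then show "\<phi> (\<Prod>i=1..n. \<xi> i ^ w i) * (\<Sum>x\<in>twisted_vecs \<xi>. ?I x) = 0" by (simp only: mult_zero_right)
    qed
  qed (auto simp: sym_tuples_def)
  also have "\<dots> = (\<Sum>y\<in>{1..n} \<rightarrow>\<^sub>E UNIV. \<Sum>p\<in>fibre y. \<phi> (\<Prod>i=1..n. fst p i ^ w i) * ?I (snd p))"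
    unfolding sum_distrib_left by (rule sum_by_fibres)
  also have "\<dots> = (\<Sum>y\<in>{1..n} \<rightarrow>\<^sub>E UNIV - {0}. \<Sum>p\<in>fibre y. \<phi> (\<Prod>i=1..n. fst p i ^ w i) * ?I (snd p))"
  proof (rule sum.mono_neutral_right)
    show "\<forall>y\<in>({1..n} \<rightarrow>\<^sub>E UNIV) - ({1..n} \<rightarrow>\<^sub>E UNIV - {0}).
        (\<Sum>p\<in>fibre y. \<phi> (\<Prod>i=1..n. fst p i ^ w i) * ?I (snd p)) = 0"
    proof
      fix y :: "nat \<Rightarrow> 'a" assume "y \<in> ({1..n} \<rightarrow>\<^sub>E UNIV) - ({1..n} \<rightarrow>\<^sub>E UNIV - {0})"
      then obtain i where i: "i \<in> {1..n}" "y i = 0" by (auto simp: PiE_def Pi_def)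
      have "\<not> full_vec (snd p)" if "p \<in> fibre y" for p
      proof -
        have "snd p i ^ d = to_ac (y i)" using that i(1) unfolding fibre_def by auto
        then have "snd p i = 0" using i(2) by simp
        then show ?thesis using i(1) by (auto simp: full_vec_def)
      qed
      then show "(\<Sum>p\<in>fibre y. \<phi> (\<Prod>i=1..n. fst p i ^ w i) * ?I (snd p)) = 0"
        by (intro sum.neutral ballI) auto
    qed
    show "{1..n} \<rightarrow>\<^sub>E UNIV - {0::'a} \<subseteq> {1..n} \<rightarrow>\<^sub>E UNIV" by (rule PiE_mono) simp
  qed simp
  also have "\<dots> = (\<Sum>y\<in>{1..n} \<rightarrow>\<^sub>E UNIV - {0}.
      of_nat (d ^ (n - 1)) * (if ?c y then \<Prod>i=1..n. char_pow chi_d (w i) (y i) else 0))"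
  proof (rule sum.cong[OF refl])
    fix y :: "nat \<Rightarrow> 'a" assume y: "y \<in> {1..n} \<rightarrow>\<^sub>E UNIV - {0}"
    let ?X = "{x \<in> {1..n} \<rightarrow>\<^sub>E UNIV. \<forall>i\<in>{1..n}. x i ^ d = to_ac (y i)}"
    let ?\<xi> = "\<lambda>i\<in>{1..n}. y i ^ ((CARD('a) - 1) div d)"
    have y0: "y i \<noteq> 0" if "i \<in> {1..n}" for i using y that by (auto simp: PiE_def Pi_def)
    have pair: "(z, x) \<in> coord_pairs (y i) \<longleftrightarrow> z = y i ^ ((CARD('a) - 1) div d) \<and> x ^ d = to_ac (y i)"
      if "i \<in> {1..n}" for i z x
      unfolding coord_pairs_nonzero[OF y0[OF that]] by auto
    have fib: "fibre y = Pair ?\<xi> ` ?X"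
    proof (intro equalityI subsetI)
      fix p assume p: "p \<in> fibre y"
      obtain \<xi> x where px: "p = (\<xi>, x)" by (cases p)
      have "(\<xi> i, x i) \<in> coord_pairs (y i)" if "i \<in> {1..n}" for i
        using p that unfolding px by (auto simp: fibre_def coord_pairs_def mu_tuples_def twisted_vecs_def PiE_def Pi_def)
      then have "\<xi> i = y i ^ ((CARD('a) - 1) div d)" if "i \<in> {1..n}" for i using pair that by blast
      then have "\<xi> = ?\<xi>" using p unfolding px
        by (auto simp: fibre_def mu_tuples_def fun_eq_iff PiE_def extensional_def)
      moreover have "x \<in> ?X" using p unfolding px by (auto simp: fibre_def twisted_vecs_def)
      ultimately show "p \<in> Pair ?\<xi> ` ?X" unfolding px by blast
    next
      fix p assume "p \<in> Pair ?\<xi> ` ?X"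
      then obtain x where x: "p = (?\<xi>, x)" "x \<in> ?X" by blast
      have "y i ^ ((CARD('a) - 1) div d) \<in> mu d
          \<and> x i ^ CARD('a) = to_ac (y i ^ ((CARD('a) - 1) div d)) * x i" if i: "i \<in> {1..n}" for i
      proof -
        have "x i ^ d = to_ac (y i)" using x(2) i by blast
        then have "(y i ^ ((CARD('a) - 1) div d), x i) \<in> coord_pairs (y i)" using pair[OF i] by blast
        then show ?thesis unfolding coord_pairs_def by blast
      qed
      then have "?\<xi> \<in> mu_tuples" "x \<in> twisted_vecs ?\<xi>"
        using x(2) by (simp_all add: mu_tuples_def twisted_vecs_def)
      then show "p \<in> fibre y" unfolding x(1) fibre_def using x(2) by blast
    qed
    have phi: "\<phi> (\<Prod>i=1..n. ?\<xi> i ^ w i) = (\<Prod>i=1..n. char_pow chi_d (w i) (y i))"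
      unfolding phi_mu_prod
    proof (rule prod.cong[OF refl])
      fix i assume i: "i \<in> {1..n}"
      show "\<phi> (?\<xi> i) ^ w i = char_pow chi_d (w i) (y i)"
        using i y0[OF i] by (simp add: char_pow_def char_root_eq)
    qed
    have full: "full_vec x" if "x \<in> ?X" for x
    proof -
      have "x i \<noteq> 0" if i: "i \<in> {1..n}" for i
      proof
        assume "x i = 0"
        moreover have "x i ^ d = to_ac (y i)" using \<open>x \<in> ?X\<close> i by blast
        ultimately have "to_ac (y i) = 0" using d_pos by (metis zero_power)
        then show False using y0[OF i] by simp
      qed
      then show ?thesis by (simp add: full_vec_def)
    qed
    have finX: "finite ?X"
    proof -
      have "?X = PiE {1..n} (\<lambda>i. {x. x ^ d = to_ac (y i)})" by (auto simp: PiE_def Pi_def)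
      then show ?thesis by (simp only:) (rule finite_PiE, simp, rule card_roots_d(2)[OF y0])
    qed
    have "(\<Sum>p\<in>fibre y. \<phi> (\<Prod>i=1..n. fst p i ^ w i) * ?I (snd p))
        = (\<Sum>x\<in>?X. \<phi> (\<Prod>i=1..n. ?\<xi> i ^ w i) * ?I x)"
      unfolding fib by (subst sum.reindex) (auto simp: inj_on_def)
    also have "\<dots> = (\<Prod>i=1..n. char_pow chi_d (w i) (y i)) * (\<Sum>x\<in>?X. if on_hyp x then 1 else 0)"
      unfolding sum_distrib_left phi by (intro sum.cong refl) (use full in simp)
    also have "(\<Sum>x\<in>?X. if on_hyp x then 1 else 0 :: qbar)
        = of_nat (card {x \<in> {1..n} \<rightarrow>\<^sub>E UNIV. (\<forall>i\<in>{1..n}. x i ^ d = to_ac (y i)) \<and> on_hyp x})"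
    proof -
      have "{x \<in> ?X. on_hyp x} = {x \<in> {1..n} \<rightarrow>\<^sub>E UNIV. (\<forall>i\<in>{1..n}. x i ^ d = to_ac (y i)) \<and> on_hyp x}" by blast
      then show ?thesis using sum.inter_filter[OF finX, of "\<lambda>_. 1 :: qbar" on_hyp] by simp
    qed
    also have "\<dots> = (if ?c y then of_nat (d ^ (n - 1)) else 0)"
      unfolding card_roots_on_hyp[OF y] by (simp only: if_distrib[of of_nat] of_nat_0)
    also have "(\<Prod>i=1..n. char_pow chi_d (w i) (y i)) * (if ?c y then of_nat (d ^ (n - 1)) else 0)
        = of_nat (d ^ (n - 1)) * (if ?c y then \<Prod>i=1..n. char_pow chi_d (w i) (y i) else 0)"
      by (simp only: if_distrib[of "\<lambda>x. _ * x"] mult_zero_right mult_zero_left mult.commute)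
    finally show "(\<Sum>p\<in>fibre y. \<phi> (\<Prod>i=1..n. fst p i ^ w i) * ?I (snd p))
        = of_nat (d ^ (n - 1)) * (if ?c y then \<Prod>i=1..n. char_pow chi_d (w i) (y i) else 0)" .
  qed
  finally show ?thesis by (simp only: sum_distrib_left)
qed

end


section \<open>Solutions with some vanishing coordinates\<close>

context diag_setup
begin

definition zero_sum :: "(nat \<Rightarrow> nat) \<Rightarrow> qbar" where
  "zero_sum k = (\<Sum>y\<in>{y \<in> {1..n} \<rightarrow>\<^sub>E UNIV. mixed_vec y \<and> (\<Sum>i=1..n. y i) = 0}.
     \<Prod>i=1..n. ext_char (k i) (y i))"

lemma ext_char_mod: "ext_char (k mod d) y = ext_char k y"
  by (simp add: ext_char_def char_pow_chi_d_mod dvd_mod_iff)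

text \<open>When some coordinate vanishes, the equation is \<open>\<Sum>x\<^sub>i\<^sup>d = 0\<close>, which depends only on the d-th powers
  of the coordinates.  The twist \<open>\<xi>\<close> is no longer determined by x, so the condition
  \<open>\<Prod>\<xi>\<^sub>i\<^sup>h\<^sup>i = 1\<close> is expressed by orthogonality, as an average over the shifts \<open>w + mh\<close>.\<close>

lemma zero_part:
  "(\<Sum>\<xi>\<in>sym_tuples. \<phi> (\<Prod>i=1..n. \<xi> i ^ w i)
      * (\<Sum>x\<in>twisted_vecs \<xi>. if mixed_vec x \<and> (\<Sum>i=1..n. x i ^ d) = 0 then 1 else 0))
    = of_nat (d ^ (n - 1)) * (\<Sum>m<d. zero_sum (\<lambda>i\<in>{1..n}. (w i + m * h i) mod d))"
proof -
  let ?I = "\<lambda>x :: nat \<Rightarrow> 'a alg_closure. if mixed_vec x \<and> (\<Sum>i=1..n. x i ^ d) = 0 then 1 else 0 :: qbar"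
  let ?J = "\<lambda>y :: nat \<Rightarrow> 'a. mixed_vec y \<and> (\<Sum>i=1..n. y i) = 0"
  have inner: "(\<Sum>\<xi>\<in>mu_tuples. \<phi> (\<Prod>i=1..n. \<xi> i ^ k i) * (\<Sum>x\<in>twisted_vecs \<xi>. ?I x))
      = of_nat d ^ n * zero_sum k" for k
  proof -
    have "(\<Sum>\<xi>\<in>mu_tuples. \<phi> (\<Prod>i=1..n. \<xi> i ^ k i) * (\<Sum>x\<in>twisted_vecs \<xi>. ?I x))
        = (\<Sum>y\<in>{1..n} \<rightarrow>\<^sub>E UNIV. \<Sum>p\<in>fibre y. \<phi> (\<Prod>i=1..n. fst p i ^ k i) * ?I (snd p))"
      unfolding sum_distrib_left by (rule sum_by_fibres)
    also have "\<dots> = (\<Sum>y\<in>{1..n} \<rightarrow>\<^sub>E UNIV. if ?J y then of_nat d ^ n * (\<Prod>i=1..n. ext_char (k i) (y i)) else 0)"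
    proof (rule sum.cong[OF refl])
      fix y :: "nat \<Rightarrow> 'a"
      have "?I (snd p) = (if ?J y then 1 else 0)" if "p \<in> fibre y" for p
      proof -
        have x: "snd p i ^ d = to_ac (y i)" if "i \<in> {1..n}" for i
          using that \<open>p \<in> fibre y\<close> unfolding fibre_def by auto
        have "snd p i = 0 \<longleftrightarrow> y i = 0" if "i \<in> {1..n}" for i
        proof -
          have "snd p i = 0 \<longleftrightarrow> snd p i ^ d = 0" using d_pos by simp
          then show ?thesis by (simp only: x[OF that] to_ac_eq_0_iff)
        qed
        then have "mixed_vec (snd p) \<longleftrightarrow> mixed_vec y" unfolding mixed_vec_def by blast
        moreover have "(\<Sum>i=1..n. snd p i ^ d) = to_ac (\<Sum>i=1..n. y i)"
          unfolding to_ac_sum by (intro sum.cong refl x)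
        ultimately show ?thesis by (simp only: to_ac_eq_0_iff)
      qed
      then have "(\<Sum>p\<in>fibre y. \<phi> (\<Prod>i=1..n. fst p i ^ k i) * ?I (snd p))
          = (\<Sum>p\<in>fibre y. \<phi> (\<Prod>i=1..n. fst p i ^ k i) * (if ?J y then 1 else 0))"
        by (intro sum.cong refl arg_cong2[where f = "(*)"])
      also have "\<dots> = (\<Sum>p\<in>fibre y. \<phi> (\<Prod>i=1..n. fst p i ^ k i)) * (if ?J y then 1 else 0)"
        by (rule sum_distrib_right[symmetric])
      also have "\<dots> = (if ?J y then of_nat d ^ n * (\<Prod>i=1..n. ext_char (k i) (y i)) else 0)"
        by (simp only: sum_fibre if_distrib[of "(*) _"] mult_1_right mult_zero_right)
      finally show "(\<Sum>p\<in>fibre y. \<phi> (\<Prod>i=1..n. fst p i ^ k i) * ?I (snd p))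
          = (if ?J y then of_nat d ^ n * (\<Prod>i=1..n. ext_char (k i) (y i)) else 0)" .
    qed
    also have "\<dots> = (\<Sum>y\<in>{y \<in> {1..n} \<rightarrow>\<^sub>E UNIV. ?J y}. of_nat d ^ n * (\<Prod>i=1..n. ext_char (k i) (y i)))"
      by (rule sum.inter_filter[symmetric]) simp
    finally show ?thesis by (simp only: zero_sum_def sum_distrib_left)
  qed
  have md: "zero_sum (\<lambda>i\<in>{1..n}. k i mod d) = zero_sum k" for k
    unfolding zero_sum_def by (intro sum.cong refl prod.cong) (simp add: ext_char_mod)
  obtain n' where n': "n = Suc n'" using n_ge by (cases n) auto
  have "(\<Sum>\<xi>\<in>sym_tuples. \<phi> (\<Prod>i=1..n. \<xi> i ^ w i) * (\<Sum>x\<in>twisted_vecs \<xi>. ?I x))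
      = 1 / of_nat d * (\<Sum>m<d. of_nat d ^ n * zero_sum (\<lambda>i. w i + m * h i))"
    by (simp only: sum_sym_tuples inner)
  also have "\<dots> = of_nat (d ^ (n - 1)) * (\<Sum>m<d. zero_sum (\<lambda>i. w i + m * h i))"
    using of_nat_d_nz by (simp add: n' flip: sum_distrib_left)
  finally show ?thesis by (simp only: md)
qed

lemma prod_chars_triv:
  assumes "d dvd (\<Sum>i=1..n. k i)"
  shows "(\<lambda>x. \<Prod>i=1..n. char_pow chi_d (k i) x) = triv_char"
proof
  fix x
  show "(\<Prod>i=1..n. char_pow chi_d (k i) x) = triv_char x"
  proof (cases "x = 0")
    case True
    have "(\<Prod>i=1..n. char_pow chi_d (k i) x) = 0"
      using n_ge True by (intro prod_zero bexI[of _ 1]) (auto simp: char_pow_def)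
    then show ?thesis using True by (simp add: triv_char_def)
  next
    case False
    have "(\<Prod>i=1..n. char_pow chi_d (k i) x) = char_pow chi_d (\<Sum>i=1..n. k i) x"
      using False by (simp add: char_pow_def power_sum)
    also have "char_pow chi_d (\<Sum>i=1..n. k i) = triv_char" using assms by (simp only: char_pow_chi_d_eq_triv_iff)
    finally show ?thesis .
  qed
qed

definition hyperplane_sum :: "(nat \<Rightarrow> nat) \<Rightarrow> qbar" where
  "hyperplane_sum k = (\<Sum>y\<in>{y \<in> {1..n} \<rightarrow>\<^sub>E UNIV. (\<Sum>i=1..n. y i) = 0}. \<Prod>i=1..n. ext_char (k i) (y i))"

text \<open>A vector has all coordinates nonzero, or all zero, or is mixed.\<close>

lemma hyperplane_sum_split:
  "hyperplane_sum k = level_sum n (\<lambda>i. char_pow chi_d (k i)) 0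
    + (if \<forall>i\<in>{1..n}. d dvd k i then 1 else 0) + zero_sum k"
proof -
  let ?f = "\<lambda>y. \<Prod>i=1..n. ext_char (k i) (y i)"
  let ?A = "{y \<in> {1..n} \<rightarrow>\<^sub>E UNIV - {0::'a}. (\<Sum>i=1..n. y i) = 0}"
  let ?Z = "\<lambda>i\<in>{1..n}. 0::'a"
  let ?C = "{y \<in> {1..n} \<rightarrow>\<^sub>E (UNIV :: 'a set). mixed_vec y \<and> (\<Sum>i=1..n. y i) = 0}"
  have one: "1 \<in> {1..n}" using n_ge by simp
  have "{y \<in> {1..n} \<rightarrow>\<^sub>E (UNIV :: 'a set). (\<Sum>i=1..n. y i) = 0} = (?A \<union> {?Z}) \<union> ?C"
  proof (intro equalityI subsetI)
    fix y :: "nat \<Rightarrow> 'a" assume y: "y \<in> {y \<in> {1..n} \<rightarrow>\<^sub>E UNIV. (\<Sum>i=1..n. y i) = 0}"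
    show "y \<in> (?A \<union> {?Z}) \<union> ?C"
    proof (cases "mixed_vec y")
      case False
      then have "(\<forall>i\<in>{1..n}. y i \<noteq> 0) \<or> (\<forall>i\<in>{1..n}. y i = 0)" by (auto simp: mixed_vec_def)
      then show ?thesis
      proof
        assume "\<forall>i\<in>{1..n}. y i \<noteq> 0"
        then show ?thesis using y by (auto simp: PiE_def Pi_def)
      next
        assume "\<forall>i\<in>{1..n}. y i = 0"
        then have "y = ?Z" using y by (auto simp: fun_eq_iff PiE_def extensional_def)
        then show ?thesis by blast
      qed
    qed (use y in blast)
  next
    fix y assume "y \<in> (?A \<union> {?Z}) \<union> ?C"
    then show "y \<in> {y \<in> {1..n} \<rightarrow>\<^sub>E UNIV. (\<Sum>i=1..n. y i) = 0}" by (auto simp: PiE_def Pi_def)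
  qed
  moreover have "(?A \<union> {?Z}) \<inter> ?C = {}" by (auto simp: mixed_vec_def PiE_def Pi_def)
  moreover have "?A \<inter> {?Z} = {}" using one by (auto simp: PiE_def Pi_def)
  moreover have "finite ?A" "finite ?C" by simp_all
  ultimately have "hyperplane_sum k = sum ?f ?A + ?f ?Z + sum ?f ?C"
    unfolding hyperplane_sum_def by (simp only:) (subst sum.union_disjoint, simp_all add: sum.union_disjoint)
  moreover have "sum ?f ?A = level_sum n (\<lambda>i. char_pow chi_d (k i)) 0"
    unfolding level_sum_def
    by (intro sum.cong refl prod.cong) (auto simp: ext_char_def PiE_def Pi_def)
  moreover have "?f ?Z = (if \<forall>i\<in>{1..n}. d dvd k i then 1 else 0)"
  proof (cases "\<forall>i\<in>{1..n}. d dvd k i")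
    case False
    then obtain i where "i \<in> {1..n}" "\<not> d dvd k i" by blast
    then have "?f ?Z = 0" by (intro prod_zero bexI[of _ i]) (simp_all add: ext_char_def)
    then show ?thesis unfolding if_not_P[OF False] .
  qed (simp add: ext_char_def)
  ultimately show ?thesis by (simp only: zero_sum_def)
qed

lemma zero_sum_no_zero:
  assumes "\<forall>i\<in>{1..n}. \<not> d dvd k i"
  shows "zero_sum k = 0"
  unfolding zero_sum_def
proof (intro sum.neutral ballI)
  fix y :: "nat \<Rightarrow> 'a" assume "y \<in> {y \<in> {1..n} \<rightarrow>\<^sub>E UNIV. mixed_vec y \<and> (\<Sum>i=1..n. y i) = 0}"
  then obtain i where "i \<in> {1..n}" "y i = 0" by (auto simp: mixed_vec_def)
  then show "(\<Prod>i=1..n. ext_char (k i) (y i)) = 0"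
    using assms by (intro prod_zero bexI[of _ i]) (auto simp: ext_char_def)
qed

text \<open>Multiply the coordinate with nontrivial character by a, and restore the sum with the coordinate
  whose character is trivial: the hyperplane sum is multiplied by a value different from 1.\<close>

lemma hyperplane_sum_mixed:
  assumes i: "i \<in> {1..n}" "d dvd k i" and j: "j \<in> {1..n}" "\<not> d dvd k j"
  shows "hyperplane_sum k = 0"
proof -
  have ij: "i \<noteq> j" using i j by auto
  have "char_pow chi_d (k j) \<noteq> triv_char" using j by (simp add: char_pow_chi_d_eq_triv_iff)
  then obtain a where a: "char_pow chi_d (k j) a \<noteq> triv_char a" by (auto simp: fun_eq_iff)
  then have a0: "a \<noteq> 0" by (auto simp: char_pow_def triv_char_def)
  have a1: "char_pow chi_d (k j) a \<noteq> 1" using a a0 by (simp add: triv_char_def)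
  let ?H = "{y \<in> {1..n} \<rightarrow>\<^sub>E (UNIV :: 'a set). (\<Sum>i=1..n. y i) = 0}"
  let ?f = "\<lambda>y. \<Prod>i=1..n. ext_char (k i) (y i)"
  let ?T = "\<lambda>b y. y(j := b * y j, i := y i + (1 - b) * y j)"
  have split: "(\<Sum>l=1..n. y l) = y i + (y j + (\<Sum>l\<in>{1..n} - {i} - {j}. y l))" for y :: "nat \<Rightarrow> 'a"
    using i(1) j(1) ij by (simp add: sum.remove[of _ i] sum.remove[of _ j])
  have psplit: "(\<Prod>l=1..n. ext_char (k l) (y l))
      = ext_char (k i) (y i) * (ext_char (k j) (y j) * (\<Prod>l\<in>{1..n} - {i} - {j}. ext_char (k l) (y l)))" for y
    using i(1) j(1) ij by (simp add: prod.remove[of _ i] prod.remove[of _ j])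
  have memT: "?T b y \<in> ?H" if "y \<in> ?H" for b y
  proof -
    have "(\<Sum>l\<in>{1..n} - {i} - {j}. ?T b y l) = (\<Sum>l\<in>{1..n} - {i} - {j}. y l)"
      by (intro sum.cong refl) auto
    then have "(\<Sum>l=1..n. ?T b y l) = (\<Sum>l=1..n. y l)"
      unfolding split using ij by (simp add: algebra_simps)
    then show ?thesis using that i(1) j(1) by (auto simp: PiE_def extensional_def)
  qed
  have inv: "?T (inverse b) (?T b y) = y" if "b \<noteq> 0" for b :: 'a and y
    using ij that by (auto simp: fun_eq_iff left_diff_distrib mult.assoc[symmetric])
  have "hyperplane_sum k = (\<Sum>y\<in>?H. ?f (?T a y))"
    unfolding hyperplane_sum_def
    by (rule sum.reindex_bij_witness[of _ "?T a" "?T (inverse a)"])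
       (use a0 inv[of a] inv[of "inverse a"] memT in \<open>simp_all\<close>)
  also have "\<dots> = (\<Sum>y\<in>?H. char_pow chi_d (k j) a * ?f y)"
  proof (rule sum.cong[OF refl])
    fix y assume "y \<in> ?H"
    have "ext_char (k i) z = 1" for z
    proof -
      have "char_pow chi_d (k i) = triv_char" using i(2) by (simp only: char_pow_chi_d_eq_triv_iff)
      then show ?thesis using i(2) by (simp add: ext_char_def triv_char_def)
    qed
    moreover have "ext_char (k j) (a * y j) = char_pow chi_d (k j) a * ext_char (k j) (y j)"
      using a0 j(2) by (simp add: ext_char_def mult_char_mult)
    moreover have "(\<Prod>l\<in>{1..n} - {i} - {j}. ext_char (k l) (?T a y l)) = (\<Prod>l\<in>{1..n} - {i} - {j}. ext_char (k l) (y l))"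
      by (intro prod.cong refl) auto
    ultimately show "?f (?T a y) = char_pow chi_d (k j) a * ?f y"
      unfolding psplit using ij by (simp add: mult.assoc)
  qed
  also have "\<dots> = char_pow chi_d (k j) a * hyperplane_sum k"
    unfolding hyperplane_sum_def by (rule sum_distrib_left[symmetric])
  finally show ?thesis using a1 by simp
qed

lemma hyperplane_sum_all_zero:
  assumes "\<forall>i\<in>{1..n}. d dvd k i"
  shows "hyperplane_sum k = of_nat CARD('a) ^ (n - 1)"
proof -
  let ?q = "of_nat CARD('a) :: qbar"
  let ?H = "{y \<in> {1..n} \<rightarrow>\<^sub>E (UNIV :: 'a set). (\<Sum>i=1..n. y i) = 0}"
  obtain n' where n': "n = Suc n'" using n_ge by (cases n) auto
  have q0: "?q \<noteq> 0" using card_field_ge_2[where 'a = 'a] by simp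
  have "ext_char (k i) z = 1" if "i \<in> {1..n}" for i z
  proof -
    have "char_pow chi_d (k i) = triv_char" using assms that by (simp only: char_pow_chi_d_eq_triv_iff)
    then show ?thesis using assms that by (simp add: ext_char_def triv_char_def)
  qed
  then have "hyperplane_sum k = (\<Sum>y\<in>?H. 1)"
    unfolding hyperplane_sum_def by (intro sum.cong refl prod.neutral ballI)
  then have "?q * hyperplane_sum k = (\<Sum>y\<in>?H. ?q)" by simp
  also have "\<dots> = (\<Sum>y\<in>{1..n} \<rightarrow>\<^sub>E UNIV. if (\<Sum>i=1..n. y i) = (0::'a) then ?q else 0)"
    by (rule sum.inter_filter) simp
  also have "\<dots> = (\<Sum>y\<in>{1..n} \<rightarrow>\<^sub>E UNIV. \<Sum>c\<in>UNIV. \<psi> ((\<Sum>i=1..n. y i) * c))"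
    by (simp only: sum_psi)
  also have "\<dots> = (\<Sum>c\<in>UNIV. \<Sum>y\<in>{1..n} \<rightarrow>\<^sub>E UNIV. \<Prod>i=1..n. \<psi> (c * y i))"
  proof -
    have "\<psi> ((\<Sum>i=1..n. y i) * c) = (\<Prod>i=1..n. \<psi> (c * y i))" for y c
      unfolding sum_distrib_right psi_sum by (simp only: mult.commute)
    then show ?thesis by (simp only:) (rule sum.swap)
  qed
  also have "\<dots> = (\<Sum>c\<in>UNIV. \<Prod>i=1..n. \<Sum>z\<in>UNIV. \<psi> (c * z))"
    by (intro sum.cong refl prod_sum_PiE[symmetric]) auto
  also have "\<dots> = (\<Sum>c\<in>UNIV. if c = (0::'a) then ?q ^ n else 0)"
    by (intro sum.cong refl) (simp add: sum_psi n')
  also have "\<dots> = ?q * ?q ^ (n - 1)" by (simp add: n')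
  finally show ?thesis using q0 by simp
qed

lemma jacobi_w_eq: "jacobi_w \<phi> d n k = jacobi_sum n (\<lambda>i. char_pow chi_d (k i))"
  by (simp add: jacobi_w_def)

lemma neg_one_power_cancel: "(-1) ^ m * ((-1) ^ m * z) = (z :: qbar)"
  by (simp flip: mult.assoc power_mult_distrib)

lemma level_sum_eq_jacobi: "level_sum n \<eta> 1 = (-1) ^ (n - 1) * jacobi_sum n \<eta>"
  by (simp only: jacobi_sum_eq_level_sum neg_one_power_cancel)

lemma zero_sum_mixed:
  assumes i: "i \<in> {1..n}" "d dvd k i" and j: "j \<in> {1..n}" "\<not> d dvd k j"
    and k: "d dvd (\<Sum>i=1..n. k i)"
  shows "zero_sum k = (of_nat CARD('a) - 1) * ((-1) ^ (n - 1) * jacobi_w \<phi> d n k)"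
proof -
  have n1: "n \<ge> 1" using n_ge by simp
  have nt: "\<not> (\<forall>i\<in>{1..n}. char_pow chi_d (k i) = triv_char)"
    using j by (auto simp: char_pow_chi_d_eq_triv_iff)
  have nt': "\<not> (\<forall>i\<in>{1..n}. d dvd k i)" using j by blast
  have L0: "level_sum n (\<lambda>i. char_pow chi_d (k i)) 0
      = - ((of_nat CARD('a) - 1) * level_sum n (\<lambda>i. char_pow chi_d (k i)) 1)"
    using level_sum_0[OF n1 _ prod_chars_triv[OF k]] unfolding if_not_P[OF nt] by simp
  have "0 = level_sum n (\<lambda>i. char_pow chi_d (k i)) 0 + 0 + zero_sum k"
    using hyperplane_sum_split[of k] unfolding if_not_P[OF nt'] hyperplane_sum_mixed[OF i j] .
  then have "level_sum n (\<lambda>i. char_pow chi_d (k i)) 0 + zero_sum k = 0" by simp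
  then have "zero_sum k = - level_sum n (\<lambda>i. char_pow chi_d (k i)) 0" by (rule add_eq_0_iff[THEN iffD1])
  then have "zero_sum k = (of_nat CARD('a) - 1) * level_sum n (\<lambda>i. char_pow chi_d (k i)) 1"
    unfolding L0 by simp
  then show ?thesis by (simp only: level_sum_eq_jacobi jacobi_w_eq)
qed

lemma zero_sum_all_zero:
  assumes k: "\<forall>i\<in>{1..n}. d dvd k i"
  shows "zero_sum k / (of_nat CARD('a) - 1)
    = (1 - of_nat CARD('a) ^ (n - 1)) / (1 - of_nat CARD('a)) + (-1) ^ (n - 1) / of_nat CARD('a)
      - (of_nat CARD('a) - 1) ^ (n - 1) / of_nat CARD('a)"
proof -
  let ?q = "of_nat CARD('a) :: qbar"
  let ?L = "level_sum n (\<lambda>i. char_pow chi_d (k i))"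
  have n1: "n \<ge> 1" using n_ge by simp
  obtain n' where n': "n = Suc n'" using n_ge by (cases n) auto
  have q0: "?q \<noteq> 0" using card_field_ge_2[where 'a = 'a] by simp
  have q1: "?q - 1 \<noteq> 0" using card_field_ge_2[where 'a = 'a] by simp
  have t: "char_pow chi_d (k i) = triv_char" if "i \<in> {1..n}" for i
    using k that by (simp only: char_pow_chi_d_eq_triv_iff)
  then have t': "\<forall>i\<in>{1..n}. char_pow chi_d (k i) = triv_char" by blast
  have P: "(\<lambda>x. \<Prod>i=1..n. char_pow chi_d (k i) x) = triv_char"
    by (rule prod_chars_triv) (use k in \<open>auto intro: dvd_sum\<close>)
  have L0: "?L 0 = (?q - 1) ^ n - (?q - 1) * ?L 1"
    using level_sum_0[OF n1 _ P] unfolding if_P[OF t'] by simp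
  have "jacobi_sum n (\<lambda>i. char_pow chi_d (k i)) = 1 / ?q - (1 - ?q) ^ n / ?q"
  proof -
    have "(\<Prod>i=1..n. gauss_sum \<psi> (char_pow chi_d (k i))) = 1"
      by (intro prod.neutral ballI) (simp only: t gauss_sum_triv)
    then show ?thesis
      using jacobi_sum_eq_gauss_sums[OF n1, of "\<lambda>i. char_pow chi_d (k i)"]
      unfolding if_P[OF t'] P gauss_sum0_triv gauss_sum_triv by simp
  qed
  then have L1: "?L 1 = (-1) ^ n' * (1 / ?q - (1 - ?q) ^ n / ?q)"
    unfolding level_sum_eq_jacobi by (simp add: n')
  have "(1 - ?q) ^ n = ((-1) * (?q - 1)) ^ n" by simp
  then have pw: "(1 - ?q) ^ n = - ((-1) ^ n' * ((?q - 1) * (?q - 1) ^ n'))"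
    unfolding power_mult_distrib by (simp add: n')
  have L1': "?L 1 = (-1) ^ n' / ?q + (?q - 1) * (?q - 1) ^ n' / ?q"
    unfolding L1 pw using q0 by (simp add: field_simps flip: mult.assoc power_mult_distrib)
  have "?q ^ (n - 1) = ?L 0 + 1 + zero_sum k"
    using hyperplane_sum_split[of k] unfolding if_P[OF k] hyperplane_sum_all_zero[OF k] .
  then have Z: "zero_sum k = ?q ^ n' - 1 - ?L 0" by (simp add: n')
  have alg: "(Q - 1 - ((q - 1) * R - (q - 1) * (S / q + (q - 1) * R / q))) / (q - 1)
      = (1 - Q) / (1 - q) + S / q - R / q" if "q \<noteq> 0" "q - 1 \<noteq> 0" for q Q R S :: qbar
  proof -
    have "1 - q \<noteq> 0" using that(2) by simp
    then have e: "(1 - Q) / (1 - q) = (Q - 1) / (q - 1)"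
      using that by (simp add: divide_simps) (simp add: algebra_simps)
    have f: "(Q - 1 - ((q - 1) * R - (q - 1) * V)) / (q - 1) = (Q - 1) / (q - 1) - (R - V)" for V
      using that(2) by (simp add: diff_divide_distrib flip: right_diff_distrib)
    have "(q - 1) * R / q = R - R / q" using that(1) by (simp add: field_simps)
    then show ?thesis unfolding e f by simp
  qed
  show ?thesis
    unfolding Z L0 L1' using alg[OF q0 q1, of "?q ^ n'" "(?q - 1) ^ n'" "(-1) ^ n'"] by (simp add: n')
qed


section \<open>The class of characters equivalent to a given one\<close>

definition shift_vec :: "(nat \<Rightarrow> nat) \<Rightarrow> nat \<Rightarrow> nat \<Rightarrow> nat" where
  "shift_vec w m = (\<lambda>i\<in>{1..n}. (w i + m * h i) mod d)"

lemma sum_shift_vec: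
  assumes "d dvd (\<Sum>i=1..n. w i)"
  shows "d dvd (\<Sum>i=1..n. shift_vec w m i)"
proof -
  have "(\<Sum>i=1..n. w i + m * h i) = (\<Sum>i=1..n. w i) + m * d"
    by (simp only: sum.distrib h_sum sum_distrib_left[symmetric])
  then have "d dvd (\<Sum>i=1..n. w i + m * h i)" using assms by simp
  moreover have "(\<Sum>i=1..n. shift_vec w m i) mod d = (\<Sum>i=1..n. w i + m * h i) mod d"
    by (simp add: shift_vec_def mod_sum_eq)
  ultimately show ?thesis by (simp add: dvd_eq_mod_eq_0)
qed

lemma Wset_dvd: "w \<in> Wset d n \<Longrightarrow> d dvd (\<Sum>i=1..n. w i)"
  by (auto simp: Wset_def)

lemma Wset_less: "w \<in> Wset d n \<Longrightarrow> i \<in> {1..n} \<Longrightarrow> w i < d"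
  by (auto simp: Wset_def PiE_def Pi_def)

lemma shift_vec_in_Wset: "w \<in> Wset d n \<Longrightarrow> shift_vec w m \<in> Wset d n"
  using sum_shift_vec[OF Wset_dvd, of w m] d_pos by (auto simp: Wset_def shift_vec_def)

lemma inj_on_shift_vec: "inj_on (shift_vec w) {..<d}"
proof (rule linorder_inj_onI')
  fix a b assume ab: "a \<in> {..<d}" "b \<in> {..<d}" "a < b"
  show "shift_vec w a \<noteq> shift_vec w b"
  proof
    assume eq: "shift_vec w a = shift_vec w b"
    have "d dvd (b - a) * h i" if "i \<in> {1..n}" for i
    proof -
      have "(w i + b * h i) mod d = (w i + a * h i) mod d"
        using fun_cong[OF eq, of i] that by (simp add: shift_vec_def)
      then have "d dvd (w i + b * h i) - (w i + a * h i)" by (rule mod_eq_dvd_iff_nat[THEN iffD1, rotated]) (use ab in simp)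
      then show ?thesis by (simp add: diff_mult_distrib)
    qed
    then have "d dvd b - a" by (rule d_dvd_if_dvd_mult_h)
    then show False using ab by (auto dest: dvd_imp_le)
  qed
qed

lemma prod_power_mod_exponents:
  assumes "\<xi> \<in> mu_tuples" "\<And>i. i \<in> {1..n} \<Longrightarrow> k i mod d = l i mod d"
  shows "(\<Prod>i=1..n. \<xi> i ^ k i) = (\<Prod>i=1..n. \<xi> i ^ l i)"
proof (rule prod.cong[OF refl])
  fix i assume i: "i \<in> {1..n}"
  have "\<xi> i ^ d = 1" using assms(1) i by (auto simp: mu_tuples_def mu_def PiE_def Pi_def)
  then show "\<xi> i ^ k i = \<xi> i ^ l i" using assms(2)[OF i] by (metis power_mod_order)
qed

lemma char_sim_iff:
  assumes "w' \<in> Wset d n" "w \<in> Wset d n"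
  shows "char_sim \<phi> d n h w' w \<longleftrightarrow>
    (\<forall>\<xi>\<in>sym_tuples. \<phi> (\<Prod>i=1..n. \<xi> i ^ w' i) = \<phi> (\<Prod>i=1..n. \<xi> i ^ w i))"
proof -
  have "carrier (Ggrp d n h) = (\<lambda>\<xi>. Delta d n #>\<^bsub>Gtilde d n h\<^esub> \<xi>) ` (sym_tuples :: (nat \<Rightarrow> 'a) set)"
    by (auto simp: Ggrp_def FactGroup_def RCOSETS_def carrier_Gtilde)
  then show ?thesis unfolding char_sim_def by (simp add: chi_coset[OF assms(1)] chi_coset[OF assms(2)])
qed

text \<open>If two characters agree on the symmetry group, the average of their quotient over it is nonzero,
  and orthogonality on all tuples of roots of unity exhibits the multiple of h by which they differ.\<close>

lemma char_sim_class:
  assumes w: "w \<in> Wset d n"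
  shows "{w' \<in> Wset d n. char_sim \<phi> d n h w' w} = shift_vec w ` {..<d}"
proof (intro equalityI subsetI)
  fix w' assume "w' \<in> shift_vec w ` {..<d}"
  then obtain m where m: "w' = shift_vec w m" by blast
  have w': "w' \<in> Wset d n" unfolding m by (rule shift_vec_in_Wset[OF w])
  have "(\<Prod>i=1..n. \<xi> i ^ w' i) = (\<Prod>i=1..n. \<xi> i ^ w i)" if \<xi>: "\<xi> \<in> sym_tuples" for \<xi>
  proof -
    have "(\<Prod>i=1..n. \<xi> i ^ w' i) = (\<Prod>i=1..n. \<xi> i ^ (w i + m * h i))"
      using \<xi> by (intro prod_power_mod_exponents) (auto simp: sym_tuples_def m shift_vec_def)
    also have "\<dots> = (\<Prod>i=1..n. \<xi> i ^ w i) * (\<Prod>i=1..n. \<xi> i ^ h i) ^ m"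
      by (simp add: power_add power_mult prod.distrib prod_power_distrib mult.commute[of m])
    also have "(\<Prod>i=1..n. \<xi> i ^ h i) = 1" using \<xi> by (simp add: sym_tuples_def)
    finally show ?thesis by simp
  qed
  then show "w' \<in> {w' \<in> Wset d n. char_sim \<phi> d n h w' w}" using w' char_sim_iff[OF w' w] by simp
next
  fix w' assume "w' \<in> {w' \<in> Wset d n. char_sim \<phi> d n h w' w}"
  then have w': "w' \<in> Wset d n" and sim: "char_sim \<phi> d n h w' w" by auto
  let ?k = "\<lambda>i. w' i + w i * (d - 1)"
  have one: "\<phi> (\<Prod>i=1..n. \<xi> i ^ ?k i) = 1" if \<xi>: "\<xi> \<in> sym_tuples" for \<xi>
  proof -
    let ?c = "\<phi> (\<Prod>i=1..n. \<xi> i ^ w i)"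
    have "(\<Prod>i=1..n. \<xi> i ^ ?k i) = (\<Prod>i=1..n. \<xi> i ^ w' i) * (\<Prod>i=1..n. \<xi> i ^ w i) ^ (d - 1)"
      by (simp only: power_add power_mult prod.distrib prod_power_distrib)
    then have "\<phi> (\<Prod>i=1..n. \<xi> i ^ ?k i) = \<phi> (\<Prod>i=1..n. \<xi> i ^ w' i) * ?c ^ (d - 1)"
      by (simp only: mult_char_mult[OF phi_char] mult_char_power[OF phi_char])
    also have "\<phi> (\<Prod>i=1..n. \<xi> i ^ w' i) = ?c" using sim \<xi> char_sim_iff[OF w' w] by blast
    also have "?c * ?c ^ (d - 1) = ?c ^ d" using d_pos by (cases d) simp_all
    also have "\<dots> = \<phi> ((\<Prod>i=1..n. \<xi> i ^ w i) ^ d)" by (rule mult_char_power[OF phi_char, symmetric])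
    also have "(\<Prod>i=1..n. \<xi> i ^ w i) ^ d = 1"
      using mu_prod[of \<xi> w] \<xi> by (simp add: sym_tuples_def mu_def)
    finally show ?thesis by (simp only: mult_char_1[OF phi_char])
  qed
  have "of_nat (card sym_tuples) = (\<Sum>\<xi>\<in>sym_tuples. \<phi> (\<Prod>i=1..n. \<xi> i ^ ?k i) * 1)"
  proof -
    have "(\<Sum>\<xi>\<in>sym_tuples. \<phi> (\<Prod>i=1..n. \<xi> i ^ ?k i) * 1) = (\<Sum>\<xi>\<in>sym_tuples. 1)"
      by (intro sum.cong refl) (simp only: one mult_1_right)
    then show ?thesis by simp
  qed
  also have "\<dots> = 1 / of_nat d * (\<Sum>m<d. if \<forall>i\<in>{1..n}. d dvd ?k i + m * h i then of_nat d ^ n else 0)"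
    using sum_sym_tuples[of ?k "\<lambda>_. 1"] by (simp only: mult_1_right sum_over_mu_tuples)
  finally have avg: "of_nat (card sym_tuples)
      = 1 / of_nat d * (\<Sum>m<d. if \<forall>i\<in>{1..n}. d dvd ?k i + m * h i then of_nat d ^ n else 0 :: qbar)" .
  have "\<exists>m<d. \<forall>i\<in>{1..n}. d dvd ?k i + m * h i"
  proof (rule ccontr)
    assume none: "\<not> ?thesis"
    have "(\<Sum>m<d. if \<forall>i\<in>{1..n}. d dvd ?k i + m * h i then of_nat d ^ n else 0 :: qbar) = 0"
      by (rule sum.neutral) (use none in auto)
    then have "of_nat (card sym_tuples) = (0 :: qbar)" using avg by (simp only: mult_zero_right)
    then show False using d_pos by (simp add: card_sym_tuples)
  qed
  then obtain m where m: "m < d" "\<forall>i\<in>{1..n}. d dvd ?k i + m * h i" by blast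
  let ?m = "(d - m) mod d"
  have "w' = shift_vec w ?m"
  proof
    fix i show "w' i = shift_vec w ?m i"
    proof (cases "i \<in> {1..n}")
      case i: True
      obtain c where c: "?k i + m * h i = d * c" using m(2) i by blast
      have "(w i + ?m * h i) mod d = (w i + (d - m) * h i) mod d"
        by (metis mod_add_right_eq mod_mult_left_eq)
      also have "\<dots> = (w i + (d - m) * h i + d * c) mod d" by simp
      also have "w i + (d - m) * h i + d * c = w' i + d * (w i + h i)"
      proof -
        have "(d - m) * h i + m * h i = d * h i" using m(1) by (simp flip: distrib_right)
        moreover have "w i + w i * (d - 1) = d * w i" using d_pos by (cases d) simp_all
        ultimately show ?thesis unfolding c[symmetric] by (simp add: distrib_left)
      qed
      also have "(w' i + d * (w i + h i)) mod d = w' i" using Wset_less[OF w' i] by simp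
      finally show ?thesis using i by (simp add: shift_vec_def)
    next
      case False
      then show ?thesis using w' by (auto simp: shift_vec_def Wset_def PiE_def extensional_def)
    qed
  qed
  moreover have "?m < d" using d_pos by simp
  ultimately show "w' \<in> shift_vec w ` {..<d}" by blast
qed

lemma zero_vec_in_Wset: "zero_vec n \<in> Wset d n"
  using d_pos by (auto simp: Wset_def zero_vec_def)

lemma zero_part_eq:
  assumes w: "w \<in> Wset d n"
  shows "(\<Sum>m<d. zero_sum (shift_vec w m)) / (of_nat CARD('a) - 1) = Cterm \<phi> d n h w
    + (if char_sim \<phi> d n h (zero_vec n) w then (1 - of_nat CARD('a) ^ (n - 1)) / (1 - of_nat CARD('a))
        + (-1) ^ (n - 1) / of_nat CARD('a) - (of_nat CARD('a) - 1) ^ (n - 1) / of_nat CARD('a) else 0)"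
proof -
  let ?q = "of_nat CARD('a) :: qbar"
  let ?T = "(1 - ?q ^ (n - 1)) / (1 - ?q) + (-1) ^ (n - 1) / ?q - (?q - 1) ^ (n - 1) / ?q"
  let ?cl = "{w' \<in> Wset d n. char_sim \<phi> d n h w' w}"
  let ?mixed = "\<lambda>w'. (\<exists>i\<in>{1..n}. w' i = 0) \<and> \<not> (\<forall>i\<in>{1..n}. w' i = 0)"
  have q1: "?q - 1 \<noteq> 0" using card_field_ge_2[where 'a = 'a] by simp
  have fin: "finite ?cl" unfolding char_sim_class[OF w] by simp
  have "(\<Sum>m<d. zero_sum (shift_vec w m)) = (\<Sum>w'\<in>?cl. zero_sum w')"
    unfolding char_sim_class[OF w] by (simp only: sum.reindex[OF inj_on_shift_vec] comp_def)
  then have "(\<Sum>m<d. zero_sum (shift_vec w m)) / (?q - 1) = (\<Sum>w'\<in>?cl. zero_sum w' / (?q - 1))"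
    by (simp only: sum_divide_distrib)
  also have "\<dots> = (\<Sum>w'\<in>?cl. (if ?mixed w' then (-1) ^ (n - 1) * jacobi_w \<phi> d n w' else 0)
      + (if w' = zero_vec n then ?T else 0))"
  proof (rule sum.cong[OF refl])
    fix w' assume "w' \<in> ?cl"
    then have w': "w' \<in> Wset d n" by blast
    have dvd: "d dvd w' i \<longleftrightarrow> w' i = 0" if "i \<in> {1..n}" for i
      using Wset_less[OF w' that] by (auto dest: dvd_imp_le)
    have zv: "w' = zero_vec n \<longleftrightarrow> (\<forall>i\<in>{1..n}. w' i = 0)"
      using w' by (auto simp: zero_vec_def Wset_def fun_eq_iff PiE_def extensional_def)
    consider (none) "\<forall>i\<in>{1..n}. w' i \<noteq> 0" | (all) "\<forall>i\<in>{1..n}. w' i = 0" | (mixed) "?mixed w'"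
      by metis
    then show "zero_sum w' / (?q - 1) = (if ?mixed w' then (-1) ^ (n - 1) * jacobi_w \<phi> d n w' else 0)
        + (if w' = zero_vec n then ?T else 0)"
    proof cases
      case none
      have "zero_sum w' = 0" using none dvd by (intro zero_sum_no_zero) auto
      moreover have "\<not> ?mixed w'" using none by blast
      moreover have "w' \<noteq> zero_vec n"
      proof -
        have "1 \<in> {1..n}" using n_ge by simp
        then show ?thesis using none unfolding zv by blast
      qed
      ultimately show ?thesis by (simp only: if_False div_0 add_0)
    next
      case all
      have "zero_sum w' / (?q - 1) = ?T" using all dvd by (intro zero_sum_all_zero) auto
      moreover have "\<not> ?mixed w'" "w' = zero_vec n" using all zv by blast+
      ultimately show ?thesis by (simp only: if_False if_True add_0 simp_thms)
    next
      case mixed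
      then obtain i j where ij: "i \<in> {1..n}" "w' i = 0" "j \<in> {1..n}" "w' j \<noteq> 0" by blast
      have "zero_sum w' = (?q - 1) * ((-1) ^ (n - 1) * jacobi_w \<phi> d n w')"
        using ij dvd by (intro zero_sum_mixed[of i _ j] Wset_dvd[OF w']) auto
      then have "zero_sum w' / (?q - 1) = (-1) ^ (n - 1) * jacobi_w \<phi> d n w'" using q1 by simp
      moreover have "w' \<noteq> zero_vec n" using mixed zv by blast
      ultimately show ?thesis using mixed by (simp only: if_True if_False add_0_right simp_thms)
    qed
  qed
  also have "\<dots> = (\<Sum>w'\<in>?cl. if ?mixed w' then (-1) ^ (n - 1) * jacobi_w \<phi> d n w' else 0)
      + (\<Sum>w'\<in>?cl. if w' = zero_vec n then ?T else 0)"
    by (rule sum.distrib)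
  also have "(\<Sum>w'\<in>?cl. if ?mixed w' then (-1) ^ (n - 1) * jacobi_w \<phi> d n w' else 0) = Cterm \<phi> d n h w"
  proof -
    have "{w' \<in> ?cl. ?mixed w'} = {w' \<in> Wset d n. char_sim \<phi> d n h w' w \<and> ?mixed w'}" by blast
    then show ?thesis
      unfolding Cterm_def sum_distrib_left
      using sum.inter_filter[OF fin, of "\<lambda>w'. (-1) ^ (n - 1) * jacobi_w \<phi> d n w'" ?mixed] by (simp only:)
  qed
  also have "(\<Sum>w'\<in>?cl. if w' = zero_vec n then ?T else 0) = (if zero_vec n \<in> ?cl then ?T else 0)"
    by (rule sum.delta[OF fin])
  finally show ?thesis using zero_vec_in_Wset by (simp only: mem_Collect_eq simp_thms)
qed

end


section \<open>The number of twisted fixed points\<close>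

context diag_setup
begin

text \<open>By homogeneity the sum is q - 1 times its part on \<open>z\<^sub>1 + \<dots> + z\<^sub>n = 1\<close>; there the remaining
  condition is detected by summing over all characters.\<close>

lemma full_sum_eq_jacobi_sums:
  assumes w: "d dvd (\<Sum>i=1..n. w i)"
  shows "(\<Sum>y\<in>{1..n} \<rightarrow>\<^sub>E UNIV - {0}.
      if ((\<Sum>i=1..n. y i) / (of_nat d * lam)) ^ d = (\<Prod>i=1..n. y i ^ h i)
      then \<Prod>i=1..n. char_pow chi_d (w i) (y i) else 0)
    = (-1) ^ (n - 1) * (\<Sum>\<nu>\<in>mult_chars. \<nu> ((of_nat d * lam) ^ d)
        * jacobi_sum n (\<lambda>i. char_mult (char_pow chi_d (w i)) (char_pow \<nu> (h i))))"
proof -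
  let ?U = "{1..n} \<rightarrow>\<^sub>E UNIV - {0::'a}"
  let ?L = "\<lambda>s. {x \<in> ?U. (\<Sum>i=1..n. x i) = s}"
  let ?x0 = "(of_nat d * lam) ^ d"
  let ?ch = "\<lambda>y. \<Prod>i=1..n. char_pow chi_d (w i) (y i)"
  let ?F = "\<lambda>y. if ((\<Sum>i=1..n. y i) / (of_nat d * lam)) ^ d = (\<Prod>i=1..n. y i ^ h i) then ?ch y else 0"
  let ?E = "\<lambda>z. if ?x0 * (\<Prod>i=1..n. z i ^ h i) = 1 then ?ch z else 0"
  have "of_nat d * lam \<noteq> 0" using d_nz lam_nz by simp
  then have x0: "?x0 \<noteq> 0" by simp
  have prod_nz: "(\<Prod>i=1..n. y i ^ h i) \<noteq> 0" if "y \<in> ?U" for y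
    using that by (auto simp: PiE_def Pi_def)
  have "(\<Sum>y\<in>?U. ?F y) = (\<Sum>s\<in>UNIV. \<Sum>y\<in>?L s. ?F y)"
    by (rule sum.group[symmetric]) auto
  also have "\<dots> = (\<Sum>y\<in>?L 0. ?F y) + (\<Sum>s\<in>UNIV - {0}. \<Sum>y\<in>?L s. ?F y)"
    by (rule sum_UNIV_split)
  also have "(\<Sum>y\<in>?L 0. ?F y) = 0"
  proof (rule sum.neutral, rule ballI)
    fix y assume y: "y \<in> ?L 0"
    then have e0: "((\<Sum>i=1..n. y i) / (of_nat d * lam)) ^ d = 0" using d_pos by simp
    have "(\<Prod>i=1..n. y i ^ h i) \<noteq> 0" using prod_nz y by blast
    then have "((\<Sum>i=1..n. y i) / (of_nat d * lam)) ^ d \<noteq> (\<Prod>i=1..n. y i ^ h i)"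
      unfolding e0 by (rule not_sym)
    then show "?F y = 0" by (rule if_not_P)
  qed
  also have "(\<Sum>s\<in>UNIV - {0}. \<Sum>y\<in>?L s. ?F y) = (\<Sum>s\<in>UNIV - {0::'a}. \<Sum>z\<in>?L 1. ?E z)"
  proof (rule sum.cong[OF refl])
    fix s :: 'a assume "s \<in> UNIV - {0}"
    then have s: "s \<noteq> 0" by simp
    have "(\<Sum>y\<in>?L s. ?F y) = (\<Sum>z\<in>?L 1. ?F (\<lambda>i\<in>{1..n}. s * z i))"
      by (rule sum.reindex_bij_betw[OF bij_betw_scale[OF s], symmetric])
    also have "\<dots> = (\<Sum>z\<in>?L 1. ?E z)"
    proof (rule sum.cong[OF refl])
      fix z assume z: "z \<in> ?L 1"
      have "(\<Sum>i=1..n. (\<lambda>i\<in>{1..n}. s * z i) i) = s * (\<Sum>i=1..n. z i)" by (simp add: sum_distrib_left)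
      then have 1: "(\<Sum>i=1..n. (\<lambda>i\<in>{1..n}. s * z i) i) = s" using z by simp
      have 2: "(\<Prod>i=1..n. (\<lambda>i\<in>{1..n}. s * z i) i ^ h i) = s ^ d * (\<Prod>i=1..n. z i ^ h i)"
        by (simp add: power_mult_distrib prod.distrib h_sum[simplified] flip: power_sum)
      have "?ch (\<lambda>i\<in>{1..n}. s * z i) = (\<Prod>i=1..n. char_pow chi_d (w i) s) * ?ch z"
        by (simp add: mult_char_mult prod.distrib)
      also have "(\<Prod>i=1..n. char_pow chi_d (w i) s) = 1"
        using fun_cong[OF prod_chars_triv[OF w], of s] s by (simp only: triv_char_def if_False)
      finally have 3: "?ch (\<lambda>i\<in>{1..n}. s * z i) = ?ch z" by simp
      have "s ^ d / ?x0 = s ^ d * b \<longleftrightarrow> ?x0 * b = 1" for b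
        using s x0 by (simp add: field_simps)
      then have 4: "(s / (of_nat d * lam)) ^ d = s ^ d * (\<Prod>i=1..n. z i ^ h i)
          \<longleftrightarrow> ?x0 * (\<Prod>i=1..n. z i ^ h i) = 1"
        by (simp only: power_divide)
      show "?F (\<lambda>i\<in>{1..n}. s * z i) = ?E z" by (simp only: 1 2 3 4)
    qed
    finally show "(\<Sum>y\<in>?L s. ?F y) = (\<Sum>z\<in>?L 1. ?E z)" .
  qed
  also have "\<dots> = of_nat (CARD('a) - 1) * (\<Sum>z\<in>?L 1. ?E z)" by (simp add: card_Diff_singleton)
  also have "\<dots> = (\<Sum>z\<in>?L 1. ?ch z * (\<Sum>\<nu>\<in>mult_chars. \<nu> (?x0 * (\<Prod>i=1..n. z i ^ h i))))"
    unfolding sum_distrib_left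
  proof (rule sum.cong[OF refl])
    fix z assume z: "z \<in> ?L 1"
    then have "?x0 * (\<Prod>i=1..n. z i ^ h i) \<noteq> 0" using x0 prod_nz[of z] by simp
    then have "(\<Sum>\<nu>\<in>mult_chars. \<nu> (?x0 * (\<Prod>i=1..n. z i ^ h i)))
        = (if ?x0 * (\<Prod>i=1..n. z i ^ h i) = 1 then of_nat (CARD('a) - 1) else 0)"
      by (rule sum_over_mult_chars)
    then show "of_nat (CARD('a) - 1) * ?E z = (\<Sum>\<nu>\<in>mult_chars. ?ch z * \<nu> (?x0 * (\<Prod>i=1..n. z i ^ h i)))"
      unfolding sum_distrib_left[symmetric]
      by (simp only: if_distrib[of "\<lambda>x. _ * x"] mult_zero_right mult_zero_left mult.commute)
  qed
  also have "\<dots> = (\<Sum>\<nu>\<in>mult_chars. \<Sum>z\<in>?L 1. ?ch z * \<nu> (?x0 * (\<Prod>i=1..n. z i ^ h i)))"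
    unfolding sum_distrib_left by (rule sum.swap)
  also have "\<dots> = (\<Sum>\<nu>\<in>mult_chars. \<nu> ?x0
      * level_sum n (\<lambda>i. char_mult (char_pow chi_d (w i)) (char_pow \<nu> (h i))) 1)"
  proof (rule sum.cong[OF refl])
    fix \<nu> :: "'a \<Rightarrow> qbar" assume \<nu>: "\<nu> \<in> mult_chars"
    show "(\<Sum>z\<in>?L 1. ?ch z * \<nu> (?x0 * (\<Prod>i=1..n. z i ^ h i)))
      = \<nu> ?x0 * level_sum n (\<lambda>i. char_mult (char_pow chi_d (w i)) (char_pow \<nu> (h i))) 1"
      unfolding level_sum_def sum_distrib_left
    proof (rule sum.cong[OF refl])
      fix z assume z: "z \<in> ?L 1"
      have "\<nu> (\<Prod>i=1..n. z i ^ h i) = (\<Prod>i=1..n. char_pow \<nu> (h i) (z i))"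
        unfolding mult_char_prod[OF \<nu>]
        by (rule prod.cong[OF refl]) (use z in \<open>auto simp: mult_char_power[OF \<nu>] char_pow_def PiE_def Pi_def\<close>)
      then show "?ch z * \<nu> (?x0 * (\<Prod>i=1..n. z i ^ h i))
          = \<nu> ?x0 * (\<Prod>i=1..n. char_mult (char_pow chi_d (w i)) (char_pow \<nu> (h i)) (z i))"
        unfolding char_mult_def prod.distrib mult_char_mult[OF \<nu>, of ?x0] by (simp only: mult_ac)
    qed
  qed
  also have "\<dots> = (-1) ^ (n - 1) * (\<Sum>\<nu>\<in>mult_chars. \<nu> ?x0
        * jacobi_sum n (\<lambda>i. char_mult (char_pow chi_d (w i)) (char_pow \<nu> (h i))))"
    unfolding level_sum_eq_jacobi sum_distrib_left by (simp only: mult.left_commute)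
  finally show ?thesis by (simp only: add_0)
qed

lemma prod_twists:
  assumes w: "w \<in> Wset d n"
  shows "(\<lambda>x. \<Prod>i=1..n. char_mult (char_pow chi_d (w i)) (char_pow \<nu> (h i)) x) = char_pow \<nu> d"
proof
  fix x
  show "(\<Prod>i=1..n. char_mult (char_pow chi_d (w i)) (char_pow \<nu> (h i)) x) = char_pow \<nu> d x"
  proof (cases "x = 0")
    case True
    have "(\<Prod>i=1..n. char_mult (char_pow chi_d (w i)) (char_pow \<nu> (h i)) x) = 0"
      using n_ge True by (intro prod_zero bexI[of _ 1]) (auto simp: char_mult_def char_pow_def)
    then show ?thesis using True by (simp add: char_pow_def)
  next
    case False
    have "(\<Prod>i=1..n. char_mult (char_pow chi_d (w i)) (char_pow \<nu> (h i)) x)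
        = (\<Prod>i=1..n. char_pow chi_d (w i) x) * (\<Prod>i=1..n. \<nu> x ^ h i)"
      using False by (simp add: char_mult_def prod.distrib char_pow_def)
    also have "(\<Prod>i=1..n. char_pow chi_d (w i) x) = 1"
      using fun_cong[OF prod_chars_triv[OF Wset_dvd[OF w]], of x] False by (simp only: triv_char_def if_False)
    also have "(\<Prod>i=1..n. \<nu> x ^ h i) = \<nu> x ^ d" by (simp add: h_sum[simplified] flip: power_sum)
    also have "\<nu> x ^ d = char_pow \<nu> d x" using False by (simp add: char_pow_def)
    finally show ?thesis by (simp only: mult_1)
  qed
qed

text \<open>A character \<open>\<nu>\<close> for which all the characters \<open>\<phi>\<^sub>d\<^sup>w\<^sup>i\<nu>\<^sup>h\<^sup>i\<close> are trivial is of the form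
  \<open>\<phi>\<^sub>d\<^sup>t\<close> with \<open>w + th = 0\<close>, so there is one if w is a multiple of h, and none otherwise.\<close>

lemma sum_trivial_twists:
  assumes w: "w \<in> Wset d n"
  shows "(\<Sum>\<nu>\<in>mult_chars. \<nu> ((of_nat d * lam) ^ d)
      * (if \<forall>i\<in>{1..n}. char_mult (char_pow chi_d (w i)) (char_pow \<nu> (h i)) = triv_char then c else 0))
    = (if char_sim \<phi> d n h (zero_vec n) w then c else 0)"
proof -
  let ?x0 = "(of_nat d * lam) ^ d"
  let ?Q = "\<lambda>\<nu>. \<forall>i\<in>{1..n}. char_mult (char_pow chi_d (w i)) (char_pow \<nu> (h i)) = triv_char"
  have x0: "of_nat d * lam \<noteq> 0" using d_nz lam_nz by simp
  have Qt: "?Q (char_pow chi_d t) \<longleftrightarrow> shift_vec w t = zero_vec n" for t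
  proof -
    have "?Q (char_pow chi_d t) \<longleftrightarrow> (\<forall>i\<in>{1..n}. d dvd w i + t * h i)"
      by (simp only: char_pow_char_pow char_mult_char_pow char_pow_chi_d_eq_triv_iff)
    also have "\<dots> \<longleftrightarrow> shift_vec w t = zero_vec n"
      by (auto simp: shift_vec_def zero_vec_def fun_eq_iff dvd_eq_mod_eq_0)
    finally show ?thesis .
  qed
  have Qtors: "\<exists>t<d. \<nu> = char_pow chi_d t" if \<nu>: "\<nu> \<in> mult_chars" and Q: "?Q \<nu>" for \<nu>
  proof -
    have "char_pow \<nu> d = (\<lambda>x. \<Prod>i=1..n. triv_char x)"
      unfolding prod_twists[OF w, symmetric] using Q by (intro ext prod.cong) (auto simp only:)
    also have "\<dots> = triv_char" using n_ge by (auto simp: triv_char_def fun_eq_iff)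
    finally show ?thesis by (simp only: char_pow_d_eq_triv_iff[OF \<nu>])
  qed
  have sim: "char_sim \<phi> d n h (zero_vec n) w \<longleftrightarrow> zero_vec n \<in> shift_vec w ` {..<d}"
    using zero_vec_in_Wset unfolding char_sim_class[OF w, symmetric] by blast
  have "(\<Sum>\<nu>\<in>mult_chars. \<nu> ?x0 * (if ?Q \<nu> then c else 0)) = (\<Sum>\<nu>\<in>{\<nu> \<in> mult_chars. ?Q \<nu>}. \<nu> ?x0 * c)"
    unfolding sum.inter_filter[OF finite_mult_chars] by (intro sum.cong refl) (simp only: if_distrib[of "\<lambda>x. _ * x"] mult_zero_right)
  also have "\<dots> = (if char_sim \<phi> d n h (zero_vec n) w then c else 0)"
  proof (cases "char_sim \<phi> d n h (zero_vec n) w")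
    case True
    then obtain t where t: "t < d" "shift_vec w t = zero_vec n" unfolding sim by (metis imageE lessThan_iff)
    have "{\<nu> \<in> mult_chars. ?Q \<nu>} = {char_pow chi_d t}"
    proof (intro equalityI subsetI)
      fix \<nu> assume "\<nu> \<in> {\<nu> \<in> mult_chars. ?Q \<nu>}"
      then have \<nu>: "\<nu> \<in> mult_chars" "?Q \<nu>" by blast+
      then obtain t' where t': "t' < d" "\<nu> = char_pow chi_d t'" using Qtors by blast
      then have "shift_vec w t' = zero_vec n" using \<nu>(2) Qt by blast
      then have "shift_vec w t' = shift_vec w t" using t(2) by simp
      then have "t' = t" by (rule inj_onD[OF inj_on_shift_vec]) (use t(1) t'(1) in simp_all)
      then show "\<nu> \<in> {char_pow chi_d t}" using t' by blast
    next
      fix \<nu> assume "\<nu> \<in> {char_pow chi_d t}"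
      then show "\<nu> \<in> {\<nu> \<in> mult_chars. ?Q \<nu>}" using Qt[of t] t(2) by simp
    qed
    moreover have "char_pow chi_d t ?x0 = 1"
    proof -
      have "char_pow chi_d t ?x0 = char_pow (char_pow chi_d t) d (of_nat d * lam)"
        using x0 by (simp add: char_pow_def mult_char_power flip: power_mult) (simp add: mult.commute)
      also have "char_pow (char_pow chi_d t) d = triv_char"
        by (simp add: char_pow_char_pow char_pow_chi_d_eq_triv_iff)
      finally show ?thesis using x0 by (simp add: triv_char_def)
    qed
    ultimately show ?thesis using True by simp
  next
    case False
    have "{\<nu> \<in> mult_chars. ?Q \<nu>} = {}"
    proof (rule ccontr)
      assume "\<not> ?thesis"
      then obtain \<nu> where \<nu>: "\<nu> \<in> mult_chars" "?Q \<nu>" by blast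
      then obtain t where t: "t < d" "\<nu> = char_pow chi_d t" using Qtors by blast
      then have "zero_vec n = shift_vec w t" using \<nu>(2) Qt by metis
      then have "zero_vec n \<in> shift_vec w ` {..<d}" using t(1) by (intro image_eqI) auto
      then show False using False sim by blast
    qed
    then show ?thesis unfolding if_not_P[OF False] by (simp only: sum.empty)
  qed
  finally show ?thesis .
qed

text \<open>The Jacobi sums are quotients of Gauss sums, and these are the terms of the hypergeometric function.
  The Jacobi sum of n trivial characters is the exception, and it accounts for the additional term.\<close>

lemma full_sum_eq_Fw:
  assumes w: "w \<in> Wset d n"
  shows "(\<Sum>y\<in>{1..n} \<rightarrow>\<^sub>E UNIV - {0}.
      if ((\<Sum>i=1..n. y i) / (of_nat d * lam)) ^ d = (\<Prod>i=1..n. y i ^ h i)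
      then \<Prod>i=1..n. char_pow chi_d (w i) (y i) else 0) / (of_nat CARD('a) - 1)
    = (-1) ^ n * ((\<Prod>i=1..n. gauss_sum \<psi> (char_pow chi_d (w i))) / of_nat CARD('a)) * Fw \<psi> \<phi> d n h w lam
      + (if char_sim \<phi> d n h (zero_vec n) w then (of_nat CARD('a) - 1) ^ (n - 1) / of_nat CARD('a) else 0)"
proof -
  let ?q = "of_nat CARD('a) :: qbar"
  let ?x0 = "(of_nat d * lam) ^ d"
  let ?G = "\<Prod>i=1..n. gauss_sum \<psi> (char_pow chi_d (w i))"
  let ?eta = "\<lambda>\<nu> i. char_mult (char_pow chi_d (w i)) (char_pow \<nu> (h i))"
  let ?b = "\<lambda>\<nu>. (\<Prod>i=1..n. gauss_sum \<psi> (?eta \<nu> i)) / gauss_sum0 \<psi> (char_pow \<nu> d)"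
  let ?S = "\<Sum>\<nu>\<in>mult_chars. \<nu> ?x0 * ?b \<nu>"
  let ?c = "(1 - ?q) ^ n / ?q"
  let ?e = "\<lambda>x. if char_sim \<phi> d n h (zero_vec n) w then x else 0"
  obtain n' where n': "n = Suc n'" using n_ge by (cases n) auto
  have n1: "n \<ge> 1" using n_ge by simp
  have q0: "?q \<noteq> 0" and q1: "?q - 1 \<noteq> 0" using card_field_ge_2[where 'a = 'a] by simp_all
  have G0: "?G \<noteq> 0" by (simp add: gauss_sum_nonzero)
  have jac: "jacobi_sum n (?eta \<nu>) = ?b \<nu> - (if \<forall>i\<in>{1..n}. ?eta \<nu> i = triv_char then ?c else 0)"
    if \<nu>: "\<nu> \<in> mult_chars" for \<nu>
  proof -
    have "(\<lambda>x. \<Prod>i=1..n. ?eta \<nu> i x) = char_pow \<nu> d" by (rule prod_twists[OF w])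
    then show ?thesis using jacobi_sum_eq_gauss_sums[OF n1, of "?eta \<nu>"] \<nu> by (simp only:) simp
  qed
  have S: "?S = Fw \<psi> \<phi> d n h w lam * ?G * (1 - ?q) / ?q"
    unfolding Fw_eq using G0 q0 q1 by simp
  have "(\<Sum>\<nu>\<in>mult_chars. \<nu> ?x0 * jacobi_sum n (?eta \<nu>))
      = (\<Sum>\<nu>\<in>mult_chars. \<nu> ?x0 * ?b \<nu> - \<nu> ?x0 * (if \<forall>i\<in>{1..n}. ?eta \<nu> i = triv_char then ?c else 0))"
    by (intro sum.cong refl) (simp only: jac right_diff_distrib)
  also have "\<dots> = ?S - ?e ?c" by (simp only: sum_subtractf sum_trivial_twists[OF w])
  finally have main: "(\<Sum>\<nu>\<in>mult_chars. \<nu> ?x0 * jacobi_sum n (?eta \<nu>)) = ?S - ?e ?c" .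
  have pw: "(-1) ^ n' * ?e ?c = - ((?q - 1) * ?e ((?q - 1) ^ n' / ?q))"
  proof (cases "char_sim \<phi> d n h (zero_vec n) w")
    case True
    have "(1 - ?q) ^ n = ((-1) * (?q - 1)) ^ n" by simp
    also have "\<dots> = - ((-1) ^ n' * ((?q - 1) * (?q - 1) ^ n'))" unfolding power_mult_distrib by (simp add: n')
    finally have "(-1) ^ n' * (1 - ?q) ^ n = - ((?q - 1) * (?q - 1) ^ n')"
      by (simp only: mult_minus_right neg_one_power_cancel)
    then show ?thesis unfolding if_P[OF True] times_divide_eq_right minus_divide_left by (simp only:)
  qed (simp only: if_False mult_zero_right minus_zero)
  have fin: "(s * (F * G * (1 - q) / q) + (q - 1) * E) / (q - 1) = (- s) * (G / q) * F + E"
    if "q \<noteq> 0" "q - 1 \<noteq> 0" for s F G q E :: qbar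
  proof -
    have "s * (F * G * (1 - q) / q) = (q - 1) * ((- s) * (G / q) * F)"
      using that(1) by (simp add: field_simps)
    then have "s * (F * G * (1 - q) / q) + (q - 1) * E = (q - 1) * ((- s) * (G / q) * F + E)"
      by (simp only: distrib_left)
    then show ?thesis using nonzero_mult_div_cancel_left[OF that(2)] by (simp only:)
  qed
  have "(-1) ^ n' * (?S - ?e ?c) / (?q - 1)
      = ((-1) ^ n' * (Fw \<psi> \<phi> d n h w lam * ?G * (1 - ?q) / ?q) + (?q - 1) * ?e ((?q - 1) ^ n' / ?q)) / (?q - 1)"
    unfolding right_diff_distrib pw S by (simp only: diff_minus_eq_add)
  also have "\<dots> = (- ((-1) ^ n')) * (?G / ?q) * Fw \<psi> \<phi> d n h w lam + ?e ((?q - 1) ^ n' / ?q)"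
    by (rule fin[OF q0 q1])
  also have "- ((-1) ^ n') = ((-1) ^ n :: qbar)" by (simp add: n')
  also have "n' = n - 1" by (simp add: n')
  finally show ?thesis
    unfolding full_sum_eq_jacobi_sums[OF Wset_dvd[OF w]] main by (simp only: n' diff_Suc_1)
qed

text \<open>The additional term from the vectors with nonzero coordinates cancels against the one from the
  vectors with vanishing coordinates.\<close>

lemma N1_formula:
  assumes w: "w \<in> Wset d n"
  shows "N1 \<phi> d n h lam w
    = (-1) ^ n * ((\<Prod>i=1..n. gauss_sum \<psi> (char_pow chi_d (w i))) / of_nat CARD('a)) * Fw \<psi> \<phi> d n h w lam
      + (if char_sim \<phi> d n h (zero_vec n) w
         then (1 - of_nat CARD('a) ^ (n - 1)) / (1 - of_nat CARD('a)) + (-1) ^ (n - 1) / of_nat CARD('a) else 0)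
      + Cterm \<phi> d n h w"
proof -
  let ?q = "of_nat CARD('a) :: qbar"
  let ?A = "\<Sum>y\<in>{1..n} \<rightarrow>\<^sub>E UNIV - {0}.
      if ((\<Sum>i=1..n. y i) / (of_nat d * lam)) ^ d = (\<Prod>i=1..n. y i ^ h i)
      then \<Prod>i=1..n. char_pow chi_d (w i) (y i) else 0"
  let ?Z = "\<Sum>m<d. zero_sum (shift_vec w m)"
  let ?D = "of_nat (d ^ (n - 1)) :: qbar"
  have D0: "?D \<noteq> 0" using d_pos by simp
  have "(\<Sum>\<xi>\<in>sym_tuples. \<phi> (\<Prod>i=1..n. \<xi> i ^ w i) * of_nat (card (twisted_sols \<xi>))) = ?D * ?A + ?D * ?Z"
    unfolding card_twisted_sols_split distrib_left sum.distrib full_part zero_part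
    by (simp only: shift_vec_def)
  then have "N1 \<phi> d n h lam w = 1 / (?D * (?q - 1)) * (?D * (?A + ?Z))"
    unfolding N1_eq[OF w] by (simp only: distrib_left)
  also have "\<dots> = ?A / (?q - 1) + ?Z / (?q - 1)"
  proof -
    have "1 / (D * r) * (D * (A + Z)) = A / r + Z / r" if "D \<noteq> 0" for D r A Z :: qbar
      using that by (simp add: add_divide_distrib)
    then show ?thesis using D0 .
  qed
  finally show ?thesis unfolding full_sum_eq_Fw[OF w] zero_part_eq[OF w] by simp
qed

lemma jacobi_w_eq_gauss_sums:
  assumes w: "w \<in> Wset d n" and "w \<noteq> zero_vec n"
  shows "(\<Prod>i=1..n. gauss_sum \<psi> (char_pow chi_d (w i))) / of_nat CARD('a) = jacobi_w \<phi> d n w"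
proof -
  have n1: "n \<ge> 1" using n_ge by simp
  have "\<exists>i\<in>{1..n}. w i \<noteq> 0"
  proof (rule ccontr)
    assume "\<not> ?thesis"
    then have "w = zero_vec n"
      using assms(1) by (auto simp: zero_vec_def Wset_def fun_eq_iff PiE_def extensional_def)
    then show False using assms(2) by contradiction
  qed
  then obtain i where i: "i \<in> {1..n}" "w i \<noteq> 0" by blast
  then have "\<not> d dvd w i" using Wset_less[OF w i(1)] by (auto dest: dvd_imp_le)
  then have nt: "\<not> (\<forall>i\<in>{1..n}. char_pow chi_d (w i) = triv_char)"
    using i(1) by (auto simp: char_pow_chi_d_eq_triv_iff)
  have "jacobi_sum n (\<lambda>i. char_pow chi_d (w i))
      = (\<Prod>i=1..n. gauss_sum \<psi> (char_pow chi_d (w i))) / (of_nat CARD('a) * 1) - 0"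
    using jacobi_sum_eq_gauss_sums[OF n1, of "\<lambda>i. char_pow chi_d (w i)"]
    unfolding if_not_P[OF nt] prod_chars_triv[OF Wset_dvd[OF w]] gauss_sum0_triv gauss_sum_triv by simp
  then show ?thesis by (simp add: jacobi_w_eq)
qed

lemma char_sim_mult_vec:
  assumes "mult_vec d n m h \<in> Wset d n"
  shows "char_sim \<phi> d n h (zero_vec n) (mult_vec d n m h)"
proof -
  have "(\<Prod>i=1..n. \<xi> i ^ zero_vec n i) = (\<Prod>i=1..n. \<xi> i ^ mult_vec d n m h i)"
    if \<xi>: "\<xi> \<in> sym_tuples" for \<xi>
  proof -
    have "(\<Prod>i=1..n. \<xi> i ^ mult_vec d n m h i) = (\<Prod>i=1..n. \<xi> i ^ (h i * m))"
      using \<xi> by (intro prod_power_mod_exponents) (auto simp: sym_tuples_def mult_vec_def mult.commute)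
    also have "\<dots> = (\<Prod>i=1..n. \<xi> i ^ h i) ^ m" by (simp only: power_mult prod_power_distrib)
    also have "\<dots> = 1" using \<xi> by (simp add: sym_tuples_def)
    finally show ?thesis by (simp add: zero_vec_def)
  qed
  then show ?thesis unfolding char_sim_iff[OF zero_vec_in_Wset assms] by simp
qed

lemma mult_vec_eq_zero_vec_iff:
  assumes "m < d"
  shows "mult_vec d n m h = zero_vec n \<longleftrightarrow> m = 0"
proof
  assume eq: "mult_vec d n m h = zero_vec n"
  have "d dvd m * h i" if "i \<in> {1..n}" for i
    using fun_cong[OF eq, of i] that by (simp add: mult_vec_def zero_vec_def dvd_eq_mod_eq_0)
  then have "d dvd m" by (rule d_dvd_if_dvd_mult_h)
  then show "m = 0" using assms by (auto dest: dvd_imp_le)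
qed (simp add: mult_vec_def zero_vec_def)

end

theorem theorem3p4:
  fixes \<psi> \<phi> :: "'a::{field,finite} \<Rightarrow> qbar"
    and d n :: nat and h w :: "nat \<Rightarrow> nat" and lam :: 'a
  assumes "nontrivial_add_char \<psi>" and "char_generator \<phi>"
    and "d \<ge> 2" and "n \<ge> 2"
    and "\<forall>i\<in>{1..n}. h i \<ge> 1" and "(\<Sum>i=1..n. h i) = d"
    and "Gcd (insert d (h ` {1..n})) = 1"
    and "\<forall>i\<in>{1..n}. d * h i dvd CARD('a) - 1"
    and "lam \<noteq> 0" and "w \<in> Wset d n"
  shows "(\<forall>m\<in>{0..d-1}. w = mult_vec d n m h \<longrightarrow>
            N1 \<phi> d n h lam w =
              (let \<delta> = (if m = 0 then 1 else 0 :: nat); q = of_nat CARD('a) :: qbar in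
                 (-1) ^ n / q ^ \<delta> * jacobi_w \<phi> d n w ^ (1 - \<delta>) * Fw \<psi> \<phi> d n h w lam
                 + (1 - q ^ (n - 1)) / (1 - q) + (-1) ^ (n - 1) / q + Cterm \<phi> d n h w))
       \<and> (\<not> char_sim \<phi> d n h w (zero_vec n) \<longrightarrow>
            N1 \<phi> d n h lam w =
              (-1) ^ n * jacobi_w \<phi> d n w * Fw \<psi> \<phi> d n h w lam + Cterm \<phi> d n h w)"
proof -
  interpret diag_setup \<psi> \<phi> d n h lam
    by unfold_locales (use assms in auto)
  note w = assms(10)
  note N = N1_formula[OF w]
  show ?thesis
  proof (intro conjI ballI impI)
    fix m assume m: "m \<in> {0..d-1}" "w = mult_vec d n m h"
    have sim: "char_sim \<phi> d n h (zero_vec n) w" using char_sim_mult_vec w m(2) by blast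
    have md: "m < d" using m(1) d_pos by auto
    show "N1 \<phi> d n h lam w =
      (let \<delta> = (if m = 0 then 1 else 0 :: nat); q = of_nat CARD('a) :: qbar in
         (-1) ^ n / q ^ \<delta> * jacobi_w \<phi> d n w ^ (1 - \<delta>) * Fw \<psi> \<phi> d n h w lam
         + (1 - q ^ (n - 1)) / (1 - q) + (-1) ^ (n - 1) / q + Cterm \<phi> d n h w)"
    proof (cases "m = 0")
      case True
      then have "w = zero_vec n" using m(2) mult_vec_eq_zero_vec_iff[OF md] by (simp only:)
      then have "w i = 0" if "i \<in> {1..n}" for i using that by (simp add: zero_vec_def)
      then have "(\<Prod>i=1..n. gauss_sum \<psi> (char_pow chi_d (w i))) = 1"
        by (intro prod.neutral ballI) (simp add: gauss_sum_triv)
      then show ?thesis unfolding N if_P[OF sim] using True by (simp add: add.assoc Let_def)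
    next
      case False
      then have "w \<noteq> zero_vec n" unfolding m(2) mult_vec_eq_zero_vec_iff[OF md] .
      then show ?thesis unfolding N if_P[OF sim] jacobi_w_eq_gauss_sums[OF w \<open>w \<noteq> zero_vec n\<close>]
        using False by (simp add: add.assoc Let_def)
    qed
  next
    assume ns: "\<not> char_sim \<phi> d n h w (zero_vec n)"
    then have "\<not> char_sim \<phi> d n h (zero_vec n) w" unfolding char_sim_def by metis
    moreover have "w \<noteq> zero_vec n" using ns by (auto simp: char_sim_def)
    ultimately show "N1 \<phi> d n h lam w =
        (-1) ^ n * jacobi_w \<phi> d n w * Fw \<psi> \<phi> d n h w lam + Cterm \<phi> d n h w"
      unfolding N using jacobi_w_eq_gauss_sums[OF w] by simp
  qed
qed

end
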